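(* Let $\boldsymbol{\mathcal P} \subset \mathbb K^n$ be a polyhedron over Puiseux series and $\boldsymbol c \in \mathbb K^n$ such that: (i) $\boldsymbol{\mathcal P} \subset \mathbb K_{\ge 0}^n$ and $0 \in \boldsymbol{\mathcal P}$; (ii) the image $\operatorname{val}\boldsymbol{\mathcal P}\subset\mathbb T^n$ of $\boldsymbol{\mathcal P}$ under the valuation map is a regular set, i.e., it is equal to the closure of its interior; (iii) $\boldsymbol c \in (\mathbb K_{>0})^n$. Then the tropical entropic central path associated with $(\boldsymbol{\mathcal P},\boldsymbol c)$ is a piecewise linear function (of the parameter $\mu\in\mathbb R$) which coincides with the projection on the $x$-coordinates of the tropical logarithmic central path associated with $(\boldsymbol{\mathcal P},\boldsymbol c)$.
   Context: Field $\mathbb K$: the field of absolutely convergent generalized real Puiseux series, i.e., series $\boldsymbol z=\sum_{\alpha\in\mathbb R} c_\alpha t^\alpha$ such that (a) the support $\{\alpha\in\mathbb R : c_\alpha\neq 0\}$ is either finite or has $-\infty$ as its unique accumulation point; (b) the coefficients $c_\alpha$ are real and the series is absolutely convergent for all sufficiently large real $t$ (written $t\gg 1$). For such $t$, $\boldsymbol z(t)\in\mathbb R$ is the value of the series; evaluation of vectors and matrices is entrywise. $\mathbb K$ is totally ordered by $\boldsymbol x\le\boldsymbol y$ iff $\boldsymbol x=\boldsymbol y$ or the coefficient of the leading term (greatest exponent) of $\boldsymbol y-\boldsymbol x$ is positive. $\mathbb K_{\ge0}$ and $\mathbb K_{>0}$ are the sets of nonnegative and positive elements. The valuation $\operatorname{val}\boldsymbol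 z$ is the greatest element of the support of $\boldsymbol z$ ($-\infty$ if $\boldsymbol z=0$), extended entrywise to vectors. $\log_t(\cdot)=\log(\cdot)/\log t$, applied entrywise to vectors. $\mathbb T=\mathbb R\cup\{-\infty\}$, and $\mathbb T^n$ has its usual topology. A polyhedron over Puiseux series is a set $\{\boldsymbol x\in\mathbb K^n:\boldsymbol M\boldsymbol x\le\boldsymbol d\}$ given by a matrix $\boldsymbol M$ and a vector $\boldsymbol d$ over $\mathbb K$; for $t\gg1$, $\boldsymbol{\mathcal P}(t)=\{x\in\mathbb R^n:\boldsymbol M(t)x\le\boldsymbol d(t)\}$. Entropic central path: for a polyhedron $\mathcal P\subset\mathbb R^n$, let $f_{\mathcal P}(\theta)=\log\int_{\mathcal P}e^{\langle\theta,x\rangle}dx$ and let $f^*_{\mathcal P}$ be its Fenchel conjugate (the entropic barrier). For $c\in\mathbb R^n$ and $\mu>0$, $\mathcal C_{\mathcal P,c}(\mu)$ is the unique optimal solution of: minimize $\langle c,x\rangle+\mu f^*_{\mathcal P}(x)$ subject to $x\in\operatorname{int}\mathcal P$. The tropical entropic central path is the function mapping $\mu\in\mathbb R$ to $\lim_{t\to+\infty}\log_t\mathcal C_{\boldsymbol{\mathcal P}(t),\boldsymbol c(t)}(\boldsymbol\mu(t))$, where $\boldsymbol\mu\in\mathbb K_{>0}$ is any element with $\operatorname{val}\boldsymbol\mu=\mu$ (under the hypotheses of the claim, this limit exists and depends only on $\operatorname{val}\boldsymbol\mu$). Tropical logarithmic central path: write $\boldsymbol{\mathcal P}=\{\boldsymbol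 x\in\mathbb K_{\ge0}^n:\boldsymbol A\boldsymbol x\le\boldsymbol b\}$ with $\boldsymbol A\in\mathbb K^{m\times n}$, $\boldsymbol b\in\mathbb K^m$, where no row of $\boldsymbol A$ is zero. For $t\gg1$ and a real parameter $\nu>0$, the point of the (primal-dual) logarithmic central path of the linear program "minimize $\langle\boldsymbol c(t),x\rangle$ subject to $\boldsymbol A(t)x+w=\boldsymbol b(t)$, $x\ge0$, $w\ge0$" (whose dual feasible set is given by $s-\boldsymbol A(t)^\top y=\boldsymbol c(t)$, $s\ge0$, $y\ge0$) is the unique quadruple $(x,w,s,y)$ with all entries positive satisfying $\boldsymbol A(t)x+w=\boldsymbol b(t)$, $s-\boldsymbol A(t)^\top y=\boldsymbol c(t)$, $x_js_j=\nu$ for all $j$ and $w_iy_i=\nu$ for all $i$. The tropical logarithmic central path is the function mapping $\mu\in\mathbb R$ to the limit as $t\to+\infty$ of $\log_t$ (entrywise) of this point taken with $\nu=\boldsymbol\mu(t)$, where $\boldsymbol\mu\in\mathbb K_{>0}$ is any element with $\operatorname{val}\boldsymbol\mu=\mu$ (the limit depends only on $\operatorname{val}\boldsymbol\mu$). *)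

theory Defs
  imports "HOL-Analysis.Analysis"
begin

section \<open>Absolutely convergent generalized real Puiseux series\<close>

text \<open>Accumulation points are taken in the extended reals, so that \<open>-\<infinity>\<close> can be one.\<close>

definition puiseux_support :: "real set \<Rightarrow> bool" where
  "puiseux_support S \<longleftrightarrow> finite S \<or> {x::ereal. x islimpt (ereal ` S)} = {-\<infinity>}"

definition series_converges_at :: "(real \<Rightarrow> real) \<Rightarrow> real \<Rightarrow> bool" where
  "series_converges_at c t \<longleftrightarrow> (\<lambda>\<alpha>. \<bar>c \<alpha> * t powr \<alpha>\<bar>) summable_on UNIV"

definition is_puiseux :: "(real \<Rightarrow> real) \<Rightarrow> bool" where
  "is_puiseux c \<longleftrightarrow>
     puiseux_support {\<alpha>. c \<alpha> \<noteq> 0} \<and> eventually (series_converges_at c) at_top"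

lemma abs_summable_iff_real:
  fixes f :: "'a \<Rightarrow> real"
  shows "(\<lambda>x. \<bar>f x\<bar>) summable_on A \<longleftrightarrow> f summable_on A"
  using summable_on_iff_abs_summable_on_real[of f A] by simp

lemma puiseux_support_iff: "puiseux_support S \<longleftrightarrow> (\<forall>r. finite (S \<inter> {r..}))"
proof
  assume S: "puiseux_support S"
  show "\<forall>r. finite (S \<inter> {r..})"
  proof (rule allI, rule ccontr)
    fix r assume inf: "infinite (S \<inter> {r..})"
    then have inf': "infinite (ereal ` (S \<inter> {r..}))"
      by (simp add: finite_image_iff)
    have "compact {ereal r..}"
      using compact_Int_closed[OF compact_UNIV closed_atLeast[of "ereal r"]] by simp
    moreover have "ereal ` (S \<inter> {r..}) \<subseteq> {ereal r..}" by auto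
    ultimately have "\<exists>l\<in>{ereal r..}. l islimpt (ereal ` (S \<inter> {r..}))"
      using Heine_Borel_imp_Bolzano_Weierstrass inf' by metis
    then obtain l where l: "ereal r \<le> l" "l islimpt (ereal ` (S \<inter> {r..}))" by auto
    then have "l islimpt (ereal ` S)"
      by (meson image_mono inf_le1 islimpt_subset)
    moreover have "infinite S" using inf by blast
    ultimately have "l = -\<infinity>" using S unfolding puiseux_support_def by auto
    with l show False by simp
  qed
next
  assume S: "\<forall>r. finite (S \<inter> {r..})"
  show "puiseux_support S"
  proof (cases "finite S")
    case False
    have "(x islimpt (ereal ` S)) = (x = -\<infinity>)" for x
    proof
      assume x: "x islimpt (ereal ` S)"
      show "x = -\<infinity>"
      proof (rule ccontr)
        assume "x \<noteq> -\<infinity>"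
        then obtain r where r: "ereal r < x"
          using ereal_dense2[of "-\<infinity>" x] by auto
        have "infinite ({ereal r<..} \<inter> (ereal ` S))"
          using x r unfolding islimpt_eq_acc_point by (auto simp: open_greaterThan)
        moreover have "{ereal r<..} \<inter> (ereal ` S) \<subseteq> ereal ` (S \<inter> {r..})" by auto
        ultimately show False using S finite_subset by blast
      qed
    next
      assume "x = -\<infinity>"
      moreover have "- \<infinity> islimpt (ereal ` S)"
      proof (rule islimptI)
        fix T :: "ereal set" assume T: "- \<infinity> \<in> T" "open T"
        then obtain r where r: "{..<ereal r} \<subseteq> T"
          using open_MInfty by blast
        have "\<not> S \<subseteq> {r..}" using S False by (metis Int_absorb2)
        then obtain y where "y \<in> S" "y < r" unfolding subset_iff atLeast_iff not_le[symmetric] by blast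
        then show "\<exists>y\<in>ereal ` S. y \<in> T \<and> y \<noteq> - \<infinity>"
          using r by (intro bexI[of _ "ereal y"]) auto
      qed
      ultimately show "x islimpt (ereal ` S)" by simp
    qed
    then show ?thesis unfolding puiseux_support_def by auto
  qed (simp add: puiseux_support_def)
qed

typedef puiseux = "{c. is_puiseux c}"
  morphisms coef Abs_puiseux
  by (rule exI[of _ "\<lambda>_. 0"]) (simp add: is_puiseux_def puiseux_support_def series_converges_at_def[abs_def])

setup_lifting type_definition_puiseux

definition pval :: "puiseux \<Rightarrow> real \<Rightarrow> real" where
  "pval z t = (\<Sum>\<^sub>\<infinity>\<alpha>. coef z \<alpha> * t powr \<alpha>)"

lemma finite_support_ge: "finite {\<alpha>. coef z \<alpha> \<noteq> 0 \<and> r \<le> \<alpha>}"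
proof -
  have "is_puiseux (coef z)" using coef by blast
  then have "finite ({\<alpha>. coef z \<alpha> \<noteq> 0} \<inter> {r..})"
    by (auto simp: is_puiseux_def puiseux_support_iff)
  then show ?thesis by (simp add: Int_def)
qed

lemma eventually_converges: "eventually (series_converges_at (coef z)) at_top"
  using coef[of z] by (simp add: is_puiseux_def)

lemma is_puiseuxI:
  assumes "\<And>r. finite {\<alpha>. c \<alpha> \<noteq> 0 \<and> r \<le> \<alpha>}" "eventually (series_converges_at c) at_top"
  shows "is_puiseux c"
  using assms by (simp add: is_puiseux_def puiseux_support_iff Int_def)

lemma ex_support_bound: "\<exists>B. \<forall>\<alpha>. coef y \<alpha> \<noteq> 0 \<longrightarrow> \<alpha> \<le> B"
proof (intro exI allI impI)
  fix \<alpha> assume \<alpha>: "coef y \<alpha> \<noteq> 0"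
  let ?S = "insert 0 {\<alpha>. coef y \<alpha> \<noteq> 0 \<and> 0 \<le> \<alpha>}"
  have "finite ?S" using finite_support_ge[of y 0] by simp
  then have "0 \<le> Max ?S" "0 \<le> \<alpha> \<Longrightarrow> \<alpha> \<le> Max ?S" using \<alpha> by (intro Max_ge; simp)+
  then show "\<alpha> \<le> Max ?S" by linarith
qed

lemma finite_convolution:
  "finite {\<beta>. coef x \<beta> \<noteq> 0 \<and> coef y (\<alpha> - \<beta>) \<noteq> 0}"
proof -
  obtain B where B: "\<And>\<alpha>. coef y \<alpha> \<noteq> 0 \<Longrightarrow> \<alpha> \<le> B"
    using ex_support_bound by blast
  have "\<alpha> - B \<le> \<beta>" if "coef y (\<alpha> - \<beta>) \<noteq> 0" for \<beta> using B[OF that] by simp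
  then show ?thesis
    by (intro finite_subset[OF _ finite_support_ge[of x "\<alpha> - B"]]) auto
qed

definition convolution :: "(real \<Rightarrow> real) \<Rightarrow> (real \<Rightarrow> real) \<Rightarrow> real \<Rightarrow> real" where
  "convolution f g \<alpha> = (\<Sum>\<beta> | f \<beta> \<noteq> 0 \<and> g (\<alpha> - \<beta>) \<noteq> 0. f \<beta> * g (\<alpha> - \<beta>))"

lemma summable_times_UNIV:
  fixes f g :: "real \<Rightarrow> real"
  assumes "(\<lambda>x. \<bar>f x\<bar>) summable_on UNIV" "(\<lambda>x. \<bar>g x\<bar>) summable_on UNIV"
  shows "(\<lambda>(x,y). f x * g y) summable_on UNIV"
    and "(\<Sum>\<^sub>\<infinity>(x,y). f x * g y) = infsum f UNIV * infsum g UNIV"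
proof -
  have "(\<lambda>z. norm ((\<lambda>(x,y). f x * g y) z)) summable_on (UNIV \<times> UNIV)"
    unfolding Infinite_Sum.abs_summable_on_Sigma_iff
  proof (intro conjI ballI)
    show "(\<lambda>y. norm (case (x,y) of (x,y) \<Rightarrow> f x * g y)) summable_on UNIV" for x
      using summable_on_cmult_right[OF assms(2), of "\<bar>f x\<bar>"] by (simp add: abs_mult)
    show "(\<lambda>x. norm (\<Sum>\<^sub>\<infinity>y. norm (case (x,y) of (x,y) \<Rightarrow> f x * g y))) summable_on UNIV"
      using summable_on_cmult_left[OF assms(1), of "\<bar>\<Sum>\<^sub>\<infinity>y. \<bar>g y\<bar>\<bar>"]
      by (simp add: abs_mult infsum_cmult_right')
  qed
  then have *: "(\<lambda>(x,y). f x * g y) summable_on (UNIV \<times> UNIV)"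
    by (simp only: abs_summable_iff_real real_norm_def)
  then show "(\<lambda>(x,y). f x * g y) summable_on UNIV" by simp
  show "(\<Sum>\<^sub>\<infinity>(x,y). f x * g y) = infsum f UNIV * infsum g UNIV"
    using infsum_Sigma_banach[OF *] by (simp add: infsum_cmult_right' infsum_cmult_left')
qed

lemma convolution_converges:
  assumes x: "series_converges_at (coef x) t" and y: "series_converges_at (coef y) t"
    and t: "t > 0"
  shows "series_converges_at (convolution (coef x) (coef y)) t"
    and "(\<Sum>\<^sub>\<infinity>\<alpha>. convolution (coef x) (coef y) \<alpha> * t powr \<alpha>) = pval x t * pval y t"
proof -
  define f where "f = (\<lambda>\<alpha>. coef x \<alpha> * t powr \<alpha>)"
  define g where "g = (\<lambda>\<alpha>. coef y \<alpha> * t powr \<alpha>)"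
  have "(\<lambda>\<alpha>. \<bar>f \<alpha>\<bar>) summable_on UNIV" "(\<lambda>\<alpha>. \<bar>g \<alpha>\<bar>) summable_on UNIV"
    using x y by (simp_all add: series_converges_at_def f_def g_def)
  note fg = summable_times_UNIV[OF this]
  define h where "h = (\<lambda>(\<alpha>,\<beta>). f \<beta> * g (\<alpha> - \<beta>))"
  have "((\<lambda>(x,y). f x * g y) summable_on UNIV) = (h summable_on UNIV)"
    by (rule summable_on_reindex_bij_witness[of _ "\<lambda>(\<alpha>,\<beta>). (\<beta>, \<alpha> - \<beta>)" "\<lambda>(a,b). (a + b, a)"])
       (auto simp: h_def)
  with fg have h: "h summable_on (UNIV \<times> UNIV)" by simp
  have "(\<Sum>\<^sub>\<infinity>(x,y). f x * g y) = infsum h UNIV"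
    by (rule infsum_reindex_bij_witness[of _ "\<lambda>(\<alpha>,\<beta>). (\<beta>, \<alpha> - \<beta>)" "\<lambda>(a,b). (a + b, a)"])
       (auto simp: h_def)
  then have prod: "infsum h UNIV = pval x t * pval y t"
    using fg by (simp add: f_def g_def pval_def)
  have inner: "(\<Sum>\<^sub>\<infinity>\<beta>. h (\<alpha>, \<beta>)) = convolution (coef x) (coef y) \<alpha> * t powr \<alpha>" for \<alpha>
  proof -
    let ?S = "{\<beta>. coef x \<beta> \<noteq> 0 \<and> coef y (\<alpha> - \<beta>) \<noteq> 0}"
    have "(\<Sum>\<^sub>\<infinity>\<beta>. h (\<alpha>, \<beta>)) = infsum (\<lambda>\<beta>. h (\<alpha>, \<beta>)) ?S"
      by (rule infsum_cong_neutral) (auto simp: h_def f_def g_def)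
    also have "\<dots> = (\<Sum>\<beta>\<in>?S. h (\<alpha>, \<beta>))"
      by (simp add: finite_convolution)
    also have "\<dots> = convolution (coef x) (coef y) \<alpha> * t powr \<alpha>"
      unfolding convolution_def sum_distrib_right
      by (rule sum.cong) (use t in \<open>auto simp: h_def f_def g_def powr_diff\<close>)
    finally show ?thesis .
  qed
  have "(\<lambda>\<alpha>. \<Sum>\<^sub>\<infinity>\<beta>. h (\<alpha>, \<beta>)) summable_on UNIV"
    using summable_on_Sigma_banach[of "\<lambda>a b. h (a,b)" UNIV "\<lambda>_. UNIV"] h
    by (simp add: case_prod_eta)
  then show "series_converges_at (convolution (coef x) (coef y)) t"
    unfolding series_converges_at_def inner
    by (simp add: abs_summable_iff_real)
  show "(\<Sum>\<^sub>\<infinity>\<alpha>. convolution (coef x) (coef y) \<alpha> * t powr \<alpha>) = pval x t * pval y t"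
    using infsum_Sigma_banach[OF h] prod by (simp add: inner)
qed

instantiation puiseux :: "{zero, one, plus, minus, uminus, times}"
begin

lift_definition zero_puiseux :: puiseux is "\<lambda>_. 0"
  by (rule is_puiseuxI) (simp_all add: series_converges_at_def[abs_def])

lift_definition one_puiseux :: puiseux is "\<lambda>\<alpha>. if \<alpha> = 0 then 1 else 0"
proof (rule is_puiseuxI)
  show "finite {\<alpha>::real. (if \<alpha> = 0 then 1 else 0::real) \<noteq> 0 \<and> r \<le> \<alpha>}" for r
    by (rule finite_subset[of _ "{0}"]) auto
  have "series_converges_at (\<lambda>\<alpha>. if \<alpha> = 0 then 1 else 0) t" for t
    unfolding series_converges_at_def
    by (rule finite_nonzero_values_imp_summable_on, rule finite_subset[of _ "{0}"])
       (auto split: if_splits)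
  then show "eventually (series_converges_at (\<lambda>\<alpha>. if \<alpha> = 0 then 1 else 0)) at_top"
    by (intro always_eventually allI)
qed

lift_definition plus_puiseux :: "puiseux \<Rightarrow> puiseux \<Rightarrow> puiseux" is "\<lambda>f g \<alpha>. f \<alpha> + g \<alpha>"
proof -
  fix f g assume "is_puiseux f" "is_puiseux g"
  then obtain x y where xy: "f = coef x" "g = coef y" 
    using that[of "Abs_puiseux f" "Abs_puiseux g"] by (simp add: Abs_puiseux_inverse)
  show "is_puiseux (\<lambda>\<alpha>. f \<alpha> + g \<alpha>)"
  proof (rule is_puiseuxI)
    show "finite {\<alpha>. f \<alpha> + g \<alpha> \<noteq> 0 \<and> r \<le> \<alpha>}" for r
      by (rule finite_subset[OF _ finite_UnI[OF finite_support_ge[of x r] finite_support_ge[of y r]]])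
         (auto simp: xy)
    show "eventually (series_converges_at (\<lambda>\<alpha>. f \<alpha> + g \<alpha>)) at_top"
      using eventually_converges[of x] eventually_converges[of y]
    proof eventually_elim
      case (elim t)
      then have "(\<lambda>\<alpha>. f \<alpha> * t powr \<alpha> + g \<alpha> * t powr \<alpha>) summable_on UNIV"
        unfolding xy series_converges_at_def
        by (intro summable_on_add) (simp_all add: abs_summable_iff_real)
      then show ?case
        unfolding series_converges_at_def
        by (simp add: abs_summable_iff_real distrib_right)
    qed
  qed
qed

lift_definition uminus_puiseux :: "puiseux \<Rightarrow> puiseux" is "\<lambda>f \<alpha>. - f \<alpha>"
  by (auto simp: is_puiseux_def series_converges_at_def[abs_def])

definition minus_puiseux :: "puiseux \<Rightarrow> puiseux \<Rightarrow> puiseux" where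
  "x - y = x + - (y::puiseux)"

lift_definition times_puiseux :: "puiseux \<Rightarrow> puiseux \<Rightarrow> puiseux" is convolution
proof -
  fix f g assume "is_puiseux f" "is_puiseux g"
  then obtain x y where xy: "f = coef x" "g = coef y" 
    using that[of "Abs_puiseux f" "Abs_puiseux g"] by (simp add: Abs_puiseux_inverse)
  show "is_puiseux (convolution f g)"
  proof (rule is_puiseuxI)
    fix r
    obtain B C where B: "\<And>\<alpha>. f \<alpha> \<noteq> 0 \<Longrightarrow> \<alpha> \<le> B" and C: "\<And>\<alpha>. g \<alpha> \<noteq> 0 \<Longrightarrow> \<alpha> \<le> C"
      using ex_support_bound xy by metis
    have "{\<alpha>. convolution f g \<alpha> \<noteq> 0 \<and> r \<le> \<alpha>} \<subseteq>
        (\<lambda>(a,b). a + b) ` ({\<alpha>. f \<alpha> \<noteq> 0 \<and> r - C \<le> \<alpha>} \<times> {\<alpha>. g \<alpha> \<noteq> 0 \<and> r - B \<le> \<alpha>})"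
    proof safe
      fix \<alpha> assume "convolution f g \<alpha> \<noteq> 0" "r \<le> \<alpha>"
      then obtain \<beta> where \<beta>: "f \<beta> \<noteq> 0" "g (\<alpha> - \<beta>) \<noteq> 0"
        unfolding convolution_def by (smt (verit) mem_Collect_eq sum.not_neutral_contains_not_neutral)
      with B[OF \<beta>(1)] C[OF \<beta>(2)] \<open>r \<le> \<alpha>\<close>
      show "\<alpha> \<in> (\<lambda>(a,b). a + b) ` ({\<alpha>. f \<alpha> \<noteq> 0 \<and> r - C \<le> \<alpha>} \<times> {\<alpha>. g \<alpha> \<noteq> 0 \<and> r - B \<le> \<alpha>})"
        by (intro image_eqI[of _ _ "(\<beta>, \<alpha> - \<beta>)"]) auto
    qed
    then show "finite {\<alpha>. convolution f g \<alpha> \<noteq> 0 \<and> r \<le> \<alpha>}"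
      by (rule finite_subset) (simp add: xy finite_support_ge)
    show "eventually (series_converges_at (convolution f g)) at_top"
      using eventually_converges[of x] eventually_converges[of y] eventually_gt_at_top[of 0]
      by eventually_elim (simp add: xy convolution_converges)
  qed
qed

instance ..

end

lemma puiseux_eqI: "(\<And>\<alpha>. coef x \<alpha> = coef y \<alpha>) \<Longrightarrow> x = y"
  by (simp add: coef_inject[symmetric] fun_eq_iff)

lemma coef_zero [simp]: "coef 0 \<alpha> = 0"
  by (simp add: zero_puiseux.rep_eq)

definition lead_exp :: "puiseux \<Rightarrow> real" where
  "lead_exp z = (GREATEST \<alpha>. coef z \<alpha> \<noteq> 0)"

definition lead_coef :: "puiseux \<Rightarrow> real" where
  "lead_coef z = coef z (lead_exp z)"

definition val :: "puiseux \<Rightarrow> ereal" where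
  "val z = (if z = 0 then -\<infinity> else ereal (lead_exp z))"

lemma lead_exp:
  assumes "z \<noteq> 0"
  shows "lead_coef z \<noteq> 0" and "\<And>\<alpha>. coef z \<alpha> \<noteq> 0 \<Longrightarrow> \<alpha> \<le> lead_exp z"
proof -
  obtain \<alpha>0 where 0: "coef z \<alpha>0 \<noteq> 0"
    using assms puiseux_eqI[of z 0] by auto
  let ?S = "{\<alpha>. coef z \<alpha> \<noteq> 0 \<and> \<alpha>0 \<le> \<alpha>}"
  have S: "finite ?S" "\<alpha>0 \<in> ?S" using 0 finite_support_ge by auto
  then have M: "Max ?S \<in> ?S" by (intro Max_in) auto
  have "\<alpha> \<le> Max ?S" if "coef z \<alpha> \<noteq> 0" for \<alpha>
  proof (cases "\<alpha>0 \<le> \<alpha>")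
    case True
    then show ?thesis using that S by (intro Max_ge) auto
  next
    case False
    then show ?thesis using M by auto
  qed
  then have *: "lead_exp z = Max ?S" "\<forall>\<alpha>. coef z \<alpha> \<noteq> 0 \<longrightarrow> \<alpha> \<le> Max ?S"
    unfolding lead_exp_def using M by (auto intro!: Greatest_equality)
  then show "lead_coef z \<noteq> 0" "\<And>\<alpha>. coef z \<alpha> \<noteq> 0 \<Longrightarrow> \<alpha> \<le> lead_exp z"
    using M by (auto simp: lead_coef_def)
qed

lemma lead_coef_zero [simp]: "lead_coef 0 = 0"
  by (simp add: lead_coef_def)

text \<open>For large arguments the leading term determines the sign of the value.\<close>

lemma eventually_sgn_pval: "eventually (\<lambda>t. sgn (pval z t) = sgn (lead_coef z)) at_top"
proof (cases "z = 0")
  case True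
  then show ?thesis by (simp add: pval_def)
next
  case False
  define a where "a = lead_exp z"
  let ?S = "{\<alpha>. coef z \<alpha> \<noteq> 0 \<and> a - 1 \<le> \<alpha>} - {a}"
  define b where "b = Max (insert (a - 1) ?S)"
  have ca: "coef z a \<noteq> 0" and a: "\<And>\<alpha>. coef z \<alpha> \<noteq> 0 \<Longrightarrow> \<alpha> \<le> a"
    using lead_exp[OF False] by (auto simp: a_def lead_coef_def)
  have fin: "finite (insert (a - 1) ?S)" using finite_support_ge by auto
  have "b \<in> insert (a - 1) ?S" unfolding b_def using fin by (intro Max_in) auto
  then have ba: "b < a" using a by force
  have b: "\<alpha> \<le> b" if "coef z \<alpha> \<noteq> 0" "\<alpha> \<noteq> a" for \<alpha>
  proof (cases "a - 1 \<le> \<alpha>")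
    case True
    then show ?thesis unfolding b_def using fin that by (intro Max_ge) auto
  next
    case False
    moreover have "a - 1 \<le> b" unfolding b_def using fin by (intro Max_ge) auto
    ultimately show ?thesis by linarith
  qed
  obtain T where T: "T > 0" "series_converges_at (coef z) T"
    using eventually_happens'[OF _ eventually_conj[OF eventually_gt_at_top[of 0] eventually_converges[of z]]]
    by auto
  define C where "C = (\<Sum>\<^sub>\<infinity>\<alpha>. \<bar>coef z \<alpha> * T powr \<alpha>\<bar>)"
  have "((\<lambda>t. C / T powr b * t powr (b - a)) \<longlongrightarrow> C / T powr b * 0) at_top"
    using ba by (intro tendsto_intros tendsto_neg_powr filterlim_ident) auto
  then have "eventually (\<lambda>t. C / T powr b * t powr (b - a) < \<bar>coef z a\<bar>) at_top"
    using ca by (intro order_tendstoD(2)) auto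
  moreover have "eventually (\<lambda>t. t \<ge> T) at_top" by (rule eventually_ge_at_top)
  ultimately show ?thesis using eventually_converges[of z]
  proof eventually_elim
    case (elim t)
    have t: "t > 0" using elim T by linarith
    define R where "R = (\<lambda>\<alpha>. if \<alpha> = a then 0 else coef z \<alpha> * t powr \<alpha>)"
    have R_le: "\<bar>R \<alpha>\<bar> \<le> (t / T) powr b * \<bar>coef z \<alpha> * T powr \<alpha>\<bar>" for \<alpha>
    proof (cases "coef z \<alpha> = 0 \<or> \<alpha> = a")
      case True
      then show ?thesis by (auto simp: R_def)
    next
      case nz: False
      have "(t / T) powr \<alpha> \<le> (t / T) powr b"
        using nz b[of \<alpha>] elim T by (intro powr_mono) auto
      then have "t powr \<alpha> \<le> (t / T) powr b * T powr \<alpha>"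
        using T t by (simp add: powr_divide field_simps)
      then show ?thesis
        using nz by (auto simp: R_def abs_mult mult.left_commute intro!: mult_left_mono)
    qed
    have sT: "(\<lambda>\<alpha>. \<bar>coef z \<alpha> * T powr \<alpha>\<bar>) summable_on UNIV"
      using T by (simp add: series_converges_at_def)
    have sT': "(\<lambda>\<alpha>. (t / T) powr b * \<bar>coef z \<alpha> * T powr \<alpha>\<bar>) summable_on UNIV"
      by (rule summable_on_cmult_right[OF sT])
    have R: "(\<lambda>\<alpha>. \<bar>R \<alpha>\<bar>) summable_on UNIV"
      using R_le by (intro summable_on_comparison_test[OF sT']) auto
    have "\<bar>infsum R UNIV\<bar> \<le> (\<Sum>\<^sub>\<infinity>\<alpha>. \<bar>R \<alpha>\<bar>)"
      using norm_infsum_bound[of R UNIV] R by simp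
    also have "\<dots> \<le> (\<Sum>\<^sub>\<infinity>\<alpha>. (t / T) powr b * \<bar>coef z \<alpha> * T powr \<alpha>\<bar>)"
      using R_le by (intro infsum_mono R sT') auto
    also have "\<dots> = (t / T) powr b * C"
      by (simp add: C_def infsum_cmult_right')
    also have "\<dots> = (C / T powr b * t powr (b - a)) * t powr a"
      using t T by (simp add: powr_divide powr_diff)
    also have "\<dots> < \<bar>coef z a\<bar> * t powr a"
      using elim t by (intro mult_strict_right_mono) auto
    finally have lt: "\<bar>infsum R UNIV\<bar> < \<bar>coef z a * t powr a\<bar>"
      by (simp add: abs_mult)
    let ?L = "\<lambda>\<alpha>. if \<alpha> = a then coef z a * t powr a else 0"
    have L: "(?L has_sum (coef z a * t powr a)) UNIV"
      by (rule has_sum_finite_neutralI[of "{a}"]) auto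
    have "(R has_sum infsum R UNIV) UNIV"
      using R by (simp add: abs_summable_iff_real)
    from has_sum_add[OF L this] have "((\<lambda>\<alpha>. coef z \<alpha> * t powr \<alpha>) has_sum (coef z a * t powr a + infsum R UNIV)) UNIV"
      by (rule has_sum_cong[THEN iffD1, rotated]) (auto simp: R_def)
    then have "pval z t = coef z a * t powr a + infsum R UNIV"
      by (simp add: pval_def infsumI)
    with lt have "sgn (pval z t) = sgn (coef z a * t powr a)"
      by (auto simp: sgn_if abs_if split: if_splits)
    then show ?case using t by (simp add: sgn_mult lead_coef_def a_def)
  qed
qed

lemma pval_zero [simp]: "pval 0 t = 0"
  by (simp add: pval_def)

lemma pval_uminus [simp]: "pval (- x) t = - pval x t"
  by (simp add: pval_def uminus_puiseux.rep_eq infsum_uminus)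

lemma pval_one [simp]: "t > 0 \<Longrightarrow> pval 1 t = 1"
proof -
  assume t: "t > 0"
  have "((\<lambda>\<alpha>. coef 1 \<alpha> * t powr \<alpha>) has_sum 1) UNIV"
    by (rule has_sum_finite_neutralI[of "{0}"]) (use t in \<open>auto simp: one_puiseux.rep_eq\<close>)
  then show ?thesis by (simp add: pval_def infsumI)
qed

lemma eventually_pval_one: "eventually (\<lambda>t. pval 1 t = 1) at_top"
  using eventually_gt_at_top[of 0] by eventually_elim simp

lemma eventually_pval_add: "eventually (\<lambda>t. pval (x + y) t = pval x t + pval y t) at_top"
  using eventually_converges[of x] eventually_converges[of y]
proof eventually_elim
  case (elim t)
  then show ?case
    unfolding pval_def series_converges_at_def
    by (subst infsum_add[symmetric]) (simp_all add: abs_summable_iff_real plus_puiseux.rep_eq distrib_right)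
qed

lemma eventually_pval_diff: "eventually (\<lambda>t. pval (x - y) t = pval x t - pval y t) at_top"
  using eventually_pval_add[of x "- y"] by (simp add: minus_puiseux_def)

lemma eventually_pval_mult: "eventually (\<lambda>t. pval (x * y) t = pval x t * pval y t) at_top"
  using eventually_converges[of x] eventually_converges[of y] eventually_gt_at_top[of 0]
proof eventually_elim
  case (elim t)
  then show ?case
    using convolution_converges(2)[of x t y] by (simp add: pval_def times_puiseux.rep_eq)
qed

lemma sgn_lead_coef_eqI:
  assumes "eventually (\<lambda>t. sgn (pval x t) = s) at_top"
  shows "sgn (lead_coef x) = s"
  using eventually_happens'[OF _ eventually_conj[OF assms eventually_sgn_pval[of x]]] by auto

lemma lead_coef_eq_0_iff [simp]: "lead_coef z = 0 \<longleftrightarrow> z = 0"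
  using lead_exp(1)[of z] by auto

lemma puiseux_diff_eq_0D:
  assumes "x - y = (0::puiseux)" shows "x = y"
proof (rule puiseux_eqI)
  fix \<alpha>
  have "coef (x - y) \<alpha> = coef x \<alpha> - coef y \<alpha>"
    by (simp add: minus_puiseux_def plus_puiseux.rep_eq uminus_puiseux.rep_eq)
  then show "coef x \<alpha> = coef y \<alpha>" using assms by simp
qed

lemma puiseux_eq_iff: "x = y \<longleftrightarrow> eventually (\<lambda>t. pval x t = pval y t) at_top"
proof
  assume *: "eventually (\<lambda>t. pval x t = pval y t) at_top"
  have "eventually (\<lambda>t. sgn (pval (x - y) t) = 0) at_top"
    using * eventually_pval_diff[of x y] by eventually_elim simp
  then have "sgn (lead_coef (x - y)) = 0" by (rule sgn_lead_coef_eqI)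
  then have "x - y = 0" by (simp add: sgn_0_0)
  then show "x = y" by (rule puiseux_diff_eq_0D)
qed simp

instance puiseux :: ab_group_add
proof
  fix x y z :: puiseux
  note ev = eventually_pval_add
  show "x + y + z = x + (y + z)"
    unfolding puiseux_eq_iff using ev[of "x + y" z] ev[of x y] ev[of x "y + z"] ev[of y z]
    by eventually_elim simp
  show "x + y = y + x"
    unfolding puiseux_eq_iff using ev[of x y] ev[of y x] by eventually_elim simp
  show "0 + x = x"
    unfolding puiseux_eq_iff using ev[of 0 x] by eventually_elim simp
  show "- x + x = 0"
    unfolding puiseux_eq_iff using ev[of "- x" x] by eventually_elim simp
  show "x - y = x + - y" by (rule minus_puiseux_def)
qed

instance puiseux :: comm_ring_1
proof
  fix x y z :: puiseux
  note ev = eventually_pval_mult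
  show "x * y * z = x * (y * z)"
    unfolding puiseux_eq_iff using ev[of "x * y" z] ev[of x y] ev[of x "y * z"] ev[of y z]
    by eventually_elim simp
  show "x * y = y * x"
    unfolding puiseux_eq_iff using ev[of x y] ev[of y x] by eventually_elim simp
  show "1 * x = x"
    unfolding puiseux_eq_iff using ev[of 1 x] eventually_pval_one by eventually_elim simp
  show "(x + y) * z = x * z + y * z"
    unfolding puiseux_eq_iff
    using ev[of "x + y" z] eventually_pval_add[of x y] eventually_pval_add[of "x * z" "y * z"]
      ev[of x z] ev[of y z]
    by eventually_elim (simp add: distrib_right)
  have "coef 0 0 \<noteq> coef 1 0" by (simp add: one_puiseux.rep_eq)
  then show "(0::puiseux) \<noteq> 1" by metis
qed

instantiation puiseux :: linordered_idom
begin

definition less_eq_puiseux :: "puiseux \<Rightarrow> puiseux \<Rightarrow> bool" where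
  "x \<le> y \<longleftrightarrow> x = y \<or> 0 < lead_coef (y - x)"

definition less_puiseux :: "puiseux \<Rightarrow> puiseux \<Rightarrow> bool" where
  "x < y \<longleftrightarrow> x \<le> y \<and> x \<noteq> (y::puiseux)"

definition abs_puiseux :: "puiseux \<Rightarrow> puiseux" where
  "\<bar>x\<bar> = (if x < 0 then - x else (x::puiseux))"

definition sgn_puiseux :: "puiseux \<Rightarrow> puiseux" where
  "sgn x = (if x = 0 then 0 else if 0 < x then 1 else - (1::puiseux))"

lemma less_puiseux_iff_lead_coef: "x < y \<longleftrightarrow> 0 < lead_coef (y - x)"
  for x y :: puiseux
  by (auto simp: less_puiseux_def less_eq_puiseux_def)

lemma less_puiseux_iff: "x < y \<longleftrightarrow> eventually (\<lambda>t. pval x t < pval y t) at_top"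
  for x y :: puiseux
proof
  assume "x < y"
  then have *: "sgn (lead_coef (y - x)) = 1" by (simp add: less_puiseux_iff_lead_coef)
  show "eventually (\<lambda>t. pval x t < pval y t) at_top"
    using eventually_sgn_pval[of "y - x"] eventually_pval_diff[of y x]
    by eventually_elim (use * in \<open>simp add: sgn_1_pos\<close>)
next
  assume "eventually (\<lambda>t. pval x t < pval y t) at_top"
  with eventually_pval_diff[of y x] have "eventually (\<lambda>t. sgn (pval (y - x) t) = 1) at_top"
    by eventually_elim simp
  then have "sgn (lead_coef (y - x)) = 1" by (rule sgn_lead_coef_eqI)
  then show "x < y" by (simp add: less_puiseux_iff_lead_coef sgn_1_pos)
qed

lemma le_puiseux_iff: "x \<le> y \<longleftrightarrow> eventually (\<lambda>t. pval x t \<le> pval y t) at_top"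
  for x y :: puiseux
proof
  assume "x \<le> y"
  then consider "x = y" | "x < y" by (auto simp: less_puiseux_def)
  then show "eventually (\<lambda>t. pval x t \<le> pval y t) at_top"
  proof cases
    case 2
    then show ?thesis unfolding less_puiseux_iff by (rule eventually_mono) simp
  qed simp
next
  assume le: "eventually (\<lambda>t. pval x t \<le> pval y t) at_top"
  show "x \<le> y"
  proof (cases "x = y")
    case False
    have "eventually (\<lambda>t. sgn (lead_coef (y - x)) = sgn (pval y t - pval x t) \<and> pval x t \<le> pval y t) at_top"
      using eventually_sgn_pval[of "y - x"] eventually_pval_diff[of y x] le by eventually_elim simp
    then obtain t where "sgn (lead_coef (y - x)) = sgn (pval y t - pval x t)" "pval x t \<le> pval y t"
      using eventually_happens'[OF trivial_limit_at_top_linorder] by blast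
    then have "0 \<le> lead_coef (y - x)" by (auto simp: sgn_if split: if_splits)
    moreover have "lead_coef (y - x) \<noteq> 0" using False by simp
    ultimately have "0 < lead_coef (y - x)" by linarith
    then show ?thesis by (simp add: less_eq_puiseux_def)
  qed (simp add: less_eq_puiseux_def)
qed

instance
proof
  fix x y z :: puiseux
  note ev = eventually_pval_add eventually_pval_mult eventually_pval_diff
  show lt: "(x < y) = (x \<le> y \<and> \<not> y \<le> x)" for x y :: puiseux
  proof -
    have "x = y" if "x \<le> y" "y \<le> x"
      using that unfolding le_puiseux_iff puiseux_eq_iff by eventually_elim simp
    moreover have "x \<le> x" by (simp add: less_eq_puiseux_def)
    ultimately show ?thesis by (auto simp: less_puiseux_def)
  qed
  show "x \<le> x" by (simp add: less_eq_puiseux_def)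
  show "x \<le> z" if "x \<le> y" "y \<le> z"
    using that unfolding le_puiseux_iff by eventually_elim simp
  show "x = y" if "x \<le> y" "y \<le> x"
    using that unfolding le_puiseux_iff puiseux_eq_iff by eventually_elim simp
  show "x \<le> y \<or> y \<le> x"
  proof -
    have "lead_coef (y - x) < 0 \<or> x = y \<or> 0 < lead_coef (y - x)"
      using lead_coef_eq_0_iff[of "y - x"] by (auto simp del: lead_coef_eq_0_iff)
    moreover have "y \<le> x" if "lead_coef (y - x) < 0"
      unfolding le_puiseux_iff using eventually_sgn_pval[of "y - x"] eventually_pval_diff[of y x]
      by eventually_elim (use that in \<open>simp add: sgn_1_neg\<close>)
    ultimately show ?thesis by (auto simp: less_eq_puiseux_def)
  qed
  show "z + x \<le> z + y" if "x \<le> y"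
    using that ev(1)[of z x] ev(1)[of z y] unfolding le_puiseux_iff by eventually_elim simp
  show "z * x < z * y" if "x < y" "0 < z"
    using that ev(2)[of z x] ev(2)[of z y] unfolding less_puiseux_iff
    by eventually_elim (simp add: mult_strict_left_mono)
  show "\<bar>x\<bar> = (if x < 0 then - x else x)" by (rule abs_puiseux_def)
  show "sgn x = (if x = 0 then 0 else if 0 < x then 1 else - 1)" by (rule sgn_puiseux_def)
qed

end

section \<open>Vectors and polyhedra over Puiseux series\<close>

definition vec_val :: "puiseux ^ 'n \<Rightarrow> ereal ^ 'n" where
  "vec_val x = (\<chi> j. val (x $ j))"

definition vec_pval :: "puiseux ^ 'n \<Rightarrow> real \<Rightarrow> real ^ 'n" where
  "vec_pval x t = (\<chi> j. pval (x $ j) t)"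

definition vec_log :: "real \<Rightarrow> real ^ 'n \<Rightarrow> real ^ 'n" where
  "vec_log t x = (\<chi> j. log t (x $ j))"

text \<open>
  A matrix with \<open>m\<close> rows is given by its rows \<open>M 0, \<dots>, M (m - 1)\<close>; the values of \<open>M\<close> at other
  indices are ignored. The number of rows is thus an arbitrary natural number, including \<open>0\<close>,
  whereas the dimension of the ambient space is the cardinality of the index type.
\<close>

definition puiseux_polyhedron :: "nat \<Rightarrow> (nat \<Rightarrow> puiseux ^ 'n) \<Rightarrow> (nat \<Rightarrow> puiseux) \<Rightarrow> (puiseux ^ 'n) set" where
  "puiseux_polyhedron m M d = {x. \<forall>i<m. (\<Sum>j\<in>UNIV. M i $ j * x $ j) \<le> d i}"

definition polyhedron_at ::
  "nat \<Rightarrow> (nat \<Rightarrow> puiseux ^ 'n) \<Rightarrow> (nat \<Rightarrow> puiseux) \<Rightarrow> real \<Rightarrow> (real ^ 'n) set" where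
  "polyhedron_at m M d t = {x. \<forall>i<m. vec_pval (M i) t \<bullet> x \<le> pval (d i) t}"

text \<open>
  \<open>\<real> \<union> {-\<infinity>}\<close> with its usual topology is a subspace of the extended reals; closure and interior
  are taken relative to its \<open>n\<close>-th power.
\<close>

definition tropical_space :: "(ereal ^ 'n) set" where
  "tropical_space = {x. \<forall>j. x $ j \<noteq> \<infinity>}"

definition tropical_regular :: "(ereal ^ 'n) set \<Rightarrow> bool" where
  "tropical_regular S \<longleftrightarrow>
     top_of_set tropical_space closure_of (top_of_set tropical_space interior_of S) = S"

section \<open>The entropic central path and its tropicalization\<close>

definition ln_ennreal :: "ennreal \<Rightarrow> ereal" where
  "ln_ennreal r = (if r = 0 then -\<infinity> else if r = \<infinity> then \<infinity> else ereal (ln (enn2real r)))"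

definition log_laplace :: "(real ^ 'n) set \<Rightarrow> real ^ 'n \<Rightarrow> ereal" where
  "log_laplace P \<theta> = ln_ennreal (\<integral>\<^sup>+x\<in>P. ennreal (exp (\<theta> \<bullet> x)) \<partial>lborel)"

definition fenchel_conjugate :: "(real ^ 'n \<Rightarrow> ereal) \<Rightarrow> real ^ 'n \<Rightarrow> ereal" where
  "fenchel_conjugate f x = (SUP \<theta>. ereal (\<theta> \<bullet> x) - f \<theta>)"

definition entropic_objective :: "(real ^ 'n) set \<Rightarrow> real ^ 'n \<Rightarrow> real \<Rightarrow> real ^ 'n \<Rightarrow> ereal" where
  "entropic_objective P c \<mu> x =
     ereal (c \<bullet> x) + ereal \<mu> * fenchel_conjugate (log_laplace P) x"

definition is_entropic_optimum :: "(real ^ 'n) set \<Rightarrow> real ^ 'n \<Rightarrow> real \<Rightarrow> real ^ 'n \<Rightarrow> bool" where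
  "is_entropic_optimum P c \<mu> x \<longleftrightarrow> x \<in> interior P \<and>
     (\<forall>y\<in>interior P. entropic_objective P c \<mu> x \<le> entropic_objective P c \<mu> y)"

definition entropic_central_path :: "(real ^ 'n) set \<Rightarrow> real ^ 'n \<Rightarrow> real \<Rightarrow> real ^ 'n" where
  "entropic_central_path P c \<mu> = (THE x. is_entropic_optimum P c \<mu> x)"

text \<open>
  \<open>F\<close> is the tropical entropic central path: for all positive Puiseux series \<open>\<epsilon>\<close> of valuation \<open>\<mu>\<close>,
  the central path of the evaluated polyhedron is well-defined at \<open>\<epsilon>(t)\<close> for large \<open>t\<close>, and its
  logarithm converges to \<open>F \<mu>\<close>. Since every real is the valuation of some positive series, this
  determines \<open>F\<close> uniquely.
\<close>

definition is_tropical_entropic_path ::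
  "nat \<Rightarrow> (nat \<Rightarrow> puiseux ^ 'n) \<Rightarrow> (nat \<Rightarrow> puiseux) \<Rightarrow> puiseux ^ 'n \<Rightarrow> (real \<Rightarrow> real ^ 'n) \<Rightarrow> bool" where
  "is_tropical_entropic_path m M d c F \<longleftrightarrow>
     (\<forall>\<mu> \<epsilon>. 0 < \<epsilon> \<and> val \<epsilon> = ereal \<mu> \<longrightarrow>
       (\<forall>\<^sub>F t in at_top.
          \<exists>!x. is_entropic_optimum (polyhedron_at m M d t) (vec_pval c t) (pval \<epsilon> t) x) \<and>
       ((\<lambda>t. vec_log t (entropic_central_path (polyhedron_at m M d t) (vec_pval c t) (pval \<epsilon> t)))
          \<longlongrightarrow> F \<mu>) at_top)"

section \<open>The logarithmic central path and its tropicalization\<close>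

text \<open>
  Points are quadruples \<open>(x, w, s, y)\<close>. The vectors \<open>w\<close> and \<open>y\<close>, which are indexed by the \<open>m\<close> rows,
  are padded with zeros; so are their logarithms, as \<open>log t 0 = 0\<close>.
\<close>

type_synonym 'n primal_dual = "(real ^ 'n) \<times> (nat \<Rightarrow> real) \<times> (real ^ 'n) \<times> (nat \<Rightarrow> real)"

definition is_log_central_point ::
  "nat \<Rightarrow> (nat \<Rightarrow> real ^ 'n) \<Rightarrow> (nat \<Rightarrow> real) \<Rightarrow> real ^ 'n \<Rightarrow> real \<Rightarrow> 'n primal_dual \<Rightarrow> bool" where
  "is_log_central_point m A b c \<nu> = (\<lambda>(x, w, s, y).
     (\<forall>j. 0 < x $ j \<and> 0 < s $ j) \<and> (\<forall>i<m. 0 < w i \<and> 0 < y i) \<and>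
     (\<forall>i\<ge>m. w i = 0 \<and> y i = 0) \<and>
     (\<forall>i<m. A i \<bullet> x + w i = b i) \<and>
     s - (\<Sum>i<m. y i *\<^sub>R A i) = c \<and>
     (\<forall>j. x $ j * s $ j = \<nu>) \<and> (\<forall>i<m. w i * y i = \<nu>))"

definition log_central_path ::
  "nat \<Rightarrow> (nat \<Rightarrow> real ^ 'n) \<Rightarrow> (nat \<Rightarrow> real) \<Rightarrow> real ^ 'n \<Rightarrow> real \<Rightarrow> 'n primal_dual" where
  "log_central_path m A b c \<nu> = (THE p. is_log_central_point m A b c \<nu> p)"

definition log_primal_dual :: "real \<Rightarrow> ('n::finite) primal_dual \<Rightarrow> 'n primal_dual" where
  "log_primal_dual t = (\<lambda>(x, w, s, y).
     (vec_log t x, (\<lambda>i. log t (w i)), vec_log t s, (\<lambda>i. log t (y i))))"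

definition is_tropical_log_path ::
  "nat \<Rightarrow> (nat \<Rightarrow> puiseux ^ 'n) \<Rightarrow> (nat \<Rightarrow> puiseux) \<Rightarrow> puiseux ^ 'n \<Rightarrow> (real \<Rightarrow> 'n primal_dual) \<Rightarrow> bool" where
  "is_tropical_log_path m A b c G \<longleftrightarrow>
     (\<forall>\<mu> \<epsilon>. 0 < \<epsilon> \<and> val \<epsilon> = ereal \<mu> \<longrightarrow>
       (\<forall>\<^sub>F t in at_top.
          \<exists>!p. is_log_central_point m (\<lambda>i. vec_pval (A i) t) (\<lambda>i. pval (b i) t) (vec_pval c t) (pval \<epsilon> t) p) \<and>
       ((\<lambda>t. log_primal_dual t
               (log_central_path m (\<lambda>i. vec_pval (A i) t) (\<lambda>i. pval (b i) t) (vec_pval c t) (pval \<epsilon> t)))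
          \<longlongrightarrow> G \<mu>) at_top)"

section \<open>Piecewise linear functions\<close>

definition piecewise_linear :: "(real \<Rightarrow> 'a::real_normed_vector) \<Rightarrow> bool" where
  "piecewise_linear F \<longleftrightarrow> continuous_on UNIV F \<and>
     (\<exists>S. finite S \<and>
       (\<forall>I. is_interval I \<and> I \<inter> S = {} \<longrightarrow> (\<exists>u v. \<forall>\<mu>\<in>I. F \<mu> = u + \<mu> *\<^sub>R v)))"

end

theory Submission
  imports Defs
begin

text \<open>
  Both central paths are, up to constant factors, solutions of the same family of linear programs.
  Fix a large real \<open>t\<close> and \<open>\<nu> = \<epsilon>(t)\<close>. The point \<open>x\<close> of either path at \<open>\<nu>\<close> lies in the polyhedron, has
  cost \<open>\<langle>c, x\<rangle> \<le> C \<nu>\<close>, and satisfies \<open>p\<^sub>j \<le> C x\<^sub>j\<close> for each \<open>j\<close> and each point \<open>p\<close> of cost at most \<open>\<nu>\<close>,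
  with a constant \<open>C\<close> that depends only on the number of variables and rows. As the polyhedron
  contains \<open>0\<close>, it also contains \<open>x / C\<close>; hence \<open>x\<^sub>j\<close> agrees up to the factor \<open>C\<close> with the maximum of
  the \<open>j\<close>-th coordinate over the points of cost at most \<open>\<nu>\<close>. Such a factor disappears in the limit of
  \<open>log\<^sub>t\<close> (\<open>tendsto_log_near_optimal\<close>), and what remains is the valuation of the optimal value of a
  linear program over Puiseux series with right-hand side \<open>\<epsilon>\<close>.

  For the logarithmic path the two estimates follow from the orthogonality of primal and dual
  directions, applied to the central point and the dual feasible point \<open>(s, y) = (c, 0)\<close>
  (\<open>log_central_point_bounds\<close>). The same argument applies to the slacks \<open>w\<close>, and \<open>s = \<nu> / x\<close>,
  \<open>y = \<nu> / w\<close> inherit their limits.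

  For the entropic path, Fenchel duality shows that the optimum at \<open>\<nu>\<close> is the gradient of the
  log-Laplace transform at \<open>- c / \<nu>\<close>, that is, the barycenter of the polyhedron for the density
  proportional to \<open>exp (- \<langle>c, x\<rangle> / \<nu>)\<close> (\<open>barycenter_optimal\<close>, \<open>optimum_unique\<close>). Contracting the polyhedron
  by the factor \<open>1/2\<close> towards \<open>0\<close>, or towards a point \<open>p\<close>, changes volumes by \<open>2\<^sup>-\<^sup>n\<close> and the density in a
  controlled way; this yields the two estimates (\<open>barycenter_cost\<close>, \<open>barycenter_dominates\<close>).

  Linear programs over Puiseux series are treated by Fourier--Motzkin elimination, in the ordered
  field of Puiseux series. It expresses the optimal value as a minimum of finitely many affine
  functions of \<open>\<epsilon>\<close>, whence its valuation is piecewise linear in \<open>val \<epsilon>\<close> (\<open>value_function\<close>). Each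
  eliminated inequality is a nonnegative combination of the given ones, so optimality over Puiseux
  series persists at large reals (\<open>optimum_eventually\<close>). Regularity of \<open>val P\<close> prevents \<open>P\<close> from lying in
  a hyperplane (\<open>regular_imp_nonvanishing\<close>), which makes all optimal values positive and provides
  strictly feasible points.
\<close>

section \<open>The ordered field of Puiseux series\<close>

lemma coef_add: "coef (x + y) \<alpha> = coef x \<alpha> + coef y \<alpha>"
  by (simp add: plus_puiseux.rep_eq)

lemma coef_uminus: "coef (- x) \<alpha> = - coef x \<alpha>"
  by (simp add: uminus_puiseux.rep_eq)

lemma coef_diff: "coef (x - y) \<alpha> = coef x \<alpha> - coef y \<alpha>"
  unfolding minus_puiseux_def by (simp only: coef_add coef_uminus)

lemma coef_mult: "coef (x * y) = convolution (coef x) (coef y)"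
  by (simp add: times_puiseux.rep_eq)

lemma lead_exp_eqI:
  assumes "coef z a \<noteq> 0" "\<And>\<alpha>. coef z \<alpha> \<noteq> 0 \<Longrightarrow> \<alpha> \<le> a"
  shows "lead_exp z = a"
  unfolding lead_exp_def using assms by (intro Greatest_equality) auto

lemma lead_exp_one [simp]: "lead_exp 1 = 0"
  by (rule lead_exp_eqI) (auto simp: one_puiseux.rep_eq split: if_splits)

lift_definition monomial :: "real \<Rightarrow> real \<Rightarrow> puiseux" is "\<lambda>k r \<alpha>. if \<alpha> = r then k else 0"
proof (rule is_puiseuxI)
  fix k r s :: real
  show "finite {\<alpha>. (if \<alpha> = r then k else 0) \<noteq> 0 \<and> s \<le> \<alpha>}"
    by (rule finite_subset[of _ "{r}"]) (auto split: if_splits)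
  have "series_converges_at (\<lambda>\<alpha>. if \<alpha> = r then k else 0) t" for t
    unfolding series_converges_at_def
    by (rule finite_nonzero_values_imp_summable_on, rule finite_subset[of _ "{r}"])
       (auto split: if_splits)
  then show "eventually (series_converges_at (\<lambda>\<alpha>. if \<alpha> = r then k else 0)) at_top"
    by (intro always_eventually allI)
qed

lemma coef_monomial: "coef (monomial k r) \<alpha> = (if \<alpha> = r then k else 0)"
  by (simp add: monomial.rep_eq)

lemma pval_monomial [simp]: "pval (monomial k r) t = k * t powr r"
proof -
  have "((\<lambda>\<alpha>. coef (monomial k r) \<alpha> * t powr \<alpha>) has_sum k * t powr r) UNIV"
    by (rule has_sum_finite_neutralI[of "{r}"]) (auto simp: coef_monomial)
  then show ?thesis by (simp add: pval_def infsumI)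
qed

lemma lead_exp_monomial [simp]: "k \<noteq> 0 \<Longrightarrow> lead_exp (monomial k r) = r"
  by (rule lead_exp_eqI) (auto simp: coef_monomial split: if_splits)

lemma monomial_pos: "0 < k \<Longrightarrow> 0 < monomial k r"
  by (simp add: less_puiseux_iff_lead_coef lead_coef_def coef_monomial)

lemma coef_lead_exp_pos: "0 < z \<Longrightarrow> 0 < coef z (lead_exp z)"
  using less_puiseux_iff_lead_coef[of 0 z] by (simp add: lead_coef_def)

text \<open>
  Comparisons between series of different valuations are the source of all statements about limits
  below: squeezing a series between monomials determines its growth.
\<close>

lemma less_if_lead_exp_less:
  assumes "0 < z" "x = 0 \<or> lead_exp x < lead_exp z"
  shows "x < z"
proof -
  have x: "coef x \<alpha> = 0" if "lead_exp z \<le> \<alpha>" for \<alpha>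
    using assms(2) lead_exp(2)[of x \<alpha>] that by (cases "x = 0") force+
  have z: "0 < coef z (lead_exp z)" using assms(1) by (rule coef_lead_exp_pos)
  have "lead_exp (z - x) = lead_exp z"
  proof (rule lead_exp_eqI)
    show "coef (z - x) (lead_exp z) \<noteq> 0" using x z by (simp add: coef_diff)
    show "\<alpha> \<le> lead_exp z" if "coef (z - x) \<alpha> \<noteq> 0" for \<alpha>
    proof (rule ccontr)
      assume "\<not> \<alpha> \<le> lead_exp z"
      then have "coef z \<alpha> \<noteq> 0" "\<not> \<alpha> \<le> lead_exp z" using that x[of \<alpha>] by (auto simp: coef_diff)
      then show False using lead_exp(2)[of z \<alpha>] assms(1) by auto
    qed
  qed
  then show ?thesis
    using x z by (simp add: less_puiseux_iff_lead_coef lead_coef_def coef_diff)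
qed

lemma lead_exp_mono:
  assumes "0 < x" "x \<le> z"
  shows "lead_exp x \<le> lead_exp z"
proof (rule ccontr)
  assume "\<not> ?thesis"
  then have "z < x" using less_if_lead_exp_less[OF assms(1), of z] by auto
  then show False using assms(2) by simp
qed

lemma tendsto_log_pval:
  assumes "0 < z"
  shows "((\<lambda>t. log t (pval z t)) \<longlongrightarrow> lead_exp z) at_top"
proof (rule order_tendstoI)
  have pos: "eventually (\<lambda>t. 0 < pval z t) at_top"
    using assms by (simp add: less_puiseux_iff)
  fix r
  show "eventually (\<lambda>t. r < log t (pval z t)) at_top" if "r < lead_exp z"
  proof -
    have "monomial 1 r < z" using that by (intro less_if_lead_exp_less[OF assms]) auto
    then have "eventually (\<lambda>t. t powr r < pval z t) at_top" by (simp add: less_puiseux_iff)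
    with pos eventually_gt_at_top[of 1] show ?thesis
      by eventually_elim (simp add: less_log_iff)
  qed
  show "eventually (\<lambda>t. log t (pval z t) < r) at_top" if "lead_exp z < r"
  proof -
    have "z < monomial 1 r"
      using that by (intro less_if_lead_exp_less[OF monomial_pos]) auto
    then have "eventually (\<lambda>t. pval z t < t powr r) at_top" by (simp add: less_puiseux_iff)
    with pos eventually_gt_at_top[of 1] show ?thesis
      by eventually_elim (simp add: log_less_iff)
  qed
qed

text \<open>
  The logarithm turns products into sums, so the valuation of a product can be read off from the
  growth of its values.
\<close>

lemma lead_exp_mult_pos:
  assumes "0 < x" "0 < y"
  shows "lead_exp (x * y) = lead_exp x + lead_exp y"
proof -
  have "((\<lambda>t. log t (pval x t) + log t (pval y t)) \<longlongrightarrow> lead_exp x + lead_exp y) at_top"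
    using assms by (intro tendsto_add tendsto_log_pval)
  moreover have "eventually (\<lambda>t. log t (pval x t) + log t (pval y t) = log t (pval (x * y) t)) at_top"
    using assms[unfolded less_puiseux_iff] eventually_pval_mult[of x y]
    by eventually_elim (simp add: log_mult_pos)
  ultimately have "((\<lambda>t. log t (pval (x * y) t)) \<longlongrightarrow> lead_exp x + lead_exp y) at_top"
    by (rule Lim_transform_eventually)
  then show ?thesis
    using tendsto_log_pval[OF mult_pos_pos[OF assms]] tendsto_unique trivial_limit_at_top_linorder
    by blast
qed

lemma lead_exp_uminus [simp]: "lead_exp (- x) = lead_exp x"
  by (simp add: lead_exp_def coef_uminus)

lemma lead_exp_abs [simp]: "lead_exp \<bar>x\<bar> = lead_exp x"
  by (simp add: abs_if)

lemma lead_exp_mult: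
  assumes "x \<noteq> 0" "y \<noteq> 0"
  shows "lead_exp (x * y) = lead_exp x + lead_exp y"
  using lead_exp_mult_pos[of "\<bar>x\<bar>" "\<bar>y\<bar>"] assms by (simp add: abs_mult[symmetric])

lemma lead_exp_add:
  assumes "x \<noteq> 0" "y = 0 \<or> lead_exp y < lead_exp x"
  shows "lead_exp (x + y) = lead_exp x"
proof (rule lead_exp_eqI)
  have y: "coef y \<alpha> = 0" if "lead_exp x \<le> \<alpha>" for \<alpha>
    using assms(2) lead_exp(2)[of y \<alpha>] that by (cases "y = 0") force+
  show "coef (x + y) (lead_exp x) \<noteq> 0"
    using y lead_exp(1)[OF assms(1)] by (simp add: coef_add lead_coef_def)
  show "\<alpha> \<le> lead_exp x" if "coef (x + y) \<alpha> \<noteq> 0" for \<alpha>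
  proof (rule ccontr)
    assume "\<not> \<alpha> \<le> lead_exp x"
    then have "coef x \<alpha> \<noteq> 0" "\<not> \<alpha> \<le> lead_exp x" using that y[of \<alpha>] by (auto simp: coef_add)
    then show False using lead_exp(2)[OF assms(1), of \<alpha>] by blast
  qed
qed

lift_definition majorant :: "puiseux \<Rightarrow> puiseux" is "\<lambda>c \<alpha>. \<bar>c \<alpha>\<bar>"
  by (simp add: is_puiseux_def series_converges_at_def[abs_def] abs_mult)

lemma coef_majorant: "coef (majorant z) \<alpha> = \<bar>coef z \<alpha>\<bar>"
  by (simp add: majorant.rep_eq)

lemma coef_power_majorant: "\<bar>coef (h ^ k) \<alpha>\<bar> \<le> coef (majorant h ^ k) \<alpha>"
proof (induction k arbitrary: \<alpha>)
  case 0
  then show ?case by (simp add: one_puiseux.rep_eq)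
next
  case (Suc k)
  let ?S = "{\<beta>. coef h \<beta> \<noteq> 0 \<and> coef (h ^ k) (\<alpha> - \<beta>) \<noteq> 0}"
  let ?T = "{\<beta>. coef (majorant h) \<beta> \<noteq> 0 \<and> coef (majorant h ^ k) (\<alpha> - \<beta>) \<noteq> 0}"
  have ST: "?S \<subseteq> ?T" using Suc by (auto simp: coef_majorant) (metis abs_le_zero_iff)
  have nonneg: "0 \<le> coef (majorant h ^ k) \<beta>" for \<beta> using Suc[of \<beta>] by linarith
  have "\<bar>coef (h ^ Suc k) \<alpha>\<bar> \<le> (\<Sum>\<beta>\<in>?S. \<bar>coef h \<beta> * coef (h ^ k) (\<alpha> - \<beta>)\<bar>)"
    by (simp add: coef_mult convolution_def sum_abs)
  also have "\<dots> \<le> (\<Sum>\<beta>\<in>?S. coef (majorant h) \<beta> * coef (majorant h ^ k) (\<alpha> - \<beta>))"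
    using Suc by (intro sum_mono) (simp add: abs_mult coef_majorant mult_left_mono)
  also have "\<dots> \<le> (\<Sum>\<beta>\<in>?T. coef (majorant h) \<beta> * coef (majorant h ^ k) (\<alpha> - \<beta>))"
    using ST nonneg by (intro sum_mono2 finite_convolution) (auto simp: coef_majorant)
  finally show ?case by (simp add: coef_mult convolution_def)
qed

lemma power_converges:
  assumes "series_converges_at (coef h) t" "0 < t"
  shows "series_converges_at (coef (h ^ k)) t \<and> pval (h ^ k) t = pval h t ^ k"
proof (induction k)
  case 0
  have "(\<lambda>\<alpha>. coef 1 \<alpha> * t powr \<alpha>) summable_on UNIV"
    by (rule finite_nonzero_values_imp_summable_on, rule finite_subset[of _ "{0}"])
       (auto simp: one_puiseux.rep_eq split: if_splits)
  then show ?case using assms by (simp add: series_converges_at_def abs_summable_iff_real)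
next
  case (Suc k)
  then show ?case
    using convolution_converges[OF assms(1), of "h ^ k"] assms(2)
    by (simp add: pval_def coef_mult)
qed

lemma lead_exp_power:
  assumes "h \<noteq> 0"
  shows "lead_exp (h ^ k) = real k * lead_exp h"
proof (induction k)
  case 0
  then show ?case by simp
next
  case (Suc k)
  then show ?case using assms by (simp add: lead_exp_mult algebra_simps)
qed

text \<open>
  The geometric series inverts \<open>1 - h\<close> when \<open>h\<close> is infinitesimal: each exponent occurs in finitely
  many powers of \<open>h\<close>, and the powers of the majorant of \<open>h\<close> dominate the double series.
\<close>

lemma inverse_one_minus_exists:
  assumes h: "h \<noteq> 0" "lead_exp h < 0"
  shows "\<exists>g. g * (1 - h) = 1"
proof -
  define m where "m = majorant h"
  define f where "f = (\<lambda>\<alpha>. \<Sum>\<^sub>\<infinity>k. coef (h ^ k) \<alpha>)"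
  have zero: "coef (h ^ k) \<alpha> = 0" if "real k * lead_exp h < \<alpha>" for k \<alpha>
    using lead_exp(2)[of "h ^ k" \<alpha>] that h lead_exp_power[of h k]
    by (metis not_less power_not_zero)
  have fin: "finite {k. coef (h ^ k) \<alpha> \<noteq> 0 \<and> r \<le> \<alpha>}" for \<alpha> r
  proof (rule finite_subset)
    show "{k. coef (h ^ k) \<alpha> \<noteq> 0 \<and> r \<le> \<alpha>} \<subseteq> {..nat \<lceil>r / lead_exp h\<rceil>}"
    proof safe
      fix k assume k: "coef (h ^ k) \<alpha> \<noteq> 0" "r \<le> \<alpha>"
      then have "r \<le> real k * lead_exp h" using zero[of k \<alpha>] by fastforce
      then have "real k \<le> r / lead_exp h" using h by (simp add: field_simps)
      then show "k \<le> nat \<lceil>r / lead_exp h\<rceil>" by linarith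
    qed
  qed simp
  have key: "series_converges_at f t \<and>
      (\<Sum>\<^sub>\<infinity>\<alpha>. f \<alpha> * t powr \<alpha>) * (1 - pval h t) = 1"
    if t: "0 < t" "series_converges_at (coef h) t" "pval m t < 1" for t
  proof -
    have cm: "series_converges_at (coef m) t"
      using t by (simp add: m_def series_converges_at_def coef_majorant abs_mult)
    note pm = power_converges[OF cm t(1)]
    note ph = power_converges[OF t(2,1)]
    have mk: "0 \<le> coef (m ^ k) \<alpha>" for k \<alpha>
      using coef_power_majorant[of h k \<alpha>] by (simp add: m_def)
    have m0: "0 \<le> pval m t" unfolding pval_def using t
      by (intro infsum_nonneg) (simp add: m_def coef_majorant)
    have "\<bar>pval h t\<bar> \<le> pval m t"
      using norm_infsum_bound[of "\<lambda>\<alpha>. coef h \<alpha> * t powr \<alpha>" UNIV] t(2)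
      by (simp add: pval_def m_def coef_majorant series_converges_at_def abs_mult)
    then have h1: "\<bar>pval h t\<bar> < 1" using t(3) by linarith
    define d where "d = (\<lambda>(k, \<alpha>). coef (h ^ k) \<alpha> * t powr \<alpha>)"
    define e where "e = (\<lambda>(k, \<alpha>). coef (m ^ k) \<alpha> * t powr \<alpha>)"
    have e: "(\<lambda>z. norm (e z)) summable_on UNIV \<times> UNIV"
      unfolding Infinite_Sum.abs_summable_on_Sigma_iff
    proof (intro conjI ballI)
      show "(\<lambda>\<alpha>. norm (e (k, \<alpha>))) summable_on UNIV" for k
        using pm[of k] by (simp add: e_def series_converges_at_def)
      have "(\<Sum>\<^sub>\<infinity>\<alpha>. norm (e (k, \<alpha>))) = pval m t ^ k" for k
        using pm[of k] mk by (simp add: e_def pval_def abs_mult)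
      moreover have "(\<lambda>k. \<bar>pval m t ^ k\<bar>) summable_on UNIV"
        using m0 t(3) summable_geometric[of "pval m t"]
        by (intro norm_summable_imp_summable_on) auto
      ultimately show "(\<lambda>k. norm (\<Sum>\<^sub>\<infinity>\<alpha>. norm (e (k, \<alpha>)))) summable_on UNIV" by simp
    qed
    have "(\<lambda>z. norm (d z)) summable_on UNIV \<times> UNIV"
    proof (rule summable_on_comparison_test[OF e])
      show "norm (d z) \<le> norm (e z)" for z
        using coef_power_majorant[of h "fst z" "snd z"] mk
        by (auto simp: d_def e_def m_def abs_mult split: prod.splits intro!: mult_right_mono)
    qed auto
    then have d: "d summable_on UNIV \<times> UNIV" by (simp only: abs_summable_iff_real real_norm_def)
    then have d': "(\<lambda>(\<alpha>, k). d (k, \<alpha>)) summable_on UNIV \<times> UNIV"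
      using summable_on_swap[of d UNIV UNIV] by simp
    have inner: "(\<Sum>\<^sub>\<infinity>k. d (k, \<alpha>)) = f \<alpha> * t powr \<alpha>" for \<alpha>
      by (simp add: d_def f_def infsum_cmult_left')
    have "(\<lambda>\<alpha>. f \<alpha> * t powr \<alpha>) summable_on UNIV"
      using summable_on_Sigma_banach[OF d'] inner by simp
    then have conv: "series_converges_at f t"
      by (simp add: series_converges_at_def abs_summable_iff_real)
    have "(\<Sum>\<^sub>\<infinity>\<alpha>. f \<alpha> * t powr \<alpha>) = (\<Sum>\<^sub>\<infinity>k. \<Sum>\<^sub>\<infinity>\<alpha>. d (k, \<alpha>))"
      using infsum_swap_banach[of "\<lambda>\<alpha> k. d (k, \<alpha>)" UNIV UNIV] d' inner by simp
    also have "\<dots> = (\<Sum>\<^sub>\<infinity>k. pval h t ^ k)"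
      using ph by (simp add: d_def pval_def)
    also have "\<dots> = 1 / (1 - pval h t)"
      using h1 by (intro infsumI norm_summable_imp_has_sum geometric_sums)
        (auto simp: power_abs intro!: summable_geometric)
    finally have "(\<Sum>\<^sub>\<infinity>\<alpha>. f \<alpha> * t powr \<alpha>) * (1 - pval h t) = 1"
      using h1 by simp
    with conv show ?thesis by simp
  qed
  have lm: "lead_exp m = lead_exp h"
    by (simp add: m_def lead_exp_def coef_majorant)
  have "m < 1"
  proof (rule less_if_lead_exp_less)
    show "m = 0 \<or> lead_exp m < lead_exp 1" using lm h by simp
  qed simp
  then have "eventually (\<lambda>t. pval m t < 1) at_top"
    using eventually_pval_one unfolding less_puiseux_iff by eventually_elim simp
  then have ev: "eventually (\<lambda>t. 0 < t \<and> series_converges_at (coef h) t \<and> pval m t < 1) at_top"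
    using eventually_gt_at_top[of 0] eventually_converges[of h] by eventually_elim simp
  have "is_puiseux f"
  proof (rule is_puiseuxI)
    fix r
    have "{\<alpha>. f \<alpha> \<noteq> 0 \<and> r \<le> \<alpha>} \<subseteq> (\<Union>k\<in>{..nat \<lceil>r / lead_exp h\<rceil>}. {\<alpha>. coef (h ^ k) \<alpha> \<noteq> 0 \<and> r \<le> \<alpha>})"
    proof safe
      fix \<alpha> assume \<alpha>: "f \<alpha> \<noteq> 0" "r \<le> \<alpha>"
      then obtain k where k: "coef (h ^ k) \<alpha> \<noteq> 0"
        unfolding f_def by (metis infsum_0)
      then have "r \<le> real k * lead_exp h" using zero[of k \<alpha>] \<alpha> by fastforce
      then have "real k \<le> r / lead_exp h" using h by (simp add: field_simps)
      then have "k \<le> nat \<lceil>r / lead_exp h\<rceil>" by linarith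
      then show "\<alpha> \<in> (\<Union>k\<in>{..nat \<lceil>r / lead_exp h\<rceil>}. {\<alpha>. coef (h ^ k) \<alpha> \<noteq> 0 \<and> r \<le> \<alpha>})"
        using k \<alpha> by auto
    qed
    then show "finite {\<alpha>. f \<alpha> \<noteq> 0 \<and> r \<le> \<alpha>}"
      by (rule finite_subset) (auto intro: finite_support_ge)
    show "eventually (series_converges_at f) at_top"
      using ev by eventually_elim (use key in blast)
  qed
  then have cf: "coef (Abs_puiseux f) = f" by (simp add: Abs_puiseux_inverse)
  have "Abs_puiseux f * (1 - h) = 1"
    unfolding puiseux_eq_iff
    using ev eventually_pval_mult[of "Abs_puiseux f" "1 - h"] eventually_pval_diff[of 1 h] eventually_pval_one
    by eventually_elim (use key in \<open>simp add: pval_def[of "Abs_puiseux f"] cf\<close>)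
  then show ?thesis by blast
qed

text \<open>Normalizing the leading term to \<open>1\<close> reduces inversion to the case of \<open>1 - h\<close>.\<close>

lemma inverse_exists:
  fixes z :: puiseux
  assumes "z \<noteq> 0"
  shows "\<exists>u. u * z = 1"
proof -
  define a where "a = lead_exp z"
  define w where "w = monomial (1 / coef z a) (- a)"
  have ca: "coef z a \<noteq> 0" using lead_exp(1)[OF assms] by (simp add: a_def lead_coef_def)
  have coef_wz: "coef (w * z) \<alpha> = coef z (\<alpha> + a) / coef z a" for \<alpha>
  proof -
    have "{\<beta>. coef w \<beta> \<noteq> 0 \<and> coef z (\<alpha> - \<beta>) \<noteq> 0} = (if coef z (\<alpha> + a) \<noteq> 0 then {- a} else {})"
      using ca by (auto simp: w_def coef_monomial)
    then show ?thesis
      by (simp add: coef_mult convolution_def) (simp add: w_def coef_monomial)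
  qed
  define h where "h = 1 - w * z"
  have h: "\<alpha> < 0" if "coef h \<alpha> \<noteq> 0" for \<alpha>
  proof -
    have "\<alpha> \<noteq> 0" using that ca by (auto simp: h_def coef_diff coef_wz one_puiseux.rep_eq)
    moreover from this have "coef z (\<alpha> + a) \<noteq> 0"
      using that by (auto simp: h_def coef_diff coef_wz one_puiseux.rep_eq)
    then have "\<alpha> + a \<le> a" unfolding a_def using lead_exp(2)[OF assms] by blast
    ultimately show ?thesis by simp
  qed
  show ?thesis
  proof (cases "h = 0")
    case True
    then show ?thesis by (intro exI[of _ w]) (simp add: h_def)
  next
    case False
    then have "lead_exp h < 0" using lead_exp(1)[of h] h by (simp add: lead_coef_def)
    then obtain g where "g * (1 - h) = 1" using inverse_one_minus_exists False by blast
    then show ?thesis by (intro exI[of _ "g * w"]) (simp add: h_def mult.assoc)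
  qed
qed

instantiation puiseux :: linordered_field
begin

definition inverse_puiseux :: "puiseux \<Rightarrow> puiseux" where
  "inverse_puiseux z = (if z = 0 then 0 else SOME u. u * z = 1)"

definition divide_puiseux :: "puiseux \<Rightarrow> puiseux \<Rightarrow> puiseux" where
  "divide_puiseux x y = x * inverse y"

instance
proof
  fix x y :: puiseux
  show "inverse x * x = 1" if "x \<noteq> 0"
    using someI_ex[OF inverse_exists[OF that]] that by (simp add: inverse_puiseux_def)
qed (simp_all add: divide_puiseux_def inverse_puiseux_def)

end

lemma eventually_pval_sum:
  "eventually (\<lambda>t. pval (\<Sum>j\<in>S. f j) t = (\<Sum>j\<in>S. pval (f j) t)) at_top"
proof (induction S rule: infinite_finite_induct)
  case (insert j S)
  with eventually_pval_add[of "f j" "\<Sum>j\<in>S. f j"] show ?case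
    by (auto elim: eventually_elim2)
qed simp_all

section \<open>Linear programming over Puiseux series\<close>

definition pdot :: "puiseux ^ 'n \<Rightarrow> puiseux ^ 'n \<Rightarrow> puiseux" where
  "pdot a x = (\<Sum>j\<in>UNIV. a $ j * x $ j)"

lemma pdot_add_left: "pdot (a + b) x = pdot a x + pdot b x"
  by (simp add: pdot_def distrib_right sum.distrib)

lemma pdot_add_right: "pdot a (x + y) = pdot a x + pdot a y"
  by (simp add: pdot_def distrib_left sum.distrib)

lemma pdot_scale_left: "pdot (k *s a) x = k * pdot a x"
  by (simp add: pdot_def sum_distrib_left mult.assoc)

lemma pdot_scale_right: "pdot a (k *s x) = k * pdot a x"
  by (simp add: pdot_def sum_distrib_left mult.left_commute)

lemma pdot_uminus_left: "pdot (- a) x = - pdot a x"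
  by (simp add: pdot_def sum_negf)

lemma pdot_diff_left: "pdot (a - b) x = pdot a x - pdot b x"
  by (simp add: pdot_def left_diff_distrib sum_subtractf)

lemma pdot_zero [simp]: "pdot 0 x = 0" "pdot a 0 = 0"
  by (simp_all add: pdot_def)

lemma pdot_axis: "pdot (axis j 1) x = x $ j"
proof -
  have "(\<Sum>i\<in>UNIV. (if i = j then 1 else 0) * x $ i) = (\<Sum>i\<in>UNIV. if i = j then x $ i else 0)"
    by (rule sum.cong) auto
  then show ?thesis by (simp add: pdot_def axis_def)
qed

lemma eventually_pval_pdot: "eventually (\<lambda>t. pval (pdot a x) t = vec_pval a t \<bullet> vec_pval x t) at_top"
proof -
  have "eventually (\<lambda>t. \<forall>j\<in>UNIV. pval (a $ j * x $ j) t = pval (a $ j) t * pval (x $ j) t) at_top"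
    by (intro eventually_ball_finite ballI eventually_pval_mult) simp
  with eventually_pval_sum[of "\<lambda>j. a $ j * x $ j" UNIV] show ?thesis
    by eventually_elim (simp add: pdot_def inner_vec_def vec_pval_def)
qed

lemma eventually_vec_pval_add:
  "eventually (\<lambda>t. vec_pval (a + b) t = vec_pval a t + vec_pval b t) at_top"
proof -
  have "eventually (\<lambda>t. \<forall>j\<in>UNIV. pval (a $ j + b $ j) t = pval (a $ j) t + pval (b $ j) t) at_top"
    by (intro eventually_ball_finite ballI eventually_pval_add) simp
  then show ?thesis by eventually_elim (simp add: vec_eq_iff vec_pval_def)
qed

lemma eventually_vec_pval_scale:
  "eventually (\<lambda>t. vec_pval (k *s a) t = pval k t *\<^sub>R vec_pval a t) at_top"
proof -
  have "eventually (\<lambda>t. \<forall>j\<in>UNIV. pval (k * a $ j) t = pval k t * pval (a $ j) t) at_top"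
    by (intro eventually_ball_finite ballI eventually_pval_mult) simp
  then show ?thesis by eventually_elim (simp add: vec_eq_iff vec_pval_def)
qed

lemma vec_pval_zero [simp]: "vec_pval 0 t = 0"
  by (simp add: vec_eq_iff vec_pval_def)

lemma vec_pval_uminus [simp]: "vec_pval (- a) t = - vec_pval a t"
  by (simp add: vec_eq_iff vec_pval_def)

lemma vec_pval_axis: "t > 0 \<Longrightarrow> vec_pval (axis j 1) t = axis j 1"
  by (simp add: vec_eq_iff vec_pval_def axis_def)

text \<open>
  A constraint \<open>(a, \<alpha>, \<beta>, \<gamma>)\<close> stands for \<open>\<langle>a, x\<rangle> + \<alpha> v \<le> \<beta> + \<gamma> e\<close>. The variables \<open>x\<close> are to be
  eliminated; \<open>v\<close> will be the value of an objective and \<open>e\<close> a parameter of the right-hand side.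
\<close>

type_synonym 'n constraint = "(puiseux ^ 'n) \<times> puiseux \<times> puiseux \<times> puiseux"

definition sat :: "('n::finite) constraint \<Rightarrow> puiseux ^ 'n \<Rightarrow> puiseux \<Rightarrow> puiseux \<Rightarrow> bool" where
  "sat = (\<lambda>(a, \<alpha>, \<beta>, \<gamma>) x v e. pdot a x + \<alpha> * v \<le> \<beta> + \<gamma> * e)"

definition sat_at :: "real \<Rightarrow> ('n::finite) constraint \<Rightarrow> real ^ 'n \<Rightarrow> real \<Rightarrow> real \<Rightarrow> bool" where
  "sat_at t = (\<lambda>(a, \<alpha>, \<beta>, \<gamma>) x v e. vec_pval a t \<bullet> x + pval \<alpha> t * v \<le> pval \<beta> t + pval \<gamma> t * e)"

definition scale_constraint :: "puiseux \<Rightarrow> ('n::finite) constraint \<Rightarrow> 'n constraint" where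
  "scale_constraint k = (\<lambda>(a, \<alpha>, \<beta>, \<gamma>). (k *s a, k * \<alpha>, k * \<beta>, k * \<gamma>))"

text \<open>The cone spanned by a system; its elements are Farkas certificates for consequences of the system.\<close>

inductive_set derivable :: "('n::finite) constraint set \<Rightarrow> 'n constraint set" for C where
  base: "k \<in> C \<Longrightarrow> k \<in> derivable C"
| add: "k \<in> derivable C \<Longrightarrow> l \<in> derivable C \<Longrightarrow> k + l \<in> derivable C"
| scale: "k \<in> derivable C \<Longrightarrow> 0 \<le> r \<Longrightarrow> scale_constraint r k \<in> derivable C"

lemma derivable_sat:
  assumes "k \<in> derivable C" "\<And>k. k \<in> C \<Longrightarrow> sat k x v e"
  shows "sat k x v e"
  using assms(1)
proof induction
  case (base k)
  then show ?case by (rule assms(2))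
next
  case (add k l)
  obtain a \<alpha> \<beta> \<gamma> a' \<alpha>' \<beta>' \<gamma>' where kl: "k = (a, \<alpha>, \<beta>, \<gamma>)" "l = (a', \<alpha>', \<beta>', \<gamma>')"
    by (metis prod_cases4)
  have "pdot a x + \<alpha> * v \<le> \<beta> + \<gamma> * e" "pdot a' x + \<alpha>' * v \<le> \<beta>' + \<gamma>' * e"
    using add by (simp_all add: kl sat_def)
  from add_mono[OF this] show ?case by (simp add: kl sat_def pdot_add_left algebra_simps)
next
  case (scale k r)
  obtain a \<alpha> \<beta> \<gamma> where k: "k = (a, \<alpha>, \<beta>, \<gamma>)" by (metis prod_cases4)
  have "pdot a x + \<alpha> * v \<le> \<beta> + \<gamma> * e" using scale by (simp add: k sat_def)
  from mult_left_mono[OF this scale(2)] show ?case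
    by (simp add: k sat_def scale_constraint_def pdot_scale_left algebra_simps)
qed

text \<open>
  A derivation is a certificate with finitely many Puiseux coefficients, so it remains valid after
  evaluation at a large real: this carries inequalities from series to real numbers.
\<close>

lemma derivable_sat_at:
  assumes "k \<in> derivable C"
  shows "eventually (\<lambda>t. \<forall>x v e. (\<forall>l\<in>C. sat_at t l x v e) \<longrightarrow> sat_at t k x v e) at_top"
  using assms
proof induction
  case (base k)
  then show ?case by simp
next
  case (add k l)
  obtain a \<alpha> \<beta> \<gamma> a' \<alpha>' \<beta>' \<gamma>' where kl: "k = (a, \<alpha>, \<beta>, \<gamma>)" "l = (a', \<alpha>', \<beta>', \<gamma>')"
    by (metis prod_cases4)
  have "eventually (\<lambda>t. \<forall>x v e. sat_at t k x v e \<and> sat_at t l x v e \<longrightarrow> sat_at t (k + l) x v e) at_top"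
    using eventually_vec_pval_add[of a a'] eventually_pval_add[of \<alpha> \<alpha>'] eventually_pval_add[of \<beta> \<beta>']
      eventually_pval_add[of \<gamma> \<gamma>']
    by eventually_elim (auto simp: kl sat_at_def inner_add_left algebra_simps)
  with add.IH show ?case by eventually_elim blast
next
  case (scale k r)
  obtain a \<alpha> \<beta> \<gamma> where k: "k = (a, \<alpha>, \<beta>, \<gamma>)" by (metis prod_cases4)
  have r: "eventually (\<lambda>t. 0 \<le> pval r t) at_top" using scale(2) by (simp add: le_puiseux_iff)
  have "eventually (\<lambda>t. \<forall>x v e. sat_at t k x v e \<longrightarrow> sat_at t (scale_constraint r k) x v e) at_top"
    using eventually_vec_pval_scale[of r a] eventually_pval_mult[of r \<alpha>] eventually_pval_mult[of r \<beta>]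
      eventually_pval_mult[of r \<gamma>] r
  proof eventually_elim
    case (elim t)
    show ?case
    proof (intro allI impI)
      fix x v e assume "sat_at t k x v e"
      then have "vec_pval a t \<bullet> x + pval \<alpha> t * v \<le> pval \<beta> t + pval \<gamma> t * e"
        by (simp add: k sat_at_def)
      from mult_left_mono[OF this elim(5)] elim show "sat_at t (scale_constraint r k) x v e"
        by (simp add: k sat_at_def scale_constraint_def algebra_simps)
    qed
  qed
  with scale.IH show ?case by eventually_elim blast
qed

text \<open>
  A system in one unknown is solvable as soon as every lower bound is below every upper bound.
\<close>

lemma finite_system_solvable:
  fixes \<kappa> r :: "'b \<Rightarrow> 'a :: linordered_field"
  assumes fin: "finite C"
    and zero: "\<And>k. k \<in> C \<Longrightarrow> \<kappa> k = 0 \<Longrightarrow> 0 \<le> r k"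
    and comb: "\<And>p q. p \<in> C \<Longrightarrow> q \<in> C \<Longrightarrow> 0 < \<kappa> p \<Longrightarrow> \<kappa> q < 0 \<Longrightarrow> 0 \<le> \<kappa> p * r q - \<kappa> q * r p"
  shows "\<exists>y. \<forall>k\<in>C. \<kappa> k * y \<le> r k"
proof -
  define L where "L = (\<lambda>q. r q / \<kappa> q) ` {q\<in>C. \<kappa> q < 0}"
  define U where "U = (\<lambda>p. r p / \<kappa> p) ` {p\<in>C. 0 < \<kappa> p}"
  have fLU: "finite L" "finite U" using fin by (simp_all add: L_def U_def)
  have LU: "l \<le> u" if lu: "l \<in> L" "u \<in> U" for l u
  proof -
    obtain p q where pq: "p \<in> C" "q \<in> C" "0 < \<kappa> p" "\<kappa> q < 0" "l = r q / \<kappa> q" "u = r p / \<kappa> p"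
      using lu by (auto simp: L_def U_def)
    have "r q = \<kappa> q * l" "r p = \<kappa> p * u" using pq by auto
    then have "0 \<le> (\<kappa> p * \<kappa> q) * (l - u)" using comb[OF pq(1-4)] by (simp add: algebra_simps)
    moreover have "\<kappa> p * \<kappa> q < 0" using pq by (simp add: mult_pos_neg)
    ultimately show ?thesis using mult_neg_pos[of "\<kappa> p * \<kappa> q" "l - u"] by (meson diff_gt_0_iff_gt leD leI)
  qed
  obtain y where y: "\<forall>l\<in>L. l \<le> y" "\<forall>u\<in>U. y \<le> u"
  proof (cases "L = {}")
    case False
    show ?thesis
    proof (rule that[of "Max L"])
      show "\<forall>l\<in>L. l \<le> Max L" using fLU by simp
      show "\<forall>u\<in>U. Max L \<le> u" using LU Max_in[OF fLU(1) False] by blast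
    qed
  next
    case L: True
    show ?thesis
    proof (cases "U = {}")
      case False
      then show ?thesis using L fLU by (intro that[of "Min U"]) auto
    qed (use L that in auto)
  qed
  have "\<kappa> k * y \<le> r k" if k: "k \<in> C" for k
  proof -
    consider "\<kappa> k = 0" | "0 < \<kappa> k" | "\<kappa> k < 0" by fastforce
    then show ?thesis
    proof cases
      case 1
      then show ?thesis using zero k by simp
    next
      case 2
      then have "y \<le> r k / \<kappa> k" using y k by (auto simp: U_def)
      then show ?thesis using 2 by (simp add: field_simps)
    next
      case 3
      then have "r k / \<kappa> k \<le> y" using y k by (auto simp: L_def)
      then show ?thesis using 3 by (simp add: field_simps)
    qed
  qed
  then show ?thesis by blast
qed

text \<open>
  Fourier--Motzkin elimination of the coordinates in \<open>J\<close>. That the new constraints are derivable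
  from the old ones is what makes them available at large reals.
\<close>

lemma fourier_motzkin_partial:
  fixes C :: "('n::finite) constraint set"
  assumes "finite C" "finite J"
  shows "\<exists>C'. finite C' \<and> C' \<subseteq> derivable C \<and> (\<forall>k\<in>C'. \<forall>j\<in>J. fst k $ j = 0) \<and>
    (\<forall>x v e. (\<forall>k\<in>C'. sat k x v e) \<longrightarrow> (\<exists>x'. \<forall>k\<in>C. sat k x' v e))"
  using assms(2)
proof (induction J)
  case empty
  show ?case by (rule exI[of _ C]) (use assms(1) in \<open>auto intro: derivable.base\<close>)
next
  case (insert j J)
  then obtain C' where C': "finite C'" "C' \<subseteq> derivable C" "\<And>k i. k \<in> C' \<Longrightarrow> i \<in> J \<Longrightarrow> fst k $ i = 0"
    and sol: "\<And>x v e. (\<forall>k\<in>C'. sat k x v e) \<Longrightarrow> (\<exists>x'. \<forall>k\<in>C. sat k x' v e)"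
    by metis
  define \<kappa> where "\<kappa> k = fst k $ j" for k :: "'n constraint"
  define comb where "comb p q = scale_constraint (\<kappa> p) q + scale_constraint (- \<kappa> q) p" for p q
  define C0 where "C0 = {k\<in>C'. \<kappa> k = 0}"
  define C1 where "C1 = (\<lambda>(p,q). comb p q) ` ({p\<in>C'. 0 < \<kappa> p} \<times> {q\<in>C'. \<kappa> q < 0})"
  have fin: "finite (C0 \<union> C1)" using C'(1) by (simp add: C0_def C1_def)
  have sub: "C0 \<union> C1 \<subseteq> derivable C"
  proof
    fix k assume "k \<in> C0 \<union> C1"
    then consider "k \<in> C'" | p q where "k = comb p q" "p \<in> C'" "q \<in> C'" "0 < \<kappa> p" "\<kappa> q < 0"
      by (auto simp: C0_def C1_def)
    then show "k \<in> derivable C"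
    proof cases
      case 2
      then show ?thesis using C'(2)
        by (auto simp only: comb_def intro!: derivable.add derivable.scale)
    qed (use C'(2) in blast)
  qed
  have zero: "fst k $ i = 0" if k: "k \<in> C0 \<union> C1" and i: "i \<in> insert j J" for k i
  proof (cases "k \<in> C0")
    case True
    then show ?thesis using i C'(3)[of k i] by (auto simp: C0_def \<kappa>_def)
  next
    case False
    with k obtain p q where pq: "p \<in> C'" "q \<in> C'" "k = comb p q" by (auto simp: C1_def)
    have "fst k $ i = \<kappa> p * fst q $ i - \<kappa> q * fst p $ i"
      by (simp add: pq comb_def scale_constraint_def split: prod.splits)
    then show ?thesis using i C'(3)[OF pq(1), of i] C'(3)[OF pq(2), of i] by (auto simp: \<kappa>_def)
  qed
  have "\<exists>x'. \<forall>k\<in>C. sat k x' v e" if x: "\<forall>k\<in>C0 \<union> C1. sat k x v e" for x v e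
  proof -
    define x0 where "x0 = (\<chi> i. if i = j then 0 else x $ i)"
    define r where "r k = (case k of (a, \<alpha>, \<beta>, \<gamma>) \<Rightarrow> \<beta> + \<gamma> * e - \<alpha> * v - pdot a x0)" for k
    have split_x: "x0 + x $ j *s axis j 1 = x"
      by (auto simp: vec_eq_iff x0_def axis_def)
    have pd: "pdot a (x0 + y *s axis j 1) = pdot a x0 + a $ j * y" for a y
    proof -
      have "pdot a (axis j 1) = pdot (axis j 1) a" by (simp add: pdot_def mult.commute)
      then show ?thesis by (simp add: pdot_add_right pdot_scale_right pdot_axis mult.commute)
    qed
    have sat_iff: "sat k (x0 + y *s axis j 1) v e \<longleftrightarrow> \<kappa> k * y \<le> r k" for k y
      by (auto simp: sat_def r_def \<kappa>_def pd algebra_simps split: prod.splits)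
    have sat_x: "\<kappa> k * x $ j \<le> r k" if "k \<in> C0 \<union> C1" for k
      using x that sat_iff[of k "x $ j"] split_x by simp
    have "\<exists>y. \<forall>k\<in>C'. \<kappa> k * y \<le> r k"
    proof (rule finite_system_solvable[OF C'(1)])
      show "0 \<le> r k" if "k \<in> C'" "\<kappa> k = 0" for k
        using sat_x[of k] that by (simp add: C0_def)
      show "0 \<le> \<kappa> p * r q - \<kappa> q * r p" if "p \<in> C'" "q \<in> C'" "0 < \<kappa> p" "\<kappa> q < 0" for p q
      proof -
        have "comb p q \<in> C0 \<union> C1" using that by (auto simp: C1_def)
        from sat_x[OF this] have "\<kappa> (comb p q) * x $ j \<le> r (comb p q)" .
        moreover have "\<kappa> (comb p q) = 0"
          by (simp add: \<kappa>_def comb_def scale_constraint_def split: prod.splits)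
        moreover have "r (comb p q) = \<kappa> p * r q - \<kappa> q * r p"
          by (simp add: r_def comb_def scale_constraint_def pdot_add_left pdot_scale_left pdot_diff_left
              algebra_simps split: prod.splits)
        ultimately show ?thesis by simp
      qed
    qed
    then obtain y where "\<forall>k\<in>C'. \<kappa> k * y \<le> r k" by blast
    then show ?thesis using sol[of "x0 + y *s axis j 1" v e] sat_iff by blast
  qed
  then show ?case using fin sub zero by (intro exI[of _ "C0 \<union> C1"]) blast
qed

lemma fourier_motzkin:
  fixes C :: "('n::finite) constraint set"
  assumes "finite C"
  shows "\<exists>T. finite T \<and> (\<forall>(\<alpha>, \<beta>, \<gamma>)\<in>T. (0, \<alpha>, \<beta>, \<gamma>) \<in> derivable C) \<and>
    (\<forall>v e. (\<forall>(\<alpha>, \<beta>, \<gamma>)\<in>T. \<alpha> * v \<le> \<beta> + \<gamma> * e) \<longrightarrow> (\<exists>x. \<forall>k\<in>C. sat k x v e))"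
proof -
  obtain C' where C': "finite C'" "C' \<subseteq> derivable C" "\<And>k j. k \<in> C' \<Longrightarrow> fst k $ j = 0"
    "\<And>x v e. (\<forall>k\<in>C'. sat k x v e) \<Longrightarrow> \<exists>x'. \<forall>k\<in>C. sat k x' v e"
    using fourier_motzkin_partial[OF assms finite_class.finite_UNIV] by (metis UNIV_I)
  have zero: "k = (0, snd k)" if "k \<in> C'" for k
    using C'(3)[OF that] by (simp add: prod_eq_iff vec_eq_iff)
  show ?thesis
  proof (intro exI[of _ "snd ` C'"] conjI allI impI)
    show "finite (snd ` C')" using C'(1) by simp
    show "\<forall>(\<alpha>, \<beta>, \<gamma>)\<in>snd ` C'. (0, \<alpha>, \<beta>, \<gamma>) \<in> derivable C"
    proof
      fix q assume "q \<in> snd ` C'"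
      then obtain k where k: "k \<in> C'" "q = snd k" by blast
      have "(0, q) \<in> C'" using zero[OF k(1)] k by simp
      then show "case q of (\<alpha>, \<beta>, \<gamma>) \<Rightarrow> (0, \<alpha>, \<beta>, \<gamma>) \<in> derivable C"
        using C'(2) by (auto split: prod.split)
    qed
    fix v e assume T: "\<forall>(\<alpha>, \<beta>, \<gamma>)\<in>snd ` C'. \<alpha> * v \<le> \<beta> + \<gamma> * e"
    show "\<exists>x. \<forall>k\<in>C. sat k x v e"
    proof (rule C'(4)[of 0])
      show "\<forall>k\<in>C'. sat k 0 v e"
      proof
        fix k assume k: "k \<in> C'"
        obtain \<alpha> \<beta> \<gamma> where s: "snd k = (\<alpha>, \<beta>, \<gamma>)" by (metis prod_cases3)
        have "\<alpha> * v \<le> \<beta> + \<gamma> * e" using bspec[OF T imageI[OF k]] s by simp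
        then show "sat k 0 v e" by (subst zero[OF k]) (simp add: sat_def s)
      qed
    qed
  qed
qed

definition solutions :: "((puiseux ^ 'n) \<times> puiseux) set \<Rightarrow> (puiseux ^ 'n) set" where
  "solutions R = {x. \<forall>(a, b)\<in>R. pdot a x \<le> b}"

definition solutions_at :: "((puiseux ^ 'n) \<times> puiseux) set \<Rightarrow> real \<Rightarrow> (real ^ 'n) set" where
  "solutions_at R t = {x. \<forall>(a, b)\<in>R. vec_pval a t \<bullet> x \<le> pval b t}"

definition optimal_point ::
  "(puiseux ^ 'n) set \<Rightarrow> puiseux ^ 'n \<Rightarrow> puiseux ^ 'n \<Rightarrow> puiseux \<Rightarrow> puiseux ^ 'n \<Rightarrow> bool" where
  "optimal_point P c g e x \<longleftrightarrow> x \<in> P \<and> pdot c x \<le> e \<and>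
     (\<forall>x'\<in>P. pdot c x' \<le> e \<longrightarrow> pdot g x' \<le> pdot g x)"

text \<open>
  Eliminating \<open>x\<close> from the system \<open>v \<le> \<langle>g, x\<rangle>\<close>, \<open>x \<in> solutions Q\<close>, \<open>\<langle>c, x\<rangle> \<le> e\<close> describes the optimal
  value as the minimum of finitely many affine functions of \<open>e\<close>. The active one of them also bounds
  the objective at large reals.
\<close>

lemma parametric_optimum:
  fixes Q :: "((puiseux ^ 'n) \<times> puiseux) set" and c g :: "puiseux ^ 'n"
  assumes "finite Q"
  shows "\<exists>T. finite T \<and> (\<forall>e B y. y \<in> solutions Q \<and> pdot c y \<le> e \<and>
      (\<forall>x\<in>solutions Q. pdot c x \<le> e \<longrightarrow> pdot g x \<le> B) \<longrightarrow>
      (\<exists>x. optimal_point (solutions Q) c g e x \<and>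
        (\<exists>(\<alpha>, \<beta>, \<gamma>)\<in>T. 0 < \<alpha> \<and> \<alpha> * pdot g x = \<beta> + \<gamma> * e) \<and>
        (\<forall>\<^sub>F t in at_top. \<forall>z\<in>solutions_at Q t. vec_pval c t \<bullet> z \<le> pval e t \<longrightarrow>
           vec_pval g t \<bullet> z \<le> pval (pdot g x) t)))"
proof -
  define C :: "'n constraint set" where "C = (\<lambda>(a, b). (a, 0, b, 0)) ` Q \<union> {(c, 0, 0, 1), (- g, 1, 0, 0)}"
  have C: "(\<forall>k\<in>C. sat k x v e) \<longleftrightarrow> x \<in> solutions Q \<and> pdot c x \<le> e \<and> v \<le> pdot g x" for x v e
    by (simp add: C_def sat_def solutions_def pdot_uminus_left ball_Un split_def) blast
  have C_at: "\<forall>k\<in>C. sat_at t k x v e"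
    if "0 < t" "x \<in> solutions_at Q t" "vec_pval c t \<bullet> x \<le> e" "v \<le> vec_pval g t \<bullet> x" for t x v e
    using that by (simp add: C_def sat_at_def solutions_at_def ball_Un split_def)
  have "finite C" using assms by (simp add: C_def)
  from fourier_motzkin[OF this]
  obtain T where T: "finite T" and T_derivable: "\<forall>(\<alpha>, \<beta>, \<gamma>)\<in>T. (0, \<alpha>, \<beta>, \<gamma>) \<in> derivable C"
    and T_sol: "\<forall>v e. (\<forall>(\<alpha>, \<beta>, \<gamma>)\<in>T. \<alpha> * v \<le> \<beta> + \<gamma> * e) \<longrightarrow> (\<exists>x. \<forall>k\<in>C. sat k x v e)"
    by (elim exE conjE)
  have derivable: "(0, \<alpha>, \<beta>, \<gamma>) \<in> derivable C" if "(\<alpha>, \<beta>, \<gamma>) \<in> T" for \<alpha> \<beta> \<gamma>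
    using T_derivable that by blast
  show ?thesis
  proof (intro exI[of _ T] conjI allI impI T)
    fix e B y
    assume *: "y \<in> solutions Q \<and> pdot c y \<le> e \<and>
      (\<forall>x\<in>solutions Q. pdot c x \<le> e \<longrightarrow> pdot g x \<le> B)"
    then have y: "y \<in> solutions Q" "pdot c y \<le> e" by blast+
    have valid: "\<alpha> * v \<le> \<beta> + \<gamma> * e"
      if "(\<alpha>, \<beta>, \<gamma>) \<in> T" "x \<in> solutions Q" "pdot c x \<le> e" "v \<le> pdot g x" for \<alpha> \<beta> \<gamma> v x
      using derivable_sat[OF derivable[OF that(1)], of x v e] C[of x v e] that by (simp add: sat_def)
    \<comment> \<open>The variable \<open>v\<close> is unbounded below, so its coefficients are nonnegative.\<close>
    have nonneg: "0 \<le> \<alpha>" if k: "(\<alpha>, \<beta>, \<gamma>) \<in> T" for \<alpha> \<beta> \<gamma>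
    proof (rule ccontr)
      assume "\<not> 0 \<le> \<alpha>"
      then have \<alpha>: "\<alpha> < 0" by simp
      define v where "v = min (pdot g y) ((\<beta> + \<gamma> * e) / \<alpha> - 1)"
      have "\<alpha> * ((\<beta> + \<gamma> * e) / \<alpha> - 1) \<le> \<alpha> * v"
        using \<alpha> by (intro mult_left_mono_neg) (auto simp: v_def)
      also have "\<alpha> * v \<le> \<beta> + \<gamma> * e" using y by (intro valid[OF k, of y]) (auto simp: v_def)
      finally have "\<alpha> * ((\<beta> + \<gamma> * e) / \<alpha> - 1) \<le> \<beta> + \<gamma> * e" .
      moreover have "\<alpha> * ((\<beta> + \<gamma> * e) / \<alpha> - 1) = \<beta> + \<gamma> * e - \<alpha>"
        using \<alpha> by (simp only: right_diff_distrib) simp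
      ultimately show False using \<alpha> by simp
    qed
    define V where "V = (\<lambda>(\<alpha>, \<beta>, \<gamma>). (\<beta> + \<gamma> * e) / \<alpha>) ` {(\<alpha>, \<beta>, \<gamma>)\<in>T. 0 < \<alpha>}"
    have "finite V" unfolding V_def using T by (intro finite_imageI finite_subset[OF _ T]) auto
    have solvable: "\<exists>x\<in>solutions Q. pdot c x \<le> e \<and> v \<le> pdot g x" if v: "\<forall>u\<in>V. v \<le> u" for v
    proof -
      have "\<alpha> * v \<le> \<beta> + \<gamma> * e" if k: "(\<alpha>, \<beta>, \<gamma>) \<in> T" for \<alpha> \<beta> \<gamma>
      proof (cases "\<alpha> = 0")
        case True
        then show ?thesis using valid[OF k y, of "pdot g y"] by simp
      next
        case False
        then have \<alpha>: "0 < \<alpha>" using nonneg[OF k] by simp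
        then have "v \<le> (\<beta> + \<gamma> * e) / \<alpha>" using v k by (force simp: V_def)
        then show ?thesis using \<alpha> by (simp add: field_simps)
      qed
      then have "\<forall>(\<alpha>, \<beta>, \<gamma>)\<in>T. \<alpha> * v \<le> \<beta> + \<gamma> * e" by blast
      then obtain x where "\<forall>k\<in>C. sat k x v e" using T_sol[rule_format, of v e] by blast
      then show ?thesis using C by blast
    qed
    have "V \<noteq> {}"
    proof
      assume "V = {}"
      then obtain x where "x \<in> solutions Q" "pdot c x \<le> e" "B + 1 \<le> pdot g x"
        using solvable[of "B + 1"] by auto
      moreover from this have "pdot g x \<le> B" using * by blast
      ultimately show False by (metis add_le_same_cancel1 not_one_le_zero order_trans)
    qed
    then have MV: "Min V \<in> V" using \<open>finite V\<close> by simp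
    then obtain \<alpha> \<beta> \<gamma> where k: "(\<alpha>, \<beta>, \<gamma>) \<in> T" "0 < \<alpha>" "Min V = (\<beta> + \<gamma> * e) / \<alpha>"
      by (auto simp: V_def)
    obtain x where x: "x \<in> solutions Q" "pdot c x \<le> e" "Min V \<le> pdot g x"
      using solvable[of "Min V"] \<open>finite V\<close> by auto
    have le: "pdot g x' \<le> Min V" if "x' \<in> solutions Q" "pdot c x' \<le> e" for x'
    proof -
      have "\<alpha> * pdot g x' \<le> \<alpha> * Min V" using valid[OF k(1) that order_refl] k by simp
      then show ?thesis using k(2) by simp
    qed
    have gx: "pdot g x = Min V" using x le[of x] by simp
    have eq: "\<alpha> * pdot g x = \<beta> + \<gamma> * e" using k by (simp add: gx)
    have pos: "eventually (\<lambda>t. 0 < pval \<alpha> t) at_top" using k(2) by (simp add: less_puiseux_iff)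
    have large: "\<forall>\<^sub>F t in at_top. \<forall>z\<in>solutions_at Q t. vec_pval c t \<bullet> z \<le> pval e t \<longrightarrow>
           vec_pval g t \<bullet> z \<le> pval (pdot g x) t"
      using derivable_sat_at[OF derivable[OF k(1)]] eventually_gt_at_top[of 0] pos
        eventually_pval_mult[of \<alpha> "pdot g x"] eventually_pval_add[of \<beta> "\<gamma> * e"] eventually_pval_mult[of \<gamma> e]
    proof eventually_elim
      case (elim t)
      show ?case
      proof (intro ballI impI)
        fix z assume "z \<in> solutions_at Q t" "vec_pval c t \<bullet> z \<le> pval e t"
        then have "sat_at t (0, \<alpha>, \<beta>, \<gamma>) z (vec_pval g t \<bullet> z) (pval e t)"
          using elim(1) C_at[OF elim(2)] by blast
        then have "pval \<alpha> t * (vec_pval g t \<bullet> z) \<le> pval \<alpha> t * pval (pdot g x) t"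
          using elim eq by (simp add: sat_at_def)
        then show "vec_pval g t \<bullet> z \<le> pval (pdot g x) t" using elim(3) by simp
      qed
    qed
    have "optimal_point (solutions Q) c g e x"
      using x le gx by (simp add: optimal_point_def)
    then show "\<exists>x. optimal_point (solutions Q) c g e x \<and>
        (\<exists>(\<alpha>, \<beta>, \<gamma>)\<in>T. 0 < \<alpha> \<and> \<alpha> * pdot g x = \<beta> + \<gamma> * e) \<and>
        (\<forall>\<^sub>F t in at_top. \<forall>z\<in>solutions_at Q t. vec_pval c t \<bullet> z \<le> pval e t \<longrightarrow>
           vec_pval g t \<bullet> z \<le> pval (pdot g x) t)"
      using k(1,2) eq large by (intro exI[of _ x]) auto
  qed
qed

lemma optimum_eventually:
  assumes Q: "finite Q" and x: "optimal_point (solutions Q) c g e x"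
  shows "\<forall>\<^sub>F t in at_top. \<forall>z\<in>solutions_at Q t. vec_pval c t \<bullet> z \<le> pval e t \<longrightarrow>
    vec_pval g t \<bullet> z \<le> pval (pdot g x) t"
proof -
  obtain y where y: "optimal_point (solutions Q) c g e y" and
    "\<forall>\<^sub>F t in at_top. \<forall>z\<in>solutions_at Q t. vec_pval c t \<bullet> z \<le> pval e t \<longrightarrow>
      vec_pval g t \<bullet> z \<le> pval (pdot g y) t"
    using parametric_optimum[OF Q, of c g] x unfolding optimal_point_def by blast
  moreover have "pdot g y = pdot g x" using x y by (auto simp: optimal_point_def intro: antisym)
  ultimately show ?thesis by simp
qed

text \<open>With cost vector \<open>0\<close> and budget \<open>0\<close> the optimum is taken over the whole polyhedron.\<close>

lemma valid_inequality_eventually: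
  assumes Q: "finite Q" "y \<in> solutions Q" and B: "\<And>x. x \<in> solutions Q \<Longrightarrow> pdot g x \<le> B"
  shows "\<forall>\<^sub>F t in at_top. \<forall>x\<in>solutions_at Q t. vec_pval g t \<bullet> x \<le> pval B t"
proof -
  have "y \<in> solutions Q \<and> pdot 0 y \<le> 0 \<and> (\<forall>x\<in>solutions Q. pdot 0 x \<le> 0 \<longrightarrow> pdot g x \<le> B)"
    using Q(2) B by simp
  then obtain x where x: "optimal_point (solutions Q) 0 g 0 x"
    using parametric_optimum[OF Q(1), of 0 g] by blast
  then have "pdot g x \<le> B" using B by (simp add: optimal_point_def)
  then have "\<forall>\<^sub>F t in at_top. pval (pdot g x) t \<le> pval B t" by (simp add: le_puiseux_iff)
  with optimum_eventually[OF Q(1) x] show ?thesis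
  proof eventually_elim
    case (elim t)
    show ?case
    proof
      fix z assume "z \<in> solutions_at Q t"
      then have "vec_pval g t \<bullet> z \<le> pval (pdot g x) t" using elim(1) by simp
      then show "vec_pval g t \<bullet> z \<le> pval B t" using elim(2) by simp
    qed
  qed
qed

section \<open>Piecewise linearity\<close>

text \<open>
  A continuous selection from finitely many affine functions can switch only where two of them meet.
\<close>

lemma piecewise_linear_selection:
  fixes \<phi> :: "real \<Rightarrow> real"
  assumes cont: "continuous_on UNIV \<phi>" and fin: "finite A" "finite B" "finite S"
    and sel: "\<And>\<mu>. \<mu> \<notin> S \<Longrightarrow> \<phi> \<mu> \<in> A \<or> \<phi> \<mu> - \<mu> \<in> B"
  shows "piecewise_linear \<phi>"
proof -
  define L where "L = A \<times> {0} \<union> B \<times> {1::real}"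
  define S' where "S' = S \<union> (\<lambda>(a, b). a - b) ` (A \<times> B)"
  define E where "E = (\<lambda>l. {\<mu>. \<phi> \<mu> = fst l + \<mu> * snd l})"
  have finL: "finite L" using fin by (simp add: L_def)
  have closedE: "closed (E l)" for l
    unfolding E_def by (intro closed_Collect_eq cont continuous_intros)
  have meet: "\<mu> \<in> S'" if "l \<in> L" "l' \<in> L" "l \<noteq> l'" "\<mu> \<in> E l" "\<mu> \<in> E l'" for l l' \<mu>
  proof -
    have "\<exists>a\<in>A. \<exists>b\<in>B. \<mu> = a - b"
      using that by (force simp: L_def E_def)
    then show ?thesis by (force simp: S'_def)
  qed
  have "\<exists>u v. \<forall>\<mu>\<in>I. \<phi> \<mu> = u + \<mu> *\<^sub>R v" if I: "is_interval I" "I \<inter> S' = {}" for I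
  proof (cases "I = {}")
    case False
    have cover: "\<exists>l\<in>L. \<mu> \<in> E l" if "\<mu> \<in> I" for \<mu>
    proof -
      have "\<mu> \<notin> S" using that I(2) by (auto simp: S'_def)
      then consider "\<phi> \<mu> \<in> A" | "\<phi> \<mu> - \<mu> \<in> B" using sel by blast
      then show ?thesis
      proof cases
        case 1
        then show ?thesis by (intro bexI[of _ "(\<phi> \<mu>, 0)"]) (auto simp: E_def L_def)
      next
        case 2
        then show ?thesis by (intro bexI[of _ "(\<phi> \<mu> - \<mu>, 1)"]) (auto simp: E_def L_def)
      qed
    qed
    \<comment> \<open>The coincidence set of \<open>\<phi>\<close> with one affine function is closed, and so is the union of the
      others; being disjoint on the interval, they cannot both meet it.\<close>
    from False obtain \<mu>0 l where l: "\<mu>0 \<in> I" "l \<in> L" "\<mu>0 \<in> E l" using cover by blast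
    define R where "R = (\<Union>l'\<in>L - {l}. E l')"
    have "closed R" unfolding R_def using finL closedE by (intro closed_UN) auto
    moreover have "I \<subseteq> E l \<union> R" using cover by (auto simp: R_def)
    moreover have "E l \<inter> R \<inter> I = {}" using meet[OF l(2)] I(2) by (fastforce simp: R_def)
    moreover have "connected I" using I(1) by (simp add: is_interval_connected)
    ultimately have "R \<inter> I = {}" using l closedE[of l] unfolding connected_closed by blast
    then have "\<forall>\<mu>\<in>I. \<mu> \<in> E l" using \<open>I \<subseteq> E l \<union> R\<close> by blast
    then show ?thesis by (intro exI[of _ "fst l"] exI[of _ "snd l"]) (simp add: E_def)
  qed simp
  moreover have "finite S'" using fin by (simp add: S'_def)
  ultimately show ?thesis unfolding piecewise_linear_def using cont by blast
qed

lemma piecewise_linear_vec: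
  fixes F :: "real \<Rightarrow> real ^ 'n"
  assumes "\<And>j. piecewise_linear (\<lambda>\<mu>. F \<mu> $ j)"
  shows "piecewise_linear F"
proof -
  have "\<forall>j. \<exists>S. finite S \<and> (\<forall>I. is_interval I \<and> I \<inter> S = {} \<longrightarrow> (\<exists>u v. \<forall>\<mu>\<in>I. F \<mu> $ j = u + \<mu> *\<^sub>R v))"
    using assms by (simp add: piecewise_linear_def)
  then obtain S where S: "\<And>j. finite (S j)"
    "\<And>j I. is_interval I \<Longrightarrow> I \<inter> S j = {} \<Longrightarrow> \<exists>u v. \<forall>\<mu>\<in>I. F \<mu> $ j = u + \<mu> *\<^sub>R v"
    by metis
  have "\<exists>u v. \<forall>\<mu>\<in>I. F \<mu> = u + \<mu> *\<^sub>R v" if I: "is_interval I" "I \<inter> (\<Union>j. S j) = {}" for I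
  proof -
    have "\<exists>u v. \<forall>\<mu>\<in>I. F \<mu> $ j = u + \<mu> *\<^sub>R v" for j using S(2)[OF I(1), of j] I(2) by blast
    then obtain u v where "\<And>j. \<forall>\<mu>\<in>I. F \<mu> $ j = u j + \<mu> *\<^sub>R v j" by metis
    then show ?thesis by (intro exI[of _ "\<chi> j. u j"] exI[of _ "\<chi> j. v j"]) (simp add: vec_eq_iff)
  qed
  moreover have "continuous_on UNIV F"
  proof -
    have "continuous_on UNIV (\<lambda>\<mu>. \<chi> j. F \<mu> $ j)"
      using assms by (intro continuous_on_vec_lambda) (simp add: piecewise_linear_def)
    then show ?thesis by simp
  qed
  ultimately show ?thesis unfolding piecewise_linear_def using S(1)
    by (intro conjI exI[of _ "\<Union>j. S j"]) auto
qed

section \<open>The tropical value function of a parametric linear program\<close>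

lemma solutions_scale:
  assumes "0 \<in> solutions Q" "x \<in> solutions Q" "0 \<le> r" "r \<le> 1"
  shows "r *s x \<in> solutions Q"
  unfolding solutions_def
proof safe
  fix a b assume ab: "(a, b) \<in> Q"
  have "0 \<le> b" "pdot a x \<le> b" using assms(1,2) ab by (auto simp: solutions_def)
  then have "r * pdot a x \<le> r * b" "r * b \<le> b" using assms(3,4) by (auto intro: mult_left_mono mult_left_le_one_le)
  then show "pdot a (r *s x) \<le> b" by (simp add: pdot_scale_right)
qed

text \<open>
  The maximum \<open>V \<epsilon>\<close> of \<open>h + \<langle>g, x\<rangle>\<close> over the points of cost at most \<open>\<epsilon>\<close> has a valuation that depends
  only on the valuation of \<open>\<epsilon>\<close>. Since \<open>solutions Q\<close> is star-shaped at \<open>0\<close>, enlarging \<open>\<epsilon>\<close> by a factor \<open>k \<ge> 1\<close>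
  enlarges \<open>V \<epsilon>\<close> at most by the factor \<open>k\<close>; hence the valuation is a Lipschitz function of \<open>val \<epsilon>\<close>. It is
  selected from finitely many affine functions because \<open>V \<epsilon>\<close> is a minimum of affine functions of \<open>\<epsilon>\<close>.
\<close>

lemma value_function:
  fixes Q :: "((puiseux ^ 'n) \<times> puiseux) set" and c g y :: "puiseux ^ 'n" and h :: puiseux
  assumes Q: "finite Q" and nonneg: "\<And>x j. x \<in> solutions Q \<Longrightarrow> 0 \<le> x $ j" and zero: "0 \<in> solutions Q"
    and c: "\<And>j. 0 < c $ j" and h: "0 \<le> h"
    and y: "y \<in> solutions Q" "0 < h + pdot g y"
  shows "\<exists>\<phi>. piecewise_linear \<phi> \<and> (\<forall>\<epsilon>. 0 < \<epsilon> \<longrightarrow> (\<exists>x. optimal_point (solutions Q) c g \<epsilon> x \<and>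
      0 < h + pdot g x \<and> lead_exp (h + pdot g x) = \<phi> (lead_exp \<epsilon>)))"
proof -
  have bound: "pdot g x \<le> (\<Sum>j\<in>UNIV. \<bar>g $ j\<bar> * (\<epsilon> / c $ j))"
    if x: "x \<in> solutions Q" "pdot c x \<le> \<epsilon>" for x \<epsilon>
    unfolding pdot_def
  proof (rule sum_mono)
    fix j
    have "c $ j * x $ j \<le> pdot c x"
      unfolding pdot_def using nonneg[OF x(1)] c by (intro member_le_sum) (auto simp: less_imp_le)
    then have "c $ j * x $ j \<le> \<epsilon>" using x(2) by simp
    then have "x $ j \<le> \<epsilon> / c $ j" using c[of j] by (simp add: field_simps)
    then have "\<bar>g $ j\<bar> * x $ j \<le> \<bar>g $ j\<bar> * (\<epsilon> / c $ j)" by (intro mult_left_mono) auto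
    moreover have "g $ j * x $ j \<le> \<bar>g $ j\<bar> * x $ j"
      using nonneg[OF x(1), of j] by (intro mult_right_mono) auto
    ultimately show "g $ j * x $ j \<le> \<bar>g $ j\<bar> * (\<epsilon> / c $ j)" by simp
  qed
  from parametric_optimum[OF Q, of c g]
  obtain T where T: "finite T" and opt: "\<forall>e B y. y \<in> solutions Q \<and> pdot c y \<le> e \<and>
      (\<forall>x\<in>solutions Q. pdot c x \<le> e \<longrightarrow> pdot g x \<le> B) \<longrightarrow>
      (\<exists>x. optimal_point (solutions Q) c g e x \<and>
        (\<exists>(\<alpha>, \<beta>, \<gamma>)\<in>T. 0 < \<alpha> \<and> \<alpha> * pdot g x = \<beta> + \<gamma> * e) \<and>
        (\<forall>\<^sub>F t in at_top. \<forall>z\<in>solutions_at Q t. vec_pval c t \<bullet> z \<le> pval e t \<longrightarrow>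
           vec_pval g t \<bullet> z \<le> pval (pdot g x) t))"
    by (elim exE conjE)
  have "\<forall>\<epsilon>. \<exists>x. 0 < \<epsilon> \<longrightarrow> optimal_point (solutions Q) c g \<epsilon> x \<and>
        (\<exists>(\<alpha>, \<beta>, \<gamma>)\<in>T. 0 < \<alpha> \<and> \<alpha> * pdot g x = \<beta> + \<gamma> * \<epsilon>)"
  proof
    fix \<epsilon>
    have "0 < \<epsilon> \<Longrightarrow> 0 \<in> solutions Q \<and> pdot c 0 \<le> \<epsilon> \<and>
        (\<forall>x\<in>solutions Q. pdot c x \<le> \<epsilon> \<longrightarrow> pdot g x \<le> (\<Sum>j\<in>UNIV. \<bar>g $ j\<bar> * (\<epsilon> / c $ j)))"
      using zero bound by (simp add: less_imp_le)
    then show "\<exists>x. 0 < \<epsilon> \<longrightarrow> optimal_point (solutions Q) c g \<epsilon> x \<and>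
        (\<exists>(\<alpha>, \<beta>, \<gamma>)\<in>T. 0 < \<alpha> \<and> \<alpha> * pdot g x = \<beta> + \<gamma> * \<epsilon>)"
      using opt by blast
  qed
  then obtain X where X_opt: "\<And>\<epsilon>. 0 < \<epsilon> \<Longrightarrow> optimal_point (solutions Q) c g \<epsilon> (X \<epsilon>)"
    and X_sel: "\<And>\<epsilon>. 0 < \<epsilon> \<Longrightarrow> \<exists>(\<alpha>, \<beta>, \<gamma>)\<in>T. 0 < \<alpha> \<and> \<alpha> * pdot g (X \<epsilon>) = \<beta> + \<gamma> * \<epsilon>"
    unfolding choice_iff by blast
  define V where "V \<epsilon> = h + pdot g (X \<epsilon>)" for \<epsilon>
  have ge_V: "h + pdot g x \<le> V \<epsilon>" if "0 < \<epsilon>" "x \<in> solutions Q" "pdot c x \<le> \<epsilon>" for x \<epsilon>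
    using X_opt[OF that(1)] that by (simp add: V_def optimal_point_def)
  \<comment> \<open>Shrinking a point by \<open>r \<le> 1\<close> keeps at least the fraction \<open>r\<close> of the objective, because \<open>h \<ge> 0\<close>.\<close>
  have shrink: "r * (h + pdot g x) \<le> V \<epsilon>"
    if "0 < \<epsilon>" "x \<in> solutions Q" "0 \<le> r" "r \<le> 1" "r * pdot c x \<le> \<epsilon>" for x r \<epsilon>
  proof -
    have "h + pdot g (r *s x) \<le> V \<epsilon>"
      using that solutions_scale[OF zero] by (intro ge_V) (simp_all add: pdot_scale_right)
    moreover have "r * h \<le> h" using that h by (simp add: mult_left_le_one_le)
    ultimately show ?thesis by (simp add: pdot_scale_right distrib_left)
  qed
  have Vpos: "0 < V \<epsilon>" if \<epsilon>: "0 < \<epsilon>" for \<epsilon>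
  proof -
    have cy: "0 \<le> pdot c y" unfolding pdot_def
      using nonneg[OF y(1)] c by (intro sum_nonneg mult_nonneg_nonneg) (auto simp: less_imp_le)
    define r where "r = min 1 (\<epsilon> / (pdot c y + 1))"
    have r: "0 < r" "r \<le> 1" using \<epsilon> cy by (auto simp: r_def)
    have "r * pdot c y \<le> r * (pdot c y + 1)" using r by simp
    also have "\<dots> \<le> \<epsilon> / (pdot c y + 1) * (pdot c y + 1)"
      using cy by (intro mult_right_mono) (auto simp: r_def)
    also have "\<dots> = \<epsilon>" using cy by (simp add: add_nonneg_eq_0_iff)
    finally have "r * (h + pdot g y) \<le> V \<epsilon>" using shrink \<epsilon> y(1) r by (simp add: less_imp_le)
    moreover have "0 < r * (h + pdot g y)" using r y(2) by simp
    ultimately show ?thesis by simp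
  qed
  \<comment> \<open>A strict gap \<open>\<delta>\<close> between valuations absorbs all constant factors in \<open>\<epsilon> \<le> k \<epsilon>'\<close>.\<close>
  have V_le: "lead_exp (V \<epsilon>) \<le> lead_exp (V \<epsilon>') + \<delta>"
    if \<epsilon>: "0 < \<epsilon>" "0 < \<epsilon>'" and \<delta>: "0 < \<delta>" "lead_exp \<epsilon> < lead_exp \<epsilon>' + \<delta>" for \<epsilon> \<epsilon>' \<delta>
  proof -
    define k where "k = monomial 1 \<delta>"
    have k0: "0 < k" by (simp add: k_def monomial_pos)
    have k1: "1 < k" using less_if_lead_exp_less[OF k0, of 1] \<delta> by (simp add: k_def)
    have lk: "lead_exp (k * z) = \<delta> + lead_exp z" if "0 < z" for z
      using lead_exp_mult_pos[OF k0 that] by (simp add: k_def)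
    have le: "\<epsilon> < k * \<epsilon>'"
      using \<delta> \<epsilon> k0 by (intro less_if_lead_exp_less[OF mult_pos_pos[OF k0 \<epsilon>(2)]]) (simp add: lk)
    have X: "X \<epsilon> \<in> solutions Q" "pdot c (X \<epsilon>) \<le> \<epsilon>"
      using X_opt[OF \<epsilon>(1)] by (simp_all add: optimal_point_def)
    then have "pdot c (X \<epsilon>) \<le> k * \<epsilon>'" using le by (meson less_imp_le order_trans)
    then have "(1 / k) * pdot c (X \<epsilon>) \<le> \<epsilon>'" using k0 by (simp add: field_simps)
    then have "(1 / k) * V \<epsilon> \<le> V \<epsilon>'" unfolding V_def[of \<epsilon>]
      using X \<epsilon> k0 k1 by (intro shrink) auto
    then have "V \<epsilon> \<le> k * V \<epsilon>'" using k0 by (simp add: field_simps)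
    then show ?thesis using lead_exp_mono[OF Vpos[OF \<epsilon>(1)]] lk[OF Vpos[OF \<epsilon>(2)]] by fastforce
  qed
  have V_same: "lead_exp (V \<epsilon>) = lead_exp (V \<epsilon>')"
    if "0 < \<epsilon>" "0 < \<epsilon>'" "lead_exp \<epsilon> = lead_exp \<epsilon>'" for \<epsilon> \<epsilon>'
  proof (rule antisym)
    show "lead_exp (V \<epsilon>) \<le> lead_exp (V \<epsilon>')"
      by (rule field_le_epsilon, rule V_le) (use that in auto)
    show "lead_exp (V \<epsilon>') \<le> lead_exp (V \<epsilon>)"
      by (rule field_le_epsilon, rule V_le) (use that in auto)
  qed
  define \<phi> where "\<phi> = (\<lambda>\<mu>. lead_exp (V (monomial 1 \<mu>)))"
  have \<phi>: "lead_exp (V \<epsilon>) = \<phi> (lead_exp \<epsilon>)" if "0 < \<epsilon>" for \<epsilon>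
    unfolding \<phi>_def using that by (intro V_same) (simp_all add: monomial_pos)
  have \<phi>_le: "\<phi> \<mu> \<le> \<phi> \<mu>' + \<bar>\<mu> - \<mu>'\<bar>" for \<mu> \<mu>'
  proof (rule field_le_epsilon)
    fix e :: real assume "0 < e"
    then have "lead_exp (V (monomial 1 \<mu>)) \<le> lead_exp (V (monomial 1 \<mu>')) + (\<bar>\<mu> - \<mu>'\<bar> + e)"
      by (intro V_le) (auto simp: monomial_pos)
    then show "\<phi> \<mu> \<le> \<phi> \<mu>' + \<bar>\<mu> - \<mu>'\<bar> + e" by (simp add: \<phi>_def)
  qed
  have "1-lipschitz_on UNIV \<phi>"
  proof (rule lipschitz_onI)
    show "dist (\<phi> \<mu>) (\<phi> \<mu>') \<le> 1 * dist \<mu> \<mu>'" for \<mu> \<mu>'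
      using \<phi>_le[of \<mu> \<mu>'] \<phi>_le[of \<mu>' \<mu>] by (simp add: dist_real_def abs_minus_commute abs_le_iff)
  qed simp
  then have cont: "continuous_on UNIV \<phi>" by (rule lipschitz_on_continuous_on)
  \<comment> \<open>Outside the points of \<open>S\<close>, where both terms have the same valuation, they cannot cancel.\<close>
  define A where "A = (\<lambda>(\<alpha>, \<beta>, \<gamma>). lead_exp (\<beta> + \<alpha> * h) - lead_exp \<alpha>) ` T"
  define B where "B = (\<lambda>(\<alpha>, \<beta>, \<gamma>). lead_exp \<gamma> - lead_exp \<alpha>) ` T"
  define S where "S = (\<lambda>(\<alpha>, \<beta>, \<gamma>). lead_exp (\<beta> + \<alpha> * h) - lead_exp \<gamma>) ` T"
  have "piecewise_linear \<phi>"
  proof (rule piecewise_linear_selection[OF cont])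
    show "finite A" "finite B" "finite S" using T by (simp_all add: A_def B_def S_def)
    fix \<mu> assume \<mu>: "\<mu> \<notin> S"
    define \<epsilon> where "\<epsilon> = monomial 1 \<mu>"
    have \<epsilon>: "0 < \<epsilon>" "lead_exp \<epsilon> = \<mu>" by (simp_all add: \<epsilon>_def monomial_pos)
    obtain \<alpha> \<beta> \<gamma> where k: "(\<alpha>, \<beta>, \<gamma>) \<in> T" "0 < \<alpha>" "\<alpha> * pdot g (X \<epsilon>) = \<beta> + \<gamma> * \<epsilon>"
      using X_sel[OF \<epsilon>(1)] by blast
    define \<beta>' where "\<beta>' = \<beta> + \<alpha> * h"
    have eq: "\<alpha> * V \<epsilon> = \<beta>' + \<gamma> * \<epsilon>" using k(3) by (simp add: V_def \<beta>'_def distrib_left)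
    have \<phi>\<mu>: "\<phi> \<mu> = lead_exp (\<beta>' + \<gamma> * \<epsilon>) - lead_exp \<alpha>"
      using lead_exp_mult_pos[OF k(2) Vpos[OF \<epsilon>(1)]] eq \<phi>[OF \<epsilon>(1)] \<epsilon>(2) by simp
    have neq: "\<mu> \<noteq> lead_exp \<beta>' - lead_exp \<gamma>" using \<mu> k(1) by (force simp: S_def \<beta>'_def)
    have nz: "\<beta>' + \<gamma> * \<epsilon> \<noteq> 0" using eq mult_pos_pos[OF k(2) Vpos[OF \<epsilon>(1)]] by auto
    have l\<gamma>: "lead_exp (\<gamma> * \<epsilon>) = lead_exp \<gamma> + \<mu>" if "\<gamma> \<noteq> 0"
      using lead_exp_mult[of \<gamma> \<epsilon>] that \<epsilon> by simp
    consider "\<beta>' \<noteq> 0" "\<gamma> * \<epsilon> = 0 \<or> lead_exp (\<gamma> * \<epsilon>) < lead_exp \<beta>'"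
      | "\<gamma> \<noteq> 0" "\<beta>' = 0 \<or> lead_exp \<beta>' < lead_exp (\<gamma> * \<epsilon>)"
      using nz neq l\<gamma> \<epsilon>(1) by fastforce
    then show "\<phi> \<mu> \<in> A \<or> \<phi> \<mu> - \<mu> \<in> B"
    proof cases
      case 1
      then have "\<phi> \<mu> = lead_exp \<beta>' - lead_exp \<alpha>" using \<phi>\<mu> lead_exp_add by simp
      then show ?thesis using k(1) by (force simp: A_def \<beta>'_def)
    next
      case 2
      then have "\<phi> \<mu> - \<mu> = lead_exp \<gamma> - lead_exp \<alpha>"
        using \<phi>\<mu> lead_exp_add[of "\<gamma> * \<epsilon>" \<beta>'] l\<gamma> \<epsilon>(1) by (simp add: add.commute)
      then show ?thesis using k(1) by (force simp: B_def)
    qed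
  qed
  then show ?thesis
  proof (intro exI[of _ \<phi>] conjI allI impI)
    fix \<epsilon> :: puiseux assume \<epsilon>: "0 < \<epsilon>"
    show "\<exists>x. optimal_point (solutions Q) c g \<epsilon> x \<and> 0 < h + pdot g x \<and>
        lead_exp (h + pdot g x) = \<phi> (lead_exp \<epsilon>)"
      using X_opt[OF \<epsilon>] Vpos[OF \<epsilon>] \<phi>[OF \<epsilon>] by (auto simp: V_def)
  qed
qed

section \<open>Regularity\<close>

lemma lead_exp_sum_less:
  assumes "\<And>j. j \<in> S \<Longrightarrow> f j = 0 \<or> lead_exp (f j) < r"
  shows "sum f S = 0 \<or> lead_exp (sum f S) < r"
  using assms
proof (induction S rule: infinite_finite_induct)
  case (insert j S)
  show ?case
  proof (rule disjCI)
    assume not_less: "\<not> lead_exp (sum f (insert j S)) < r"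
    define z where "z = f j + sum f S"
    have r: "r \<le> lead_exp z" using not_less insert by (simp add: z_def)
    have "coef (f j) (lead_exp z) = 0"
      using insert.prems[of j] r lead_exp(2)[of "f j" "lead_exp z"] by (cases "f j = 0") force+
    moreover have "coef (sum f S) (lead_exp z) = 0"
      using insert.IH insert.prems r lead_exp(2)[of "sum f S" "lead_exp z"] by (cases "sum f S = 0") force+
    ultimately have "coef z (lead_exp z) = 0" by (simp add: z_def coef_add)
    then have "z = 0" using lead_exp(1)[of z] by (auto simp: lead_coef_def)
    then show "sum f (insert j S) = 0" using insert by (simp add: z_def)
  qed
qed simp_all

text \<open>
  Inside the interior of \<open>val P\<close>, raising one coordinate at which the tropical form \<open>val a + \<xi>\<close> is
  maximal makes the maximum unique, so that no cancellation can occur in \<open>\<langle>a, x\<rangle>\<close>.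
\<close>

lemma regular_imp_nonvanishing:
  fixes P :: "(puiseux ^ 'n) set"
  assumes reg: "tropical_regular (vec_val ` P)" and P: "P \<noteq> {}" and a: "a \<noteq> 0"
  shows "\<exists>x\<in>P. (\<forall>j. x $ j \<noteq> 0) \<and> pdot a x \<noteq> 0"
proof -
  have "top_of_set tropical_space interior_of (vec_val ` P) \<noteq> {}"
  proof
    assume "top_of_set tropical_space interior_of (vec_val ` P) = {}"
    then have "vec_val ` P = {}" using reg by (simp add: tropical_regular_def)
    then show False using P by simp
  qed
  then obtain p U where U: "open U" "p \<in> U" "p \<in> tropical_space" "tropical_space \<inter> U \<subseteq> vec_val ` P"
    unfolding interior_of_def openin_open by blast
  then obtain A where A: "\<And>i. open (A i)" "\<And>i. p $ i \<in> A i" "\<And>y. (\<And>i. y $ i \<in> A i) \<Longrightarrow> y \<in> U"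
    unfolding open_vec_def by metis
  have "\<exists>l u. l < u \<and> {ereal l<..<ereal u} \<subseteq> A i" for i
  proof (cases "p $ i")
    case (real r)
    have "open (ereal -` A i)" "r \<in> ereal -` A i" using A(1,2)[of i] real by (auto intro: open_ereal_vimage)
    then obtain e where e: "0 < e" "ball r e \<subseteq> ereal -` A i" by (meson open_contains_ball)
    have "{ereal (r - e)<..<ereal (r + e)} \<subseteq> A i"
    proof
      fix z assume z: "z \<in> {ereal (r - e)<..<ereal (r + e)}"
      then obtain q where q: "z = ereal q" by (cases z) auto
      then have "q \<in> ball r e" using z by (auto simp: dist_real_def abs_less_iff)
      then show "z \<in> A i" using e(2) q by blast
    qed
    then show ?thesis using e(1) by (intro exI[of _ "r - e"] exI[of _ "r + e"]) simp
  next
    case PInf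
    then show ?thesis using U(3) by (simp add: tropical_space_def)
  next
    case MInf
    then obtain r where "{..<ereal r} \<subseteq> A i" using open_MInfty[OF A(1)[of i]] A(2)[of i] by auto
    then show ?thesis by (intro exI[of _ "r - 1"] exI[of _ r]) auto
  qed
  then obtain l u where lu: "\<And>i. l i < u i" "\<And>i. {ereal (l i)<..<ereal (u i)} \<subseteq> A i" by metis
  define \<xi> where "\<xi> = (\<lambda>i. l i + (u i - l i) / 3)"
  define w where "w = (\<lambda>i. lead_exp (a $ i) + \<xi> i)"
  define J where "J = {j. a $ j \<noteq> 0}"
  have J: "finite J" "J \<noteq> {}" using a by (auto simp: J_def vec_eq_iff)
  define m where "m = Max (w ` J)"
  have "m \<in> w ` J" unfolding m_def using J by (intro Max_in) auto
  then obtain j0 where j0: "j0 \<in> J" "w j0 = m" by auto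
  have w_le: "w j \<le> m" if "j \<in> J" for j using that J by (simp add: m_def)
  define \<eta> where "\<eta> = (\<lambda>i. if i = j0 then \<xi> i + (u i - l i) / 3 else \<xi> i)"
  have "ereal (\<eta> i) \<in> A i" for i
  proof -
    have "l i < \<eta> i" "\<eta> i < u i" using lu(1)[of i] by (auto simp: \<eta>_def \<xi>_def field_simps)
    then show ?thesis using lu(2)[of i] by auto
  qed
  then have "(\<chi> i. ereal (\<eta> i)) \<in> tropical_space \<inter> U"
    by (auto simp: tropical_space_def intro!: A(3))
  then obtain x where x: "x \<in> P" "vec_val x = (\<chi> i. ereal (\<eta> i))" using U(4) by (metis imageE subsetD)
  have val_x: "val (x $ i) = ereal (\<eta> i)" for i using x(2) by (simp add: vec_val_def vec_eq_iff)
  have xi: "x $ i \<noteq> 0" "lead_exp (x $ i) = \<eta> i" for i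
    using val_x[of i] by (auto simp: val_def split: if_splits)
  have "pdot a x \<noteq> 0"
  proof
    assume *: "pdot a x = 0"
    define s where "s = (\<Sum>j\<in>UNIV - {j0}. a $ j * x $ j)"
    have split: "pdot a x = a $ j0 * x $ j0 + s"
      unfolding pdot_def s_def by (rule sum.remove) auto
    have main: "lead_exp (a $ j0 * x $ j0) = lead_exp (a $ j0) + \<eta> j0"
      using j0 xi by (simp add: J_def lead_exp_mult)
    have big: "m < lead_exp (a $ j0) + \<eta> j0"
      using j0 lu(1)[of j0] by (auto simp: \<eta>_def w_def)
    have "s = 0 \<or> lead_exp s < lead_exp (a $ j0) + \<eta> j0"
      unfolding s_def
    proof (rule lead_exp_sum_less)
      fix j assume j: "j \<in> UNIV - {j0}"
      show "a $ j * x $ j = 0 \<or> lead_exp (a $ j * x $ j) < lead_exp (a $ j0) + \<eta> j0"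
      proof (cases "a $ j = 0")
        case False
        then have "lead_exp (a $ j * x $ j) = w j"
          using j xi by (simp add: lead_exp_mult w_def \<eta>_def)
        then show ?thesis using w_le[of j] False big by (simp add: J_def)
      qed simp
    qed
    moreover have "s = - (a $ j0 * x $ j0)" using * split by (simp add: eq_neg_iff_add_eq_0 add.commute)
    ultimately show False using main j0 xi by (auto simp: J_def)
  qed
  then show ?thesis using x(1) xi(1) by blast
qed

section \<open>The logarithmic central path at a fixed real parameter\<close>

lemma log_central_pointD:
  assumes "is_log_central_point m A b c \<nu> (x, w, s, y)"
  shows "\<And>j. 0 < x $ j" "\<And>j. 0 < s $ j" "\<And>i. i < m \<Longrightarrow> 0 < w i" "\<And>i. i < m \<Longrightarrow> 0 < y i"
    "\<And>i. m \<le> i \<Longrightarrow> w i = 0" "\<And>i. m \<le> i \<Longrightarrow> y i = 0"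
    "\<And>i. i < m \<Longrightarrow> w i = b i - A i \<bullet> x" "s - (\<Sum>i<m. y i *\<^sub>R A i) = c"
    "\<And>j. x $ j * s $ j = \<nu>" "\<And>i. i < m \<Longrightarrow> w i * y i = \<nu>"
  using assms by (auto simp: is_log_central_point_def algebra_simps)

text \<open>
  Differences of dual feasible \<open>s\<close> lie in the row space of \<open>A\<close>, so pairing them with differences of
  primal points gives minus the pairing of the slacks with \<open>y\<close>.
\<close>

lemma primal_dual_orthogonal:
  fixes x x' s s' :: "real ^ 'n"
  assumes "s - (\<Sum>i<m. y i *\<^sub>R A i) = c" "s' - (\<Sum>i<m. y' i *\<^sub>R A i) = c"
  shows "(\<Sum>j\<in>UNIV. (x' $ j - x $ j) * (s' $ j - s $ j)) +
    (\<Sum>i<m. ((b i - A i \<bullet> x') - (b i - A i \<bullet> x)) * (y' i - y i)) = 0"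
proof -
  have "s' - s = (\<Sum>i<m. (y' i - y i) *\<^sub>R A i)"
    using assms by (simp add: scaleR_diff_left sum_subtractf algebra_simps)
  then have "(x' - x) \<bullet> (s' - s) = (\<Sum>i<m. (y' i - y i) * (A i \<bullet> (x' - x)))"
    by (simp add: inner_sum_right inner_commute)
  also have "\<dots> = - (\<Sum>i<m. ((b i - A i \<bullet> x') - (b i - A i \<bullet> x)) * (y' i - y i))"
    unfolding sum_negf[symmetric] by (rule sum.cong) (auto simp: inner_diff_right algebra_simps)
  finally show ?thesis by (simp add: inner_vec_def)
qed

lemma diff_mult_inverse_diff:
  fixes x x' s s' :: real
  assumes "0 < x" "0 < x'" "0 < \<nu>" "x * s = \<nu>" "x' * s' = \<nu>"
  shows "(x' - x) * (s' - s) \<le> 0" "(x' - x) * (s' - s) = 0 \<Longrightarrow> x' = x"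
proof -
  have s: "s = \<nu> / x" "s' = \<nu> / x'" using assms by (auto simp: field_simps)
  have "(x' - x) * (s' - s) = - (\<nu> * (x' - x)\<^sup>2 / (x * x'))"
    using assms(1,2) unfolding s by (simp add: field_simps power2_eq_square)
  then show "(x' - x) * (s' - s) \<le> 0" "(x' - x) * (s' - s) = 0 \<Longrightarrow> x' = x"
    using assms(1-3) by auto
qed

text \<open>
  Since \<open>s = \<nu> / x\<close> decreases in \<open>x\<close>, all summands in the orthogonality relation of two central points
  are nonpositive, hence zero.
\<close>

lemma log_central_point_unique:
  assumes p: "is_log_central_point m A b c \<nu> p" and p': "is_log_central_point m A b c \<nu> p'"
    and \<nu>: "0 < \<nu>"
  shows "p' = p"
proof -
  obtain x w s y where [simp]: "p = (x, w, s, y)" by (cases p)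
  obtain x' w' s' y' where [simp]: "p' = (x', w', s', y')" by (cases p')
  note D = log_central_pointD[OF p[simplified]] and D' = log_central_pointD[OF p'[simplified]]
  define f where "f j = (x' $ j - x $ j) * (s' $ j - s $ j)" for j
  define g where "g i = (w' i - w i) * (y' i - y i)" for i
  have f: "f j \<le> 0" "f j = 0 \<Longrightarrow> x' $ j = x $ j" for j
    using diff_mult_inverse_diff[OF D(1)[of j] D'(1)[of j] \<nu> D(9)[of j] D'(9)[of j]] by (auto simp: f_def)
  have g: "g i \<le> 0" "g i = 0 \<Longrightarrow> w' i = w i" if "i < m" for i
    using diff_mult_inverse_diff[OF D(3)[OF that] D'(3)[OF that] \<nu> D(10)[OF that] D'(10)[OF that]]
    by (auto simp: g_def)
  have "sum f UNIV + (\<Sum>i<m. g i) = 0"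
    using primal_dual_orthogonal[OF D(8) D'(8), of x' x b] D(7) D'(7)
    by (simp add: f_def g_def)
  moreover have "sum f UNIV \<le> 0" "(\<Sum>i<m. g i) \<le> 0"
    using f g by (auto intro: sum_nonpos)
  ultimately have "sum f UNIV = 0" "(\<Sum>i<m. g i) = 0" by linarith+
  then have "\<forall>j\<in>UNIV. f j = 0" "\<forall>i\<in>{..<m}. g i = 0"
    using f(1) g(1) sum_nonneg_eq_0_iff[of UNIV "\<lambda>j. - f j"] sum_nonneg_eq_0_iff[of "{..<m}" "\<lambda>i. - g i"]
    by (auto simp: sum_negf)
  then have xw: "x' $ j = x $ j" "i < m \<Longrightarrow> w' i = w i" for i j using f(2) g(2) by auto
  have "s' $ j = s $ j" for j using D(9)[of j] D'(9)[of j] D(1)[of j] xw(1)[of j] by auto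
  moreover have "y' i = y i" if "i < m" for i
    using D(10)[OF that] D'(10)[OF that] D(3)[OF that] xw(2)[OF that] by auto
  ultimately show ?thesis
    using xw D(5,6) D'(5,6) by (auto simp: vec_eq_iff fun_eq_iff) (metis not_le)+
qed

text \<open>
  Comparing the central point with the dual feasible point \<open>(c, 0)\<close>: among the points of cost at
  most \<open>\<nu>\<close>, the central point maximizes every coordinate and every slack up to a constant factor.
\<close>

lemma log_central_point_bounds:
  fixes x :: "real ^ 'n"
  assumes p: "is_log_central_point m A b c \<nu> (x, w, s, y)"
    and c: "\<And>j. 0 < c $ j" and b: "\<And>i. i < m \<Longrightarrow> 0 \<le> b i"
  shows "c \<bullet> x \<le> real (CARD('n) + m) * \<nu>"
    and "\<And>x' j. \<lbrakk>\<And>j. 0 \<le> x' $ j; \<And>i. i < m \<Longrightarrow> A i \<bullet> x' \<le> b i; c \<bullet> x' \<le> \<nu>\<rbrakk> \<Longrightarrow>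
      x' $ j \<le> real (CARD('n) + m + 1) * x $ j"
    and "\<And>x' i. \<lbrakk>\<And>j. 0 \<le> x' $ j; \<And>i. i < m \<Longrightarrow> A i \<bullet> x' \<le> b i; c \<bullet> x' \<le> \<nu>; i < m\<rbrakk> \<Longrightarrow>
      b i - A i \<bullet> x' \<le> real (CARD('n) + m + 1) * w i"
proof -
  note D = log_central_pointD[OF p]
  define N where "N = real (CARD('n) + m)"
  have gap: "(\<Sum>j\<in>UNIV. x' $ j * s $ j) + (\<Sum>i<m. (b i - A i \<bullet> x') * y i) = c \<bullet> x' - c \<bullet> x + N * \<nu>" for x'
  proof -
    have "(\<Sum>j\<in>UNIV. (x' $ j - x $ j) * (c $ j - s $ j)) +
      (\<Sum>i<m. ((b i - A i \<bullet> x') - (b i - A i \<bullet> x)) * (0 - y i)) = 0"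
      by (rule primal_dual_orthogonal[OF D(8)]) simp
    moreover have "(\<Sum>j\<in>UNIV. (x' $ j - x $ j) * (c $ j - s $ j)) =
       c \<bullet> x' - c \<bullet> x - (\<Sum>j\<in>UNIV. x' $ j * s $ j) + (\<Sum>j\<in>UNIV. x $ j * s $ j)"
      by (simp add: inner_vec_def sum.distrib[symmetric] sum_subtractf[symmetric] algebra_simps)
    moreover have "(\<Sum>i<m. ((b i - A i \<bullet> x') - (b i - A i \<bullet> x)) * (0 - y i)) =
       (\<Sum>i<m. (b i - A i \<bullet> x) * y i) - (\<Sum>i<m. (b i - A i \<bullet> x') * y i)"
      by (simp add: sum_subtractf[symmetric] algebra_simps)
    moreover have "(\<Sum>i<m. (b i - A i \<bullet> x) * y i) = real m * \<nu>" using D(7,10) by simp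
    moreover have "(\<Sum>j\<in>UNIV. x $ j * s $ j) = real CARD('n) * \<nu>" using D(9) by simp
    ultimately show ?thesis by (simp add: N_def distrib_right)
  qed
  have cx: "0 \<le> c \<bullet> x" unfolding inner_vec_def
    using c D(1) by (intro sum_nonneg) (simp add: less_imp_le)
  have "0 \<le> (\<Sum>i<m. b i * y i)" using b D(4) by (intro sum_nonneg) (simp add: less_imp_le)
  then show "c \<bullet> x \<le> real (CARD('n) + m) * \<nu>" using gap[of 0] by (simp add: N_def)
  fix x' assume x': "\<And>j. 0 \<le> x' $ j" "\<And>i. i < m \<Longrightarrow> A i \<bullet> x' \<le> b i" "c \<bullet> x' \<le> \<nu>"
  have s0: "0 \<le> x' $ j * s $ j" for j using x'(1)[of j] D(2)[of j] by simp
  have y0: "0 \<le> (b i - A i \<bullet> x') * y i" if "i < m" for i using x'(2)[OF that] D(4)[OF that] by simp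
  have le: "(\<Sum>j\<in>UNIV. x' $ j * s $ j) + (\<Sum>i<m. (b i - A i \<bullet> x') * y i) \<le> (N + 1) * \<nu>"
    using gap[of x'] x'(3) cx by (simp add: distrib_right)
  have nn: "0 \<le> (\<Sum>j\<in>UNIV. x' $ j * s $ j)" "0 \<le> (\<Sum>i<m. (b i - A i \<bullet> x') * y i)"
    using s0 y0 by (auto intro: sum_nonneg)
  show "x' $ j \<le> real (CARD('n) + m + 1) * x $ j" for j
  proof -
    have "x' $ j * s $ j \<le> (\<Sum>j\<in>UNIV. x' $ j * s $ j)" using s0 by (intro member_le_sum) auto
    then have "x' $ j * s $ j \<le> (N + 1) * (x $ j * s $ j)" unfolding D(9) using le nn by linarith
    then show ?thesis using D(2)[of j] by (simp add: N_def mult.assoc[symmetric] add_ac)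
  qed
  show "b i - A i \<bullet> x' \<le> real (CARD('n) + m + 1) * w i" if "i < m" for i
  proof -
    have "(b i - A i \<bullet> x') * y i \<le> (\<Sum>i<m. (b i - A i \<bullet> x') * y i)" 
      using y0 that by (intro member_le_sum[of i "{..<m}" "\<lambda>i. (b i - A i \<bullet> x') * y i"]) auto
    then have "(b i - A i \<bullet> x') * y i \<le> (N + 1) * (w i * y i)" unfolding D(10)[OF that] using le nn by linarith
    then show ?thesis using D(4)[OF that] by (simp add: N_def mult.assoc[symmetric] add_ac)
  qed
qed

text \<open>
  The central point maximizes \<open>exp (- \<langle>c, x\<rangle> / \<nu>) \<Prod>\<^sub>j x\<^sub>j \<Prod>\<^sub>i (b\<^sub>i - \<langle>A\<^sub>i, x\<rangle>)\<close>. This product, unlike its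
  logarithm, is continuous up to the boundary, and it decays at infinity since every factor is at
  most affine in \<open>\<langle>c, x\<rangle>\<close>.
\<close>

lemma log_central_point_exists:
  fixes c x0 :: "real ^ 'n"
  assumes c: "\<And>j. 0 < c $ j" and \<nu>: "0 < \<nu>"
    and x0: "\<And>j. 0 < x0 $ j" "\<And>i. i < m \<Longrightarrow> A i \<bullet> x0 < b i"
  shows "\<exists>p. is_log_central_point m A b c \<nu> p"
proof -
  define P where "P = {x. (\<forall>j. 0 \<le> x $ j) \<and> (\<forall>i<m. A i \<bullet> x \<le> b i)}"
  define \<Phi> where "\<Phi> x = exp (- (c \<bullet> x) / \<nu>) * ((\<Prod>j\<in>UNIV. x $ j) * (\<Prod>i<m. b i - A i \<bullet> x))"
    for x :: "real ^ 'n"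
  define N where "N = CARD('n) + m"
  have x0P: "x0 \<in> P" using x0 by (auto simp: P_def less_imp_le)
  have \<Phi>0: "0 < \<Phi> x0" unfolding \<Phi>_def using x0 by (intro mult_pos_pos prod_pos) auto
  have cx: "c $ j * x $ j \<le> c \<bullet> x" if "x \<in> P" for x j
    unfolding inner_vec_def using that c
    by (simp add: P_def) (intro member_le_sum, auto simp: less_imp_le)
  have cx0: "0 \<le> c \<bullet> x" if "x \<in> P" for x
    using cx[OF that, of undefined] that c[of undefined] unfolding P_def
    by (smt (verit) mem_Collect_eq mult_nonneg_nonneg)
  define D where "D = (\<Sum>j\<in>UNIV. 1 / c $ j)"
  have D: "1 / c $ j \<le> D" for j unfolding D_def using c by (intro member_le_sum) (auto simp: less_imp_le)
  have D0: "0 \<le> D" unfolding D_def using c by (intro sum_nonneg) (auto simp: less_imp_le)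
  have xj: "x $ j \<le> D * (c \<bullet> x)" if "x \<in> P" for x j
  proof -
    have "x $ j \<le> 1 / c $ j * (c \<bullet> x)" using cx[OF that, of j] c[of j] by (simp add: field_simps)
    also have "\<dots> \<le> D * (c \<bullet> x)" using D cx0[OF that] by (intro mult_right_mono)
    finally show ?thesis .
  qed
  have normx: "norm x \<le> real CARD('n) * D * (c \<bullet> x)" if "x \<in> P" for x
  proof -
    have "norm x \<le> (\<Sum>j\<in>UNIV. \<bar>x $ j\<bar>)" by (rule norm_le_l1_cart)
    also have "\<dots> \<le> (\<Sum>j\<in>(UNIV::'n set). D * (c \<bullet> x))"
      using that xj by (intro sum_mono) (auto simp: P_def)
    finally show ?thesis by (simp add: mult.assoc)
  qed
  define K where "K = 1 + D + (\<Sum>i<m. \<bar>b i\<bar> + norm (A i) * (real CARD('n) * D))"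
  have Ki: "\<bar>b i\<bar> + norm (A i) * (real CARD('n) * D) \<le> K" if "i < m" for i
    using member_le_sum[of i "{..<m}" "\<lambda>i. \<bar>b i\<bar> + norm (A i) * (real CARD('n) * D)"] that D0
    by (simp add: K_def)
  have "0 \<le> (\<Sum>i<m. \<bar>b i\<bar> + norm (A i) * (real CARD('n) * D))" using D0 by (intro sum_nonneg) auto
  then have KD: "D \<le> K" "0 < K" using D0 by (auto simp: K_def)
  have \<Phi>_le: "\<Phi> x \<le> exp (- (c \<bullet> x) / \<nu>) * (K * (1 + c \<bullet> x)) ^ N" if x: "x \<in> P" for x
  proof -
    define u where "u = c \<bullet> x"
    have u: "0 \<le> u" using cx0[OF x] by (simp add: u_def)
    have 1: "0 \<le> x $ j \<and> x $ j \<le> K * (1 + u)" for j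
    proof -
      have "x $ j \<le> D * u" using xj[OF x] by (simp add: u_def)
      also have "\<dots> \<le> K * (1 + u)" using KD u D0 by (intro mult_mono) auto
      finally show ?thesis using x by (simp add: P_def)
    qed
    have 2: "0 \<le> b i - A i \<bullet> x \<and> b i - A i \<bullet> x \<le> K * (1 + u)" if i: "i < m" for i
    proof -
      have "b i - A i \<bullet> x \<le> \<bar>b i\<bar> + norm (A i) * norm x"
        using Cauchy_Schwarz_ineq2[of "A i" x] by linarith
      also have "\<dots> \<le> \<bar>b i\<bar> * (1 + u) + norm (A i) * (real CARD('n) * D * u)"
        using normx[OF x] u by (intro add_mono mult_left_mono) (auto simp: u_def mult_le_cancel_left1)
      also have "\<dots> \<le> \<bar>b i\<bar> * (1 + u) + norm (A i) * (real CARD('n) * D * (1 + u))"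
        using u D0 by (intro add_left_mono mult_left_mono) auto
      also have "\<dots> = (\<bar>b i\<bar> + norm (A i) * (real CARD('n) * D)) * (1 + u)"
        by (simp add: algebra_simps)
      also have "\<dots> \<le> K * (1 + u)" using Ki[OF i] u by (intro mult_right_mono) auto
      finally show ?thesis using x i by (simp add: P_def)
    qed
    have "(\<Prod>j\<in>UNIV. x $ j) \<le> (\<Prod>j\<in>(UNIV::'n set). K * (1 + u))"
      using 1 by (intro prod_mono) auto
    moreover have "(\<Prod>i<m. b i - A i \<bullet> x) \<le> (\<Prod>i<m. K * (1 + u))"
      using 2 by (intro prod_mono) auto
    ultimately have "(\<Prod>j\<in>UNIV. x $ j) * (\<Prod>i<m. b i - A i \<bullet> x) \<le> (K * (1 + u)) ^ CARD('n) * (K * (1 + u)) ^ m"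
      using 1 2 KD u by (intro mult_mono) (auto intro!: prod_nonneg)
    then show ?thesis by (simp add: \<Phi>_def u_def N_def power_add)
  qed
  have "((\<lambda>u. exp (- u / \<nu>) * (K * (1 + u)) ^ N) \<longlongrightarrow> 0) at_top"
  proof -
    have lim: "filterlim (\<lambda>u. (1 + u) / \<nu>) at_top at_top"
    proof -
      have "filterlim (\<lambda>u. (1 / \<nu>) * (1 + u)) at_top at_top"
        using \<nu> by (intro filterlim_tendsto_pos_mult_at_top[OF tendsto_const]
            filterlim_tendsto_add_at_top[OF tendsto_const] filterlim_ident) auto
      then show ?thesis by simp
    qed
    have "((\<lambda>u. (exp (1 / \<nu>) * (K * \<nu>) ^ N) * (((1 + u) / \<nu>) ^ N / exp ((1 + u) / \<nu>))) \<longlongrightarrow>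
        (exp (1 / \<nu>) * (K * \<nu>) ^ N) * 0) at_top"
      by (intro tendsto_mult tendsto_const filterlim_compose[OF tendsto_power_div_exp_0 lim])
    moreover have "(exp (1 / \<nu>) * (K * \<nu>) ^ N) * (((1 + u) / \<nu>) ^ N / exp ((1 + u) / \<nu>)) =
        exp (- u / \<nu>) * (K * (1 + u)) ^ N" for u
    proof -
      have "exp (1 / \<nu>) / exp ((1 + u) / \<nu>) = exp (- u / \<nu>)"
        unfolding exp_diff[symmetric] by (simp add: add_divide_distrib)
      moreover have "(K * \<nu>) ^ N * ((1 + u) / \<nu>) ^ N = (K * (1 + u)) ^ N"
        unfolding power_mult_distrib[symmetric] using \<nu> by simp
      moreover have "(exp (1 / \<nu>) * (K * \<nu>) ^ N) * (((1 + u) / \<nu>) ^ N / exp ((1 + u) / \<nu>)) =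
          exp (1 / \<nu>) / exp ((1 + u) / \<nu>) * ((K * \<nu>) ^ N * ((1 + u) / \<nu>) ^ N)"
        by (simp only: times_divide_eq_left times_divide_eq_right mult_ac)
      ultimately show ?thesis by simp
    qed
    ultimately show ?thesis by simp
  qed
  then have "eventually (\<lambda>u. exp (- u / \<nu>) * (K * (1 + u)) ^ N < \<Phi> x0) at_top"
    using \<Phi>0 by (rule order_tendstoD(2))
  then obtain U where U: "\<And>u. U \<le> u \<Longrightarrow> exp (- u / \<nu>) * (K * (1 + u)) ^ N < \<Phi> x0"
    unfolding eventually_at_top_linorder by blast
  have small: "\<Phi> x < \<Phi> x0" if "x \<in> P" "U \<le> c \<bullet> x" for x
    using \<Phi>_le[OF that(1)] U[OF that(2)] by linarith
  define Q where "Q = P \<inter> {x. c \<bullet> x \<le> U}"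
  have "closed P" unfolding P_def
    by (intro closed_Collect_conj closed_Collect_all closed_Collect_imp closed_Collect_le continuous_intros) auto
  then have "closed Q" unfolding Q_def by (intro closed_Int closed_halfspace_le)
  moreover have "bounded Q"
  proof (rule boundedI)
    fix x assume "x \<in> Q"
    then have x: "x \<in> P" "c \<bullet> x \<le> U" by (auto simp: Q_def)
    have "norm x \<le> real CARD('n) * D * (c \<bullet> x)" by (rule normx[OF x(1)])
    also have "\<dots> \<le> real CARD('n) * D * U" using x(2) D0 by (intro mult_left_mono) auto
    finally show "norm x \<le> real CARD('n) * D * U" .
  qed
  ultimately have "compact Q" by (simp add: compact_eq_bounded_closed)
  have x0Q: "x0 \<in> Q" using x0P small[of x0] by (force simp: Q_def)
  have "continuous_on Q \<Phi>" unfolding \<Phi>_def using \<nu> by (intro continuous_intros) auto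
  then obtain x where x: "x \<in> Q" "\<And>z. z \<in> Q \<Longrightarrow> \<Phi> z \<le> \<Phi> x"
    using continuous_attains_sup[OF \<open>compact Q\<close>, of \<Phi>] x0Q by blast
  have xmax: "\<Phi> z \<le> \<Phi> x" if "z \<in> P" for z
  proof (cases "c \<bullet> z \<le> U")
    case False
    then have "\<Phi> z < \<Phi> x0" using small that by simp
    then show ?thesis using x(2)[OF x0Q] by simp
  qed (use x(2) that in \<open>simp add: Q_def\<close>)
  have \<Phi>x: "0 < \<Phi> x" using x(2)[OF x0Q] \<Phi>0 by simp
  have xP: "\<And>j. 0 \<le> x $ j" "\<And>i. i < m \<Longrightarrow> A i \<bullet> x \<le> b i" using x(1) by (auto simp: Q_def P_def)
  have xpos: "0 < x $ j" for j
  proof -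
    have "(\<Prod>j\<in>UNIV. x $ j) \<noteq> 0" using \<Phi>x unfolding \<Phi>_def by (metis less_irrefl mult_zero_left mult_zero_right)
    then have "x $ j \<noteq> 0" by (simp add: prod_zero_iff)
    then show ?thesis using xP(1)[of j] by simp
  qed
  define w where "w i = b i - A i \<bullet> x" for i
  have wpos: "0 < w i" if "i < m" for i
  proof -
    have "(\<Prod>i<m. b i - A i \<bullet> x) \<noteq> 0" using \<Phi>x unfolding \<Phi>_def by (metis less_irrefl mult_zero_right)
    then have "b i - A i \<bullet> x \<noteq> 0" using that by auto
    then show ?thesis using xP(2)[OF that] by (simp add: w_def)
  qed
  \<comment> \<open>The maximum lies in the interior, where the derivative of \<open>ln \<Phi>\<close> in each direction \<open>v\<close> vanishes.\<close>
  have stationary: "- (c \<bullet> v) / \<nu> + (\<Sum>j\<in>UNIV. v $ j / x $ j) - (\<Sum>i<m. (A i \<bullet> v) / w i) = 0" for v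
  proof -
    define f where "f r = - (c \<bullet> (x + r *\<^sub>R v)) / \<nu> + (\<Sum>j\<in>UNIV. ln (x $ j + r * v $ j)) +
      (\<Sum>i<m. ln (w i - r * (A i \<bullet> v)))" for r
    have "eventually (\<lambda>r. (\<forall>j\<in>UNIV. 0 < x $ j + r * v $ j) \<and> (\<forall>i\<in>{..<m}. 0 < w i - r * (A i \<bullet> v))) (nhds 0)"
    proof (intro eventually_conj eventually_ball_finite ballI)
      fix j
      have "((\<lambda>r. x $ j + r * v $ j) \<longlongrightarrow> x $ j + 0 * v $ j) (nhds 0)"
        by (intro tendsto_intros filterlim_ident)
      then show "eventually (\<lambda>r. 0 < x $ j + r * v $ j) (nhds 0)"
        using xpos[of j] by (intro order_tendstoD(1)) auto
    next
      fix i assume i: "i \<in> {..<m}"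
      have "((\<lambda>r. w i - r * (A i \<bullet> v)) \<longlongrightarrow> w i - 0 * (A i \<bullet> v)) (nhds 0)"
        by (intro tendsto_intros filterlim_ident)
      then show "eventually (\<lambda>r. 0 < w i - r * (A i \<bullet> v)) (nhds 0)"
        using wpos[of i] i by (intro order_tendstoD(1)) auto
    qed auto
    then obtain d where d: "0 < d" and pos: "\<And>r j. \<bar>r\<bar> < d \<Longrightarrow> 0 < x $ j + r * v $ j"
      "\<And>r i. \<bar>r\<bar> < d \<Longrightarrow> i < m \<Longrightarrow> 0 < w i - r * (A i \<bullet> v)"
      unfolding eventually_nhds_metric by (auto simp: dist_real_def)
    have w_eq: "b i - A i \<bullet> (x + r *\<^sub>R v) = w i - r * (A i \<bullet> v)" for i r
      by (simp add: w_def inner_add_right)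
    have f_eq: "f r = ln (\<Phi> (x + r *\<^sub>R v))" and in_P: "x + r *\<^sub>R v \<in> P" and \<Phi>pos: "0 < \<Phi> (x + r *\<^sub>R v)"
      if r: "\<bar>r\<bar> < d" for r
    proof -
      have p: "0 < (\<Prod>j\<in>UNIV. x $ j + r * v $ j)" "0 < (\<Prod>i<m. w i - r * (A i \<bullet> v))"
        using pos r by (auto intro!: prod_pos)
      have e: "\<Phi> (x + r *\<^sub>R v) = exp (- (c \<bullet> (x + r *\<^sub>R v)) / \<nu>) *
        ((\<Prod>j\<in>UNIV. x $ j + r * v $ j) * (\<Prod>i<m. w i - r * (A i \<bullet> v)))"
        by (simp add: \<Phi>_def w_eq)
      then show "0 < \<Phi> (x + r *\<^sub>R v)" using p by simp
      have "ln (\<Prod>j\<in>UNIV. x $ j + r * v $ j) = (\<Sum>j\<in>UNIV. ln (x $ j + r * v $ j))"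
        using pos(1)[OF r] by (intro ln_prod) (auto simp: less_imp_neq[symmetric])
      moreover have "ln (\<Prod>i<m. w i - r * (A i \<bullet> v)) = (\<Sum>i<m. ln (w i - r * (A i \<bullet> v)))"
        using pos(2)[OF r] by (intro ln_prod) (auto simp: less_imp_neq[symmetric])
      ultimately show "f r = ln (\<Phi> (x + r *\<^sub>R v))"
        unfolding e f_def using p by (simp add: ln_mult_pos)
      show "x + r *\<^sub>R v \<in> P"
        using pos[OF r] w_eq[of _ r] by (auto simp: P_def less_imp_le) (smt (verit))
    qed
    have "f r \<le> f 0" if r: "\<bar>r\<bar> < d" for r
      using f_eq[OF r] f_eq[of 0] xmax[OF in_P[OF r]] \<Phi>pos[OF r] \<Phi>x d by simp
    then have max: "\<forall>r. \<bar>0 - r\<bar> < d \<longrightarrow> f r \<le> f 0" by simp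
    have "(f has_real_derivative (- (c \<bullet> v) / \<nu> + (\<Sum>j\<in>UNIV. v $ j / x $ j) +
        (\<Sum>i<m. - (A i \<bullet> v) / w i))) (at 0)"
      unfolding f_def
    proof (intro DERIV_add DERIV_sum)
      show "((\<lambda>r. - (c \<bullet> (x + r *\<^sub>R v)) / \<nu>) has_real_derivative - (c \<bullet> v) / \<nu>) (at 0)"
        unfolding inner_add_right inner_scaleR_right using \<nu>
        by (auto intro!: derivative_eq_intros)
      show "((\<lambda>r. ln (x $ j + r * v $ j)) has_real_derivative v $ j / x $ j) (at 0)" for j
        using xpos[of j] by (auto intro!: derivative_eq_intros)
      show "((\<lambda>r. ln (w i - r * (A i \<bullet> v))) has_real_derivative - (A i \<bullet> v) / w i) (at 0)"
        if "i \<in> {..<m}" for i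
        using wpos[of i] that by (auto intro!: derivative_eq_intros)
    qed
    from DERIV_local_max[OF this d max] show ?thesis by (simp add: sum_negf)
  qed
  define s where "s = (\<chi> j. \<nu> / x $ j)"
  define y where "y i = (if i < m then \<nu> / w i else 0)" for i
  have "s - (\<Sum>i<m. y i *\<^sub>R A i) = c"
  proof (rule vec_eq_iff[THEN iffD2], rule allI)
    fix k
    have "(\<Sum>j\<in>UNIV. axis k 1 $ j / x $ j) = (\<Sum>j\<in>UNIV. if j = k then 1 / x $ j else 0)"
      by (rule sum.cong) (auto simp: axis_def)
    then have "- c $ k / \<nu> + 1 / x $ k - (\<Sum>i<m. A i $ k / w i) = 0"
      using stationary[of "axis k 1"] by (simp add: inner_axis)
    then have "c $ k = \<nu> / x $ k - \<nu> * (\<Sum>i<m. A i $ k / w i)"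
      using \<nu> by (simp add: field_simps)
    also have "\<nu> * (\<Sum>i<m. A i $ k / w i) = (\<Sum>i<m. y i * A i $ k)"
      by (simp add: sum_distrib_left y_def)
    finally show "(s - (\<Sum>i<m. y i *\<^sub>R A i)) $ k = c $ k" by (simp add: s_def)
  qed
  then have "is_log_central_point m A b c \<nu> (x, (\<lambda>i. if i < m then w i else 0), s, y)"
    using xpos wpos \<nu> by (auto simp: is_log_central_point_def s_def y_def) (simp_all add: w_def less_le)
  then show ?thesis by blast
qed

section \<open>The entropic central path at a fixed real parameter\<close>

text \<open>
  The norm dominates the mean of the absolute values of the coordinates, so the integrand is bounded
  by a product of one-dimensional exponentials.
\<close>

lemma integrable_exp_norm:
  fixes k :: real
  assumes "0 < k"
  shows "integrable lborel (\<lambda>x::'a::euclidean_space. exp (- k * norm x))"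
proof -
  define r where "r = k / DIM('a)"
  have r: "0 < r" using assms by (simp add: r_def)
  have half: "(\<integral>\<^sup>+t. ennreal (exp (- r * t)) * indicator {0..} t \<partial>lborel) = ennreal (1 / r)"
  proof -
    have "((\<lambda>t. - exp (- r * t) / r) \<longlongrightarrow> - 0 / r) at_top"
      using r by (intro tendsto_intros filterlim_compose[OF exp_at_bot]
          filterlim_tendsto_neg_mult_at_bot[OF tendsto_const] filterlim_ident) auto
    moreover have "((\<lambda>t. - exp (- r * t) / r) has_real_derivative exp (- r * t)) (at t)" for t
      using r by (auto intro!: derivative_eq_intros)
    ultimately show ?thesis
      by (subst nn_integral_FTC_atLeast[where F="\<lambda>t. - exp (- r * t) / r" and T="- 0 / r"]) auto
  qed
  have "(\<integral>\<^sup>+t. ennreal (exp (- r * \<bar>t\<bar>)) \<partial>lborel) \<le>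
      (\<integral>\<^sup>+t. ennreal (exp (- r * t)) * indicator {0..} t + ennreal (exp (- r * (0 + - 1 * t))) * indicator {0..} (0 + - 1 * t) \<partial>lborel)"
    by (intro nn_integral_mono) (auto simp: indicator_def)
  also have "\<dots> = ennreal (1 / r) + (\<integral>\<^sup>+t. ennreal (exp (- r * (0 + - 1 * t))) * indicator {0..} (0 + - 1 * t) \<partial>lborel)"
    unfolding half[symmetric] by (rule nn_integral_add) measurable
  also have "(\<integral>\<^sup>+t. ennreal (exp (- r * (0 + - 1 * t))) * indicator {0..} (0 + - 1 * t) \<partial>lborel) = ennreal (1 / r)"
  proof -
    have "(\<integral>\<^sup>+t. ennreal (exp (- r * t)) * indicator {0..} t \<partial>lborel) =
        ennreal \<bar>- 1\<bar> * (\<integral>\<^sup>+t. ennreal (exp (- r * (0 + - 1 * t))) * indicator {0..} (0 + - 1 * t) \<partial>lborel)"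
      by (rule nn_integral_real_affine) auto
    then show ?thesis unfolding half by simp
  qed
  finally have one: "(\<integral>\<^sup>+t. ennreal (exp (- r * \<bar>t\<bar>)) \<partial>lborel) < \<infinity>"
    by (auto simp: less_top[symmetric] top_unique)
  have "exp (- k * norm x) \<le> (\<Prod>b\<in>Basis. exp (- r * \<bar>x \<bullet> b\<bar>))" for x :: 'a
  proof -
    have "(\<Sum>b\<in>Basis. \<bar>x \<bullet> b\<bar>) \<le> (\<Sum>b\<in>(Basis::'a set). norm x)"
      by (intro sum_mono Basis_le_norm)
    then have "r * (\<Sum>b\<in>Basis. \<bar>x \<bullet> b\<bar>) \<le> r * (DIM('a) * norm x)" using r by simp
    also have "\<dots> = k * norm x" by (simp add: r_def)
    finally show ?thesis by (simp add: exp_sum[symmetric] sum_negf sum_distrib_left)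
  qed
  then have "(\<integral>\<^sup>+x. ennreal (exp (- k * norm (x::'a))) \<partial>lborel) \<le>
      (\<integral>\<^sup>+x. (\<Prod>b\<in>Basis. ennreal (exp (- r * \<bar>(x::'a) \<bullet> b\<bar>))) \<partial>lborel)"
    by (intro nn_integral_mono) (simp add: prod_ennreal ennreal_leI)
  also have "\<dots> = (\<Prod>b\<in>(Basis::'a set). \<integral>\<^sup>+t. ennreal (exp (- r * \<bar>t\<bar>)) \<partial>lborel)"
    by (rule nn_integral_lborel_prod) auto
  also have "\<dots> < \<infinity>" using one by (simp add: power_less_top_ennreal)
  finally show ?thesis by (simp add: integrable_iff_bounded)
qed

lemma integral_half_affine:
  fixes g :: "'a::euclidean_space \<Rightarrow> real"
  assumes [measurable]: "g \<in> borel_measurable borel"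
  shows "(LINT x|lborel. g x) = (1 / 2) ^ DIM('a) * (LINT x|lborel. g (t + (1 / 2) *\<^sub>R x))"
    and "integrable lborel g \<Longrightarrow> integrable lborel (\<lambda>x. g (t + (1 / 2) *\<^sub>R x))"
proof -
  let ?D = "distr lborel borel (\<lambda>x::'a. t + (1 / 2) *\<^sub>R x)"
  let ?k = "(1 / 2 :: real) ^ DIM('a)"
  have eq: "lborel = density ?D (\<lambda>_. ennreal ?k)"
    using lborel_affine[of "1 / 2" t] by simp
  have "(LINT x|lborel. g x) = (LINT x|?D. ?k *\<^sub>R g x)"
    by (subst eq) (rule integral_density, auto)
  also have "\<dots> = ?k * (LINT x|lborel. g (t + (1 / 2) *\<^sub>R x))"
    by (simp add: integral_distr)
  finally show "(LINT x|lborel. g x) = ?k * (LINT x|lborel. g (t + (1 / 2) *\<^sub>R x))" .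
  assume "integrable lborel g"
  then have "integrable ?D (\<lambda>x. ?k *\<^sub>R g x)"
    by (subst (asm) eq) (subst (asm) integrable_density, auto)
  then have "integrable ?D g" by simp
  then show "integrable lborel (\<lambda>x. g (t + (1 / 2) *\<^sub>R x))"
    by (subst (asm) integrable_distr_eq) auto
qed

lemma integral_pos_if_pos_on_open:
  fixes g :: "'a::euclidean_space \<Rightarrow> real"
  assumes "integrable lborel g" "\<And>x. 0 \<le> g x" "open U" "U \<noteq> {}" "\<And>x. x \<in> U \<Longrightarrow> 0 < g x"
  shows "0 < (LINT x|lborel. g x)"
proof (rule ccontr)
  assume "\<not> ?thesis"
  moreover have "0 \<le> (LINT x|lborel. g x)" using assms(2) by simp
  ultimately have "(LINT x|lborel. g x) = 0" by linarith
  then have "AE x in lborel. g x = 0"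
    using integral_nonneg_eq_0_iff_AE[OF assms(1)] assms(2) by simp
  then have "AE x in lborel. x \<notin> U" by eventually_elim (use assms(5) in force)
  then have "U \<in> null_sets lborel" using assms(3) by (simp add: AE_iff_null_sets)
  then have "negligible U" using null_sets_completionI negligible_iff_null_sets by blast
  then show False using open_not_negligible assms(3,4) by blast
qed

lemma exp_le_quadratic:
  fixes s :: real
  shows "exp s \<le> 1 + s + s\<^sup>2 * exp \<bar>s\<bar>"
proof -
  obtain t where t: "\<bar>t\<bar> \<le> \<bar>s\<bar>" "exp s = (\<Sum>m<2. s ^ m / fact m) + exp t / fact 2 * s ^ 2"
    using Maclaurin_exp_le[of s 2] by blast
  have "exp t \<le> exp \<bar>s\<bar>" "0 < exp \<bar>s\<bar>" using t(1) by auto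
  then have "exp t / 2 \<le> exp \<bar>s\<bar>" by linarith
  then have "exp t / 2 * s\<^sup>2 \<le> exp \<bar>s\<bar> * s\<^sup>2" by (rule mult_right_mono) simp
  then show ?thesis using t(2) by (simp add: numeral_2_eq_2 mult.commute)
qed

locale entropic_problem =
  fixes P :: "(real ^ 'n) set" and c :: "real ^ 'n" and \<nu> :: real
  assumes closed_P: "closed P" and convex_P: "convex P" and zero_P: "0 \<in> P"
    and nonneg_P: "x \<in> P \<Longrightarrow> 0 \<le> x $ j" and interior_P: "interior P \<noteq> {}"
    and c_pos: "0 < c $ j" and \<nu>_pos: "0 < \<nu>"
begin

definition wt :: "real ^ 'n \<Rightarrow> real" where
  "wt x = indicator P x * exp (- (c \<bullet> x) / \<nu>)"

definition mass :: real where "mass = (LINT x|lborel. wt x)"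

definition barycenter :: "real ^ 'n" where
  "barycenter = (1 / mass) *\<^sub>R (LINT x|lborel. wt x *\<^sub>R x)"

text \<open>On \<open>P\<close>, the weight decays at least like \<open>exp (- rate * norm x)\<close>.\<close>

definition rate :: real where "rate = Min (range (($) c)) / \<nu>"

lemma rate_pos: "0 < rate"
  using c_pos \<nu>_pos by (simp add: rate_def)

lemma rate_le:
  assumes "x \<in> P"
  shows "rate * norm x \<le> (c \<bullet> x) / \<nu>"
proof -
  define k where "k = Min (range (($) c))"
  have k: "0 < k" "\<And>j. k \<le> c $ j" using c_pos by (auto simp: k_def)
  have "norm x \<le> (\<Sum>j\<in>UNIV. \<bar>x $ j\<bar>)" by (rule norm_le_l1_cart)
  also have "\<dots> = (\<Sum>j\<in>UNIV. x $ j)" using nonneg_P[OF assms] by simp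
  finally have "k * norm x \<le> (\<Sum>j\<in>UNIV. k * x $ j)" using k by (simp add: sum_distrib_left[symmetric])
  also have "\<dots> \<le> c \<bullet> x" unfolding inner_vec_def
    using k nonneg_P[OF assms] by (intro sum_mono) (auto intro: mult_right_mono)
  finally show ?thesis using \<nu>_pos by (simp add: rate_def k_def[symmetric] divide_right_mono)
qed

lemma cost_nonneg: "x \<in> P \<Longrightarrow> 0 \<le> c \<bullet> x"
  unfolding inner_vec_def using nonneg_P c_pos by (intro sum_nonneg) (simp add: less_imp_le)

lemma borel_P [measurable]: "P \<in> sets borel"
  using closed_P by simp

lemma wt_measurable [measurable]: "wt \<in> borel_measurable borel"
  unfolding wt_def[abs_def] by measurable

lemma wt_nonneg: "0 \<le> wt x"
  by (simp add: wt_def)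

lemma wt_pos: "x \<in> P \<Longrightarrow> 0 < wt x"
  by (simp add: wt_def)

lemma wt_pos_interior: "x \<in> interior P \<Longrightarrow> 0 < wt x"
  using wt_pos interior_subset by blast

lemma integrable_wt:
  fixes g :: "real ^ 'n \<Rightarrow> 'b::{banach, second_countable_topology}"
  assumes [measurable]: "g \<in> borel_measurable borel"
    and g: "\<And>x. x \<in> P \<Longrightarrow> norm (g x) \<le> C * exp (\<delta> * norm x)" and \<delta>: "\<delta> < rate"
  shows "integrable lborel (\<lambda>x. wt x *\<^sub>R g x)"
proof (rule Bochner_Integration.integrable_bound)
  show "integrable lborel (\<lambda>x::real ^ 'n. \<bar>C\<bar> * exp (- (rate - \<delta>) * norm x))"
    using \<delta> by (intro integrable_mult_right integrable_exp_norm) simp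
  show "(\<lambda>x. wt x *\<^sub>R g x) \<in> borel_measurable lborel" by simp
  show "AE x in lborel. norm (wt x *\<^sub>R g x) \<le> norm (\<bar>C\<bar> * exp (- (rate - \<delta>) * norm x))"
  proof (rule AE_I2)
    fix x :: "real ^ 'n"
    show "norm (wt x *\<^sub>R g x) \<le> norm (\<bar>C\<bar> * exp (- (rate - \<delta>) * norm x))"
    proof (cases "x \<in> P")
      case True
      have "norm (wt x *\<^sub>R g x) = exp (- (c \<bullet> x) / \<nu>) * norm (g x)" using True by (simp add: wt_def)
      also have "\<dots> \<le> exp (- (rate * norm x)) * (\<bar>C\<bar> * exp (\<delta> * norm x))"
        using rate_le[OF True] g[OF True]
        by (intro mult_mono) (auto intro: order_trans[OF _ mult_right_mono[OF abs_ge_self]])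
      also have "\<dots> = \<bar>C\<bar> * exp (- (rate - \<delta>) * norm x)"
        by (simp add: exp_add[symmetric] algebra_simps)
      finally show ?thesis by simp
    qed (simp add: wt_def)
  qed
qed

lemma integrable_wt_affine: "integrable lborel (\<lambda>x. wt x * (a \<bullet> x + b))"
  and integrable_wt_id: "integrable lborel (\<lambda>x. wt x *\<^sub>R x)"
  and integrable_wt_const: "integrable lborel (\<lambda>x. wt x)"
proof -
  have norm_le: "norm x \<le> 2 / rate * exp (rate / 2 * norm x)" for x :: "real ^ 'n"
    using exp_ge_add_one_self[of "rate / 2 * norm x"] rate_pos by (simp add: field_simps)
  show id: "integrable lborel (\<lambda>x. wt x *\<^sub>R x)"
    using rate_pos by (intro integrable_wt[of _ "2 / rate" "rate / 2"] norm_le) auto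
  show const: "integrable lborel (\<lambda>x. wt x)"
    using integrable_wt[of "\<lambda>_. 1::real" 1 0] rate_pos by simp
  have "integrable lborel (\<lambda>x. a \<bullet> (wt x *\<^sub>R x) + b * wt x)"
    using id const by (intro Bochner_Integration.integrable_add integrable_mult_right integrable_inner_right) auto
  then show "integrable lborel (\<lambda>x. wt x * (a \<bullet> x + b))" by (simp add: algebra_simps)
qed

lemma mass_pos: "0 < mass"
  unfolding mass_def
  by (rule integral_pos_if_pos_on_open[OF integrable_wt_const wt_nonneg open_interior interior_P])
     (use interior_subset in \<open>auto intro: wt_pos\<close>)

lemma integral_wt_affine: "(LINT x|lborel. wt x * (a \<bullet> x + b)) = mass * (a \<bullet> barycenter + b)"
proof -
  have "(LINT x|lborel. wt x * (a \<bullet> x + b)) = (LINT x|lborel. a \<bullet> (wt x *\<^sub>R x) + b * wt x)"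
    by (simp add: algebra_simps)
  also have "\<dots> = (LINT x|lborel. a \<bullet> (wt x *\<^sub>R x)) + (LINT x|lborel. b * wt x)"
    by (intro Bochner_Integration.integral_add integrable_inner_right integrable_mult_right
        integrable_wt_id integrable_wt_const)
  also have "(LINT x|lborel. a \<bullet> (wt x *\<^sub>R x)) = a \<bullet> (LINT x|lborel. wt x *\<^sub>R x)"
    by (rule integral_inner_right) (rule integrable_wt_id)
  also have "(LINT x|lborel. b * wt x) = b * mass" by (simp add: mass_def)
  finally show ?thesis using mass_pos by (simp add: barycenter_def algebra_simps)
qed

text \<open>
  If a hyperplane separated the barycenter from the interior, the corresponding linear form would be
  positive on the interior and yet have nonpositive mean.
\<close>

lemma barycenter_interior: "barycenter \<in> interior P"
proof (rule ccontr)
  assume "barycenter \<notin> interior P"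
  then obtain a b where ab: "a \<noteq> 0" "a \<bullet> barycenter \<le> b" "\<And>x. x \<in> interior P \<Longrightarrow> b \<le> a \<bullet> x"
    using separating_hyperplane_sets[of "{barycenter}" "interior P"] interior_P convex_P convex_interior
    by auto
  have "closure (interior P) \<subseteq> {x. b \<le> a \<bullet> x}"
    using ab(3) by (intro closure_minimal closed_halfspace_ge) auto
  then have P: "b \<le> a \<bullet> x" if "x \<in> P" for x
    using that closure_subset[of P] convex_closure_interior[OF convex_P interior_P] by blast
  have "0 < (LINT x|lborel. wt x * (a \<bullet> x + - b))"
  proof (rule integral_pos_if_pos_on_open[OF integrable_wt_affine _ open_interior interior_P])
    show "0 \<le> wt x * (a \<bullet> x + - b)" for x
      using P wt_nonneg by (cases "x \<in> P") (auto simp: wt_def)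
    fix x assume x: "x \<in> interior P"
    \<comment> \<open>A nonzero linear form does not attain its minimum over an open set.\<close>
    obtain e where e: "0 < e" "ball x e \<subseteq> interior P" using x open_contains_ball[of "interior P"] by auto
    define z where "z = x - (e / (2 * norm a)) *\<^sub>R a"
    have "z \<in> ball x e" using ab(1) e(1) by (simp add: z_def dist_norm)
    then have "b \<le> a \<bullet> z" using e(2) ab(3) by blast
    moreover have "a \<bullet> z < a \<bullet> x" using ab(1) e(1) by (simp add: z_def inner_diff_right)
    ultimately show "0 < wt x * (a \<bullet> x + - b)"
      using wt_pos x interior_subset by (intro mult_pos_pos) auto
  qed
  then have "0 < mass * (a \<bullet> barycenter + - b)" by (simp only: integral_wt_affine)
  then show False using mass_pos ab(2) by (simp add: zero_less_mult_iff)
qed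

text \<open>The parameter at which the log-Laplace transform has the barycenter as its gradient.\<close>

definition tilt :: "real ^ 'n" where "tilt = - (1 / \<nu>) *\<^sub>R c"

lemma nn_integral_tilt:
  "(\<integral>\<^sup>+x\<in>P. ennreal (exp ((tilt + h) \<bullet> x)) \<partial>lborel) = (\<integral>\<^sup>+x. ennreal (wt x * exp (h \<bullet> x)) \<partial>lborel)"
  by (rule nn_integral_cong)
     (auto simp: wt_def tilt_def indicator_def inner_diff_left exp_diff exp_minus divide_inverse mult_ac)

lemma log_laplace_tilt:
  assumes "integrable lborel (\<lambda>x. wt x * exp (h \<bullet> x))"
  shows "log_laplace P (tilt + h) = ereal (ln (LINT x|lborel. wt x * exp (h \<bullet> x)))"
proof -
  have pos: "0 < (LINT x|lborel. wt x * exp (h \<bullet> x))"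
    by (rule integral_pos_if_pos_on_open[OF assms _ open_interior interior_P])
       (auto intro!: mult_pos_pos wt_pos_interior simp: wt_nonneg)
  have "(\<integral>\<^sup>+x. ennreal (wt x * exp (h \<bullet> x)) \<partial>lborel) = ennreal (LINT x|lborel. wt x * exp (h \<bullet> x))"
    using assms by (intro nn_integral_eq_integral) (auto simp: wt_nonneg)
  then show ?thesis using pos
    by (simp add: log_laplace_def nn_integral_tilt ln_ennreal_def ennreal_eq_0_iff)
qed

lemma log_laplace_tilt_zero: "log_laplace P tilt = ereal (ln mass)"
  using log_laplace_tilt[of 0] integrable_wt_const by (simp add: mass_def)

text \<open>Jensen's inequality, from the tangent of \<open>exp\<close> at the mean of \<open>\<langle>h, x\<rangle>\<close>.\<close>

lemma log_laplace_ge: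
  "ereal (ln mass + h \<bullet> barycenter) \<le> log_laplace P (tilt + h)"
proof (cases "integrable lborel (\<lambda>x. wt x * exp (h \<bullet> x))")
  case True
  define e where "e = exp (h \<bullet> barycenter)"
  have "mass * e = (LINT x|lborel. wt x * ((e *\<^sub>R h) \<bullet> x + e * (1 - h \<bullet> barycenter)))"
    unfolding integral_wt_affine by (simp add: algebra_simps)
  also have "\<dots> \<le> (LINT x|lborel. wt x * exp (h \<bullet> x))"
  proof (intro integral_mono[OF integrable_wt_affine True] mult_left_mono wt_nonneg)
    fix x
    have "e * (1 + (h \<bullet> x - h \<bullet> barycenter)) \<le> e * exp (h \<bullet> x - h \<bullet> barycenter)"
      by (intro mult_left_mono exp_ge_add_one_self) (simp add: e_def)
    then show "(e *\<^sub>R h) \<bullet> x + e * (1 - h \<bullet> barycenter) \<le> exp (h \<bullet> x)"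
      by (simp add: e_def exp_add[symmetric] algebra_simps)
  qed
  finally have *: "mass * e \<le> (LINT x|lborel. wt x * exp (h \<bullet> x))" .
  moreover have "0 < mass * e" using mass_pos by (simp add: e_def)
  ultimately have "ln (mass * e) \<le> ln (LINT x|lborel. wt x * exp (h \<bullet> x))"
    by (subst ln_le_cancel_iff) linarith+
  then show ?thesis using mass_pos by (simp add: log_laplace_tilt[OF True] ln_mult_pos e_def)
next
  case False
  have "(\<integral>\<^sup>+x. ennreal (wt x * exp (h \<bullet> x)) \<partial>lborel) = \<infinity>"
  proof (rule ccontr)
    assume "(\<integral>\<^sup>+x. ennreal (wt x * exp (h \<bullet> x)) \<partial>lborel) \<noteq> \<infinity>"
    then have "integrable lborel (\<lambda>x. wt x * exp (h \<bullet> x))"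
      by (intro integrableI_nonneg) (auto simp: wt_nonneg less_top)
    then show False using False by simp
  qed
  then show ?thesis by (simp add: log_laplace_def nn_integral_tilt ln_ennreal_def)
qed

lemma conjugate_ge: "ereal (tilt \<bullet> y - ln mass) \<le> fenchel_conjugate (log_laplace P) y"
  unfolding fenchel_conjugate_def
  by (rule SUP_upper2[of tilt]) (simp_all add: log_laplace_tilt_zero)

lemma conjugate_barycenter:
  "fenchel_conjugate (log_laplace P) barycenter = ereal (tilt \<bullet> barycenter - ln mass)"
proof (rule antisym)
  show "fenchel_conjugate (log_laplace P) barycenter \<le> ereal (tilt \<bullet> barycenter - ln mass)"
    unfolding fenchel_conjugate_def
  proof (rule SUP_least)
    fix \<theta>
    have "ereal (ln mass + (\<theta> - tilt) \<bullet> barycenter) \<le> log_laplace P \<theta>"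
      using log_laplace_ge[of "\<theta> - tilt"] by simp
    then show "ereal (\<theta> \<bullet> barycenter) - log_laplace P \<theta> \<le> ereal (tilt \<bullet> barycenter - ln mass)"
      by (cases "log_laplace P \<theta>") (auto simp: inner_diff_left)
  qed
qed (rule conjugate_ge)

lemma tilt_inner: "c \<bullet> x + \<nu> * (tilt \<bullet> x - r) = - \<nu> * r"
  using \<nu>_pos by (simp add: tilt_def algebra_simps)

lemma objective_ge: "ereal (- \<nu> * ln mass) \<le> entropic_objective P c \<nu> y"
proof -
  have "ereal (- \<nu> * ln mass) = ereal (c \<bullet> y) + ereal \<nu> * ereal (tilt \<bullet> y - ln mass)"
    by (simp only: times_ereal.simps plus_ereal.simps tilt_inner)
  also have "\<dots> \<le> entropic_objective P c \<nu> y"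
    unfolding entropic_objective_def
    using \<nu>_pos by (intro add_left_mono ereal_mult_left_mono conjugate_ge) auto
  finally show ?thesis .
qed

lemma objective_barycenter: "entropic_objective P c \<nu> barycenter = ereal (- \<nu> * ln mass)"
  unfolding entropic_objective_def conjugate_barycenter
  by (simp only: times_ereal.simps plus_ereal.simps tilt_inner)

lemma barycenter_optimal: "is_entropic_optimum P c \<nu> barycenter"
  unfolding is_entropic_optimum_def using barycenter_interior objective_barycenter objective_ge by simp

text \<open>
  An optimum \<open>y\<close> is a subgradient at \<open>tilt\<close> of the log-Laplace transform, which is differentiable
  there with gradient the barycenter; the second order estimate below replaces differentiability.
\<close>

lemma optimum_unique:
  assumes "is_entropic_optimum P c \<nu> y"
  shows "y = barycenter"
proof (rule ccontr)
  assume "y \<noteq> barycenter"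
  define u where "u = y - barycenter"
  have u: "u \<noteq> 0" using \<open>y \<noteq> barycenter\<close> by (simp add: u_def)
  have "entropic_objective P c \<nu> y \<le> ereal (- \<nu> * ln mass)"
    using assms barycenter_interior unfolding is_entropic_optimum_def objective_barycenter[symmetric] by blast
  then have le: "fenchel_conjugate (log_laplace P) y \<le> ereal (tilt \<bullet> y - ln mass)"
  proof (cases "fenchel_conjugate (log_laplace P) y")
    case (real f)
    assume "entropic_objective P c \<nu> y \<le> ereal (- \<nu> * ln mass)"
    then have "c \<bullet> y + \<nu> * f \<le> c \<bullet> y + \<nu> * (tilt \<bullet> y - ln mass)"
      unfolding tilt_inner by (simp add: entropic_objective_def real)
    then show ?thesis using \<nu>_pos by (simp add: real)
  qed (use \<nu>_pos in \<open>auto simp: entropic_objective_def\<close>)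
  have sub: "mass * exp (h \<bullet> y) \<le> (LINT x|lborel. wt x * exp (h \<bullet> x))"
    if h: "integrable lborel (\<lambda>x. wt x * exp (h \<bullet> x))" for h
  proof -
    have pos: "0 < (LINT x|lborel. wt x * exp (h \<bullet> x))"
      by (rule integral_pos_if_pos_on_open[OF h _ open_interior interior_P])
         (auto intro!: mult_pos_pos wt_pos_interior simp: wt_nonneg)
    have "ereal ((tilt + h) \<bullet> y) - log_laplace P (tilt + h) \<le> fenchel_conjugate (log_laplace P) y"
      unfolding fenchel_conjugate_def by (rule SUP_upper) simp
    with le have "ereal ((tilt + h) \<bullet> y) - log_laplace P (tilt + h) \<le> ereal (tilt \<bullet> y - ln mass)"
      by (rule order_trans[rotated])
    then have "ln mass + h \<bullet> y \<le> ln (LINT x|lborel. wt x * exp (h \<bullet> x))"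
      by (simp add: log_laplace_tilt[OF h] inner_add_left)
    then have "exp (ln mass + h \<bullet> y) \<le> exp (ln (LINT x|lborel. wt x * exp (h \<bullet> x)))" by simp
    then show ?thesis using mass_pos pos by (simp add: exp_add)
  qed
  \<comment> \<open>The mean of \<open>a\<close> is \<open>- |u|\<^sup>2\<close>, whereas \<open>sub\<close> says that \<open>exp (r * a)\<close> has mean at least \<open>1\<close> for all
    small \<open>r\<close>. The radius \<open>r0\<close> is chosen so that \<open>q\<close>, which bounds the second order term, is integrable.\<close>
  define a where "a x = u \<bullet> x - u \<bullet> y" for x
  define r0 where "r0 = rate / (4 * norm u)"
  have r0: "0 < r0" using u rate_pos by (simp add: r0_def)
  have a_le: "r0 * \<bar>a x\<bar> \<le> rate / 4 * norm x + rate / 4 * norm y" for x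
  proof -
    have "\<bar>a x\<bar> \<le> norm u * norm x + norm u * norm y"
      unfolding a_def using Cauchy_Schwarz_ineq2[of u x] Cauchy_Schwarz_ineq2[of u y] by linarith
    then have "r0 * \<bar>a x\<bar> \<le> r0 * (norm u * norm x + norm u * norm y)" using r0 by simp
    also have "\<dots> = rate / 4 * norm x + rate / 4 * norm y" using u by (simp add: r0_def field_simps)
    finally show ?thesis .
  qed
  define q where "q x = (a x)\<^sup>2 * exp (r0 * \<bar>a x\<bar>)" for x
  have a_meas [measurable]: "a \<in> borel_measurable borel" unfolding a_def[abs_def] by measurable
  have int_q: "integrable lborel (\<lambda>x. wt x *\<^sub>R q x)"
  proof (rule integrable_wt)
    show "q \<in> borel_measurable borel" unfolding q_def[abs_def] by measurable
    fix x
    have "z\<^sup>2 \<le> 2 * exp z" if "0 \<le> z" for z :: real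
      using exp_lower_Taylor_quadratic[OF that] that by linarith
    then have "(r0 * \<bar>a x\<bar>)\<^sup>2 \<le> 2 * exp (r0 * \<bar>a x\<bar>)" using r0 by simp
    then have "(a x)\<^sup>2 \<le> 2 / r0\<^sup>2 * exp (r0 * \<bar>a x\<bar>)" using r0 by (simp add: power_mult_distrib field_simps)
    then have "q x \<le> 2 / r0\<^sup>2 * exp (r0 * \<bar>a x\<bar>) * exp (r0 * \<bar>a x\<bar>)"
      unfolding q_def by (intro mult_right_mono) auto
    also have "\<dots> = 2 / r0\<^sup>2 * exp (2 * (r0 * \<bar>a x\<bar>))" by (simp add: exp_add[symmetric])
    also have "\<dots> \<le> 2 / r0\<^sup>2 * exp (rate / 2 * norm y + rate / 2 * norm x)"
      using a_le[of x] r0 by (intro mult_left_mono) auto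
    also have "\<dots> = (2 / r0\<^sup>2 * exp (rate / 2 * norm y)) * exp (rate / 2 * norm x)" by (simp add: exp_add)
    finally show "norm (q x) \<le> (2 / r0\<^sup>2 * exp (rate / 2 * norm y)) * exp (rate / 2 * norm x)"
      by (simp add: q_def)
  qed (use rate_pos in simp)
  define I where "I = (LINT x|lborel. wt x * q x)"
  have est: "mass * (norm u)\<^sup>2 \<le> r * I" if r: "0 < r" "r \<le> r0" for r
  proof -
    have int_e: "integrable lborel (\<lambda>x. wt x *\<^sub>R exp ((r *\<^sub>R u) \<bullet> x))"
    proof (rule integrable_wt)
      fix x
      have "r * (u \<bullet> x) \<le> r0 * (norm u * norm x)"
        using r r0 Cauchy_Schwarz_ineq2[of u x] by (intro order_trans[OF _ mult_mono[of r r0 "\<bar>u \<bullet> x\<bar>"]]) (auto intro: mult_left_mono)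
      also have "\<dots> = rate / 4 * norm x" using u by (simp add: r0_def)
      finally show "norm (exp ((r *\<^sub>R u) \<bullet> x)) \<le> 1 * exp (rate / 4 * norm x)" by simp
    qed (use rate_pos in auto)
    then have "mass * exp ((r *\<^sub>R u) \<bullet> y) \<le> (LINT x|lborel. wt x * exp ((r *\<^sub>R u) \<bullet> x))"
      by (intro sub) simp
    moreover have "(LINT x|lborel. wt x * exp ((r *\<^sub>R u) \<bullet> x)) = exp ((r *\<^sub>R u) \<bullet> y) * (LINT x|lborel. wt x * exp (r * a x))"
      unfolding integral_mult_right_zero[symmetric]
      by (rule Bochner_Integration.integral_cong) (auto simp: a_def exp_diff right_diff_distrib)
    ultimately have "mass \<le> (LINT x|lborel. wt x * exp (r * a x))" by simp
    also have "\<dots> \<le> (LINT x|lborel. wt x * ((r *\<^sub>R u) \<bullet> x + (1 - r * (u \<bullet> y))) + r\<^sup>2 * (wt x * q x))"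
    proof (rule integral_mono)
      have "integrable lborel (\<lambda>x. exp (- (r * (u \<bullet> y))) * (wt x * exp ((r *\<^sub>R u) \<bullet> x)))"
        using int_e by (intro integrable_mult_right) simp
      then show "integrable lborel (\<lambda>x. wt x * exp (r * a x))"
        by (rule back_subst[where P="integrable lborel"])
          (auto simp: a_def right_diff_distrib exp_diff exp_minus field_simps)
      show "integrable lborel (\<lambda>x. wt x * ((r *\<^sub>R u) \<bullet> x + (1 - r * (u \<bullet> y))) + r\<^sup>2 * (wt x * q x))"
        using int_q by (intro Bochner_Integration.integrable_add integrable_wt_affine integrable_mult_right) simp
      fix x
      have "exp (r * a x) \<le> 1 + r * a x + (r * a x)\<^sup>2 * exp \<bar>r * a x\<bar>" by (rule exp_le_quadratic)
      also have "(r * a x)\<^sup>2 * exp \<bar>r * a x\<bar> \<le> r\<^sup>2 * q x"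
        unfolding q_def power_mult_distrib mult.assoc using r
        by (intro mult_left_mono) (auto simp: abs_mult intro: mult_right_mono)
      finally have "exp (r * a x) \<le> (r *\<^sub>R u) \<bullet> x + (1 - r * (u \<bullet> y)) + r\<^sup>2 * q x"
        by (simp add: a_def algebra_simps)
      from mult_left_mono[OF this wt_nonneg[of x]]
      show "wt x * exp (r * a x) \<le> wt x * ((r *\<^sub>R u) \<bullet> x + (1 - r * (u \<bullet> y))) + r\<^sup>2 * (wt x * q x)"
        by (simp add: algebra_simps)
    qed
    also have "\<dots> = mass * ((r *\<^sub>R u) \<bullet> barycenter + (1 - r * (u \<bullet> y))) + r\<^sup>2 * I"
    proof -
      have "integrable lborel (\<lambda>x. r\<^sup>2 * (wt x * q x))" using int_q by (intro integrable_mult_right) simp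
      from Bochner_Integration.integral_add[OF integrable_wt_affine this] show ?thesis
        by (simp only: integral_wt_affine integral_mult_right_zero I_def)
    qed
    also have "\<dots> = mass - r * (mass * (norm u)\<^sup>2) + r * (r * I)"
    proof -
      have n: "(norm u)\<^sup>2 = u \<bullet> y - u \<bullet> barycenter"
        unfolding power2_norm_eq_inner inner_diff_right[symmetric] by (simp add: u_def)
      show ?thesis unfolding n by (simp add: power2_eq_square algebra_simps)
    qed
    finally have "r * (mass * (norm u)\<^sup>2) \<le> r * (r * I)" by simp
    then show ?thesis using r by simp
  qed
  have I0: "0 \<le> I" unfolding I_def by (intro integral_nonneg_AE AE_I2 mult_nonneg_nonneg wt_nonneg) (simp add: q_def)
  define m where "m = mass * (norm u)\<^sup>2"
  have m: "0 < m" using mass_pos u by (simp add: m_def)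
  define r where "r = min r0 (m / (2 * (I + 1)))"
  have r: "0 < r" "r \<le> r0" using r0 m I0 by (auto simp: r_def)
  have "r * I \<le> m / (2 * (I + 1)) * (I + 1)" using r I0 m by (intro mult_mono) (auto simp: r_def)
  also have "\<dots> = m / 2" using I0 by (simp add: field_simps)
  finally show False using est[OF r] m by (simp add: m_def)
qed

lemma ex1_entropic_optimum: "\<exists>!x. is_entropic_optimum P c \<nu> x"
  using barycenter_optimal optimum_unique by blast

lemma entropic_central_path_eq: "entropic_central_path P c \<nu> = barycenter"
  unfolding entropic_central_path_def using barycenter_optimal optimum_unique by (rule the_equality)

text \<open>
  Averaging with a fixed point of \<open>P\<close> maps \<open>P\<close> into itself and scales volumes by \<open>2\<^sup>-\<^sup>n\<close>. This
  compares the weight with the weight at half the rate, and thereby bounds the barycenter on both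
  sides: its cost is of order \<open>\<nu>\<close>, and it dominates all points of cost at most \<open>\<nu>\<close>.
\<close>

definition half_wt :: "real ^ 'n \<Rightarrow> real" where
  "half_wt x = indicator P x * exp (- (c \<bullet> x) / (2 * \<nu>))"

lemma midpoint_P: "x \<in> P \<Longrightarrow> y \<in> P \<Longrightarrow> (1 / 2) *\<^sub>R x + (1 / 2) *\<^sub>R y \<in> P"
  using convex_P by (simp add: convex_def)

lemma half_wt_measurable [measurable]: "half_wt \<in> borel_measurable borel"
  unfolding half_wt_def[abs_def] by measurable

lemma half_wt_le: "half_wt x \<le> wt ((1 / 2) *\<^sub>R x)"
  using midpoint_P[OF zero_P, of x] by (auto simp: half_wt_def wt_def indicator_def)

lemma wt_le_half_wt: "wt x \<le> half_wt x"
  using cost_nonneg[of x] \<nu>_pos by (auto simp: half_wt_def wt_def indicator_def field_simps)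

lemma integrable_half_wt: "integrable lborel half_wt"
proof (rule Bochner_Integration.integrable_bound)
  show "integrable lborel (\<lambda>x. wt (0 + (1 / 2) *\<^sub>R x))"
    by (rule integral_half_affine(2)) (auto simp: integrable_wt_const)
  show "AE x in lborel. norm (half_wt x) \<le> norm (wt (0 + (1 / 2) *\<^sub>R x))"
    using half_wt_le wt_nonneg by (auto simp: half_wt_def)
qed simp

lemma integral_half_wt_le: "(LINT x|lborel. half_wt x) \<le> 2 ^ CARD('n) * mass"
proof -
  have "(LINT x|lborel. half_wt x) \<le> (LINT x|lborel. wt (0 + (1 / 2) *\<^sub>R x))"
  proof (rule integral_mono[OF integrable_half_wt])
    show "integrable lborel (\<lambda>x. wt (0 + (1 / 2) *\<^sub>R x))"
      by (rule integral_half_affine(2)) (auto simp: integrable_wt_const)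
  qed (simp add: half_wt_le)
  also have "\<dots> = 2 ^ CARD('n) * mass"
    using integral_half_affine(1)[of wt 0] by (simp add: mass_def power_one_over)
  finally show ?thesis .
qed

lemma mass_le: "mass \<le> (LINT x|lborel. half_wt x)"
  unfolding mass_def by (rule integral_mono[OF integrable_wt_const integrable_half_wt wt_le_half_wt])

lemma barycenter_cost: "c \<bullet> barycenter \<le> 2 ^ (CARD('n) + 1) * \<nu>"
proof -
  have "mass * (c \<bullet> barycenter) = (LINT x|lborel. wt x * (c \<bullet> x + 0))"
    unfolding integral_wt_affine by simp
  also have "\<dots> \<le> (LINT x|lborel. 2 * \<nu> * half_wt x)"
  proof (rule integral_mono[OF integrable_wt_affine integrable_mult_right[OF integrable_half_wt]])
    fix x
    show "wt x * (c \<bullet> x + 0) \<le> 2 * \<nu> * half_wt x"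
    proof (cases "x \<in> P")
      case True
      define z where "z = (c \<bullet> x) / (2 * \<nu>)"
      have z: "c \<bullet> x = 2 * \<nu> * z" using \<nu>_pos by (simp add: z_def)
      have "z \<le> exp z" using exp_ge_add_one_self[of z] by linarith
      then have "exp (- 2 * z) * z \<le> exp (- 2 * z) * exp z" by (intro mult_left_mono) auto
      also have "\<dots> = exp (- z)" by (simp add: exp_add[symmetric])
      finally have "2 * \<nu> * (exp (- 2 * z) * z) \<le> 2 * \<nu> * exp (- z)" using \<nu>_pos by simp
      then show ?thesis using True \<nu>_pos by (simp add: wt_def half_wt_def z mult_ac)
    qed (simp add: wt_def half_wt_def)
  qed
  also have "\<dots> \<le> 2 * \<nu> * (2 ^ CARD('n) * mass)"
    using integral_half_wt_le \<nu>_pos by (simp add: mult_left_mono)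
  finally have "mass * (c \<bullet> barycenter) \<le> mass * (2 ^ (CARD('n) + 1) * \<nu>)" by (simp add: mult_ac)
  then show ?thesis using mass_pos by simp
qed

lemma barycenter_dominates:
  assumes p: "p \<in> P" "c \<bullet> p \<le> \<nu>"
  shows "p $ j \<le> 2 ^ (CARD('n) + 2) * barycenter $ j"
proof -
  have pj: "0 \<le> p $ j" using nonneg_P p(1) by blast
  define g where "g x = wt x * (axis j 1 \<bullet> x + 0)" for x
  have g_meas: "g \<in> borel_measurable borel" unfolding g_def[abs_def] by measurable
  have g_int: "integrable lborel g" unfolding g_def by (rule integrable_wt_affine)
  have "(p $ j / 4) * mass \<le> (p $ j / 4) * (LINT x|lborel. half_wt x)"
    using mass_le pj by (intro mult_left_mono) auto
  also have "\<dots> = (LINT x|lborel. (p $ j / 4) * half_wt x)" by simp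
  also have "\<dots> \<le> (LINT x|lborel. g ((1 / 2) *\<^sub>R p + (1 / 2) *\<^sub>R x))"
  proof (rule integral_mono[OF integrable_mult_right[OF integrable_half_wt] integral_half_affine(2)[OF g_meas g_int]])
    fix x
    show "p $ j / 4 * half_wt x \<le> g ((1 / 2) *\<^sub>R p + (1 / 2) *\<^sub>R x)"
    proof (cases "x \<in> P")
      case True
      have "exp (1 / 2 :: real) \<le> 2"
        using exp_bound_half[of "1 / 2 :: real"] by simp
      then have "1 / 2 \<le> exp (- (1 / 2) :: real)" by (simp add: exp_minus field_simps)
      also have "exp (- (1 / 2)) \<le> exp (- (c \<bullet> p) / (2 * \<nu>))" using p(2) \<nu>_pos by (simp add: field_simps)
      finally have e: "1 / 2 \<le> exp (- (c \<bullet> p) / (2 * \<nu>))" .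
      have "wt ((1 / 2) *\<^sub>R p + (1 / 2) *\<^sub>R x) = exp (- (c \<bullet> p) / (2 * \<nu>)) * half_wt x"
      proof -
        have "- (c \<bullet> ((1 / 2) *\<^sub>R p + (1 / 2) *\<^sub>R x)) / \<nu> = - (c \<bullet> p) / (2 * \<nu>) + - (c \<bullet> x) / (2 * \<nu>)"
          using \<nu>_pos by (simp add: inner_add_right field_simps)
        then show ?thesis
          unfolding wt_def half_wt_def using midpoint_P[OF p(1) True] True by (simp only: exp_add) simp
      qed
      then have g: "g ((1 / 2) *\<^sub>R p + (1 / 2) *\<^sub>R x) =
          exp (- (c \<bullet> p) / (2 * \<nu>)) * ((p $ j + x $ j) / 2) * half_wt x"
        by (simp add: g_def inner_axis' inner_add_right add_divide_distrib)
      have "1 / 2 * (p $ j / 2) \<le> exp (- (c \<bullet> p) / (2 * \<nu>)) * ((p $ j + x $ j) / 2)"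
        using e pj nonneg_P[OF True, of j] by (intro mult_mono) auto
      then show ?thesis unfolding g by (intro mult_right_mono) (auto simp: half_wt_def)
    next
      case False
      have "0 \<le> g z" for z
      proof (cases "z \<in> P")
        case True
        then show ?thesis using nonneg_P[OF True, of j] wt_nonneg[of z] by (simp add: g_def inner_axis')
      qed (simp add: g_def wt_def)
      then show ?thesis using False by (simp add: half_wt_def)
    qed
  qed
  also have "\<dots> = 2 ^ CARD('n) * (LINT x|lborel. g x)"
    using integral_half_affine(1)[OF g_meas, of "(1 / 2) *\<^sub>R p"] by (simp add: power_one_over)
  also have "(LINT x|lborel. g x) = mass * barycenter $ j"
    unfolding g_def integral_wt_affine by (simp add: inner_axis')
  finally have "mass * p $ j \<le> mass * (2 ^ (CARD('n) + 2) * barycenter $ j)" by (simp add: mult_ac)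
  then show ?thesis using mass_pos by simp
qed

end

section \<open>From Puiseux series to large real parameters\<close>

lemma solutions_eventually:
  assumes "finite Q" "x \<in> solutions Q"
  shows "\<forall>\<^sub>F t in at_top. vec_pval x t \<in> solutions_at Q t"
proof -
  have "\<forall>\<^sub>F t in at_top. \<forall>q\<in>Q. pval (pdot (fst q) x) t \<le> pval (snd q) t \<and>
      pval (pdot (fst q) x) t = vec_pval (fst q) t \<bullet> vec_pval x t"
    using assms
    by (intro eventually_ball_finite ballI eventually_conj eventually_pval_pdot)
       (auto simp: solutions_def le_puiseux_iff[symmetric])
  then show ?thesis by eventually_elim (auto simp: solutions_at_def)
qed

lemma solutions_at_convex: "convex (solutions_at Q t)" and solutions_at_closed: "closed (solutions_at Q t)"
proof -
  have eq: "solutions_at Q t = (\<Inter>(a, b)\<in>Q. {x. vec_pval a t \<bullet> x \<le> pval b t})"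
    by (auto simp: solutions_at_def)
  show "convex (solutions_at Q t)" unfolding eq
    by (intro convex_INT) (auto simp: convex_halfspace_le)
  show "closed (solutions_at Q t)" unfolding eq
    by (intro closed_INT) (auto simp: closed_halfspace_le)
qed

lemma tendsto_log_squeeze:
  assumes V: "0 < V" and C: "0 < C"
    and lo: "\<forall>\<^sub>F t in at_top. pval V t \<le> C * f t" and hi: "\<forall>\<^sub>F t in at_top. f t \<le> C * pval V t"
  shows "((\<lambda>t. log t (f t)) \<longlongrightarrow> lead_exp V) at_top"
proof -
  have logC: "((\<lambda>t. log t C) \<longlongrightarrow> 0) at_top"
    unfolding log_def by (intro real_tendsto_divide_at_top[OF tendsto_const] ln_at_top)
  have pos: "\<forall>\<^sub>F t in at_top. 0 < pval V t" using V by (simp add: less_puiseux_iff)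
  note lim = tendsto_log_pval[OF V]
  show ?thesis
  proof (rule tendsto_sandwich)
    show "((\<lambda>t. log t (pval V t) - log t C) \<longlongrightarrow> lead_exp V) at_top"
      using tendsto_diff[OF lim logC] by simp
    show "((\<lambda>t. log t (pval V t) + log t C) \<longlongrightarrow> lead_exp V) at_top"
      using tendsto_add[OF lim logC] by simp
    show "\<forall>\<^sub>F t in at_top. log t (pval V t) - log t C \<le> log t (f t)"
      using lo pos eventually_gt_at_top[of 1]
    proof eventually_elim
      case (elim t)
      then have "0 < C * f t" by linarith
      then have f: "0 < f t" using C by (simp add: zero_less_mult_iff)
      have "log t (pval V t) \<le> log t (C * f t)" using elim by simp
      then show ?case using C f by (simp add: log_mult_pos)
    qed
    show "\<forall>\<^sub>F t in at_top. log t (f t) \<le> log t (pval V t) + log t C"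
      using lo hi pos eventually_gt_at_top[of 1]
    proof eventually_elim
      case (elim t)
      then have "0 < C * f t" by linarith
      then have f: "0 < f t" using C by (simp add: zero_less_mult_iff)
      have "log t (f t) \<le> log t (C * pval V t)" using elim f by simp
      then show ?case using C elim by (simp add: log_mult_pos)
    qed
  qed
qed

text \<open>
  A family of feasible points whose cost and objective are within a constant factor of the optimum
  has the same logarithmic limit as the optimum. Both central paths are such families, for every
  coordinate and, in the logarithmic case, for every slack.
\<close>

lemma tendsto_log_near_optimal:
  assumes Q: "finite Q" "0 \<in> solutions Q" and h: "0 \<le> h"
    and x: "optimal_point (solutions Q) c g \<epsilon> x" "0 < h + pdot g x"
    and C: "1 \<le> C"
    and z: "\<forall>\<^sub>F t in at_top. z t \<in> solutions_at Q t \<and> vec_pval c t \<bullet> z t \<le> C * pval \<epsilon> t \<and>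
      (\<forall>p\<in>solutions_at Q t. vec_pval c t \<bullet> p \<le> pval \<epsilon> t \<longrightarrow>
        pval h t + vec_pval g t \<bullet> p \<le> C * (pval h t + vec_pval g t \<bullet> z t))"
  shows "((\<lambda>t. log t (pval h t + vec_pval g t \<bullet> z t)) \<longlongrightarrow> lead_exp (h + pdot g x)) at_top"
proof (rule tendsto_log_squeeze[OF x(2), of C])
  show "0 < C" using C by simp
  have V: "\<forall>\<^sub>F t in at_top. pval (h + pdot g x) t = pval h t + vec_pval g t \<bullet> vec_pval x t"
    using eventually_pval_add[of h "pdot g x"] eventually_pval_pdot[of g x] by eventually_elim simp
  have x_in: "x \<in> solutions Q" "pdot c x \<le> \<epsilon>" using x(1) by (simp_all add: optimal_point_def)
  have cx: "\<forall>\<^sub>F t in at_top. pval (pdot c x) t \<le> pval \<epsilon> t" using x_in(2) by (simp add: le_puiseux_iff)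
  show "\<forall>\<^sub>F t in at_top. pval (h + pdot g x) t \<le> C * (pval h t + vec_pval g t \<bullet> z t)"
    using V cx eventually_pval_pdot[of c x] solutions_eventually[OF Q(1) x_in(1)] z
    by eventually_elim simp
  have h_t: "\<forall>\<^sub>F t in at_top. 0 \<le> pval h t" using h by (simp add: le_puiseux_iff)
  show "\<forall>\<^sub>F t in at_top. pval h t + vec_pval g t \<bullet> z t \<le> C * pval (h + pdot g x) t"
    using V h_t z solutions_eventually[OF Q] optimum_eventually[OF Q(1) x(1)] eventually_pval_pdot[of g x]
  proof eventually_elim
    case (elim t)
    have "(1 / C) *\<^sub>R z t + (1 - 1 / C) *\<^sub>R 0 \<in> solutions_at Q t"
      using elim C by (intro convexD[OF solutions_at_convex]) auto
    then have "(1 / C) *\<^sub>R z t \<in> solutions_at Q t" by simp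
    moreover have "vec_pval c t \<bullet> ((1 / C) *\<^sub>R z t) \<le> pval \<epsilon> t"
      using elim C by (simp add: field_simps)
    ultimately have "vec_pval g t \<bullet> ((1 / C) *\<^sub>R z t) \<le> pval (pdot g x) t" using elim(5) by blast
    then have "vec_pval g t \<bullet> z t \<le> C * pval (pdot g x) t" using C by (simp add: field_simps)
    moreover have "pval h t \<le> C * pval h t" using C elim by (simp add: mult_le_cancel_right1)
    ultimately show ?case using elim by (simp add: distrib_left)
  qed
qed

section \<open>Strictly feasible points\<close>

text \<open>
  If \<open>0\<close> is not strictly feasible for the row \<open>(a, b)\<close>, then \<open>b = 0\<close>, and a point with \<open>\<langle>a, x\<rangle> \<noteq> 0\<close> is.
\<close>

lemma strict_row:
  fixes Q :: "((puiseux ^ 'n) \<times> puiseux) set"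
  assumes reg: "tropical_regular (vec_val ` solutions Q)" and zero: "0 \<in> solutions Q"
    and ab: "(a, b) \<in> Q" "a \<noteq> 0"
  shows "\<exists>x\<in>solutions Q. pdot a x < b"
proof -
  obtain x where x: "x \<in> solutions Q" "pdot a x \<noteq> 0"
    using regular_imp_nonvanishing[OF reg _ ab(2)] zero by blast
  have b: "pdot a x \<le> b" "pdot a 0 \<le> b" using x(1) zero ab(1) unfolding solutions_def by blast+
  show ?thesis
  proof (cases "b = 0")
    case True
    then show ?thesis using x b by (intro bexI[of _ x]) auto
  next
    case False
    then show ?thesis using b zero by (intro bexI[of _ 0]) auto
  qed
qed

lemma strict_point:
  fixes Q :: "((puiseux ^ 'n) \<times> puiseux) set"
  assumes Q: "finite Q" and reg: "tropical_regular (vec_val ` solutions Q)" and zero: "0 \<in> solutions Q"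
  shows "\<exists>x\<in>solutions Q. \<forall>(a, b)\<in>Q. a \<noteq> 0 \<longrightarrow> pdot a x < b"
proof -
  have "\<exists>x\<in>solutions Q. \<forall>(a, b)\<in>S. a \<noteq> 0 \<longrightarrow> pdot a x < b" if "S \<subseteq> Q" for S
    using finite_subset[OF that Q] that
  proof (induction S)
    case empty
    then show ?case using zero by blast
  next
    case (insert q S)
    then obtain x where x: "x \<in> solutions Q" "\<forall>(a, b)\<in>S. a \<noteq> 0 \<longrightarrow> pdot a x < b" by blast
    obtain a b where q: "q = (a, b)" by (cases q)
    obtain x' where x': "x' \<in> solutions Q" "a \<noteq> 0 \<longrightarrow> pdot a x' < b"
      using strict_row[OF reg zero, of a b] insert.prems q zero by blast
    \<comment> \<open>The midpoint is strictly feasible for every row for which one of the two points is.\<close>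
    define y where "y = (1 / 2) *s (x + x')"
    have y: "pdot a' y = (pdot a' x + pdot a' x') / 2" for a'
      by (simp add: y_def pdot_scale_right pdot_add_right)
    have le: "pdot a' x \<le> b' \<and> pdot a' x' \<le> b'" if "(a', b') \<in> Q" for a' b'
      using x(1) x'(1) that by (auto simp: solutions_def)
    have "y \<in> solutions Q" unfolding solutions_def
    proof safe
      fix a' b' assume "(a', b') \<in> Q"
      then have "pdot a' x + pdot a' x' \<le> b' + b'" using le by (blast intro: add_mono)
      then show "pdot a' y \<le> b'" by (simp add: y)
    qed
    moreover have "pdot a' y < b'" if "(a', b') \<in> insert q S" "a' \<noteq> 0" for a' b'
    proof -
      have "pdot a' x < b' \<or> pdot a' x' < b'" using that x(2) x'(2) q by auto
      moreover have "pdot a' x \<le> b'" "pdot a' x' \<le> b'" using le that insert.prems by auto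
      ultimately have "pdot a' x + pdot a' x' < b' + b'" by (auto intro: add_less_le_mono add_le_less_mono)
      then show ?thesis by (simp add: y)
    qed
    ultimately show ?case by blast
  qed
  then show ?thesis by blast
qed

lemma strict_point_eventually:
  fixes Q :: "((puiseux ^ 'n) \<times> puiseux) set"
  assumes Q: "finite Q" and reg: "tropical_regular (vec_val ` solutions Q)" and zero: "0 \<in> solutions Q"
  shows "\<forall>\<^sub>F t in at_top. \<exists>z\<in>solutions_at Q t. \<forall>(a, b)\<in>Q. a \<noteq> 0 \<longrightarrow> vec_pval a t \<bullet> z < pval b t"
proof -
  obtain x where x: "x \<in> solutions Q" "\<forall>(a, b)\<in>Q. a \<noteq> 0 \<longrightarrow> pdot a x < b"
    using strict_point[OF assms] by blast
  have "\<forall>\<^sub>F t in at_top. \<forall>q\<in>Q. fst q \<noteq> 0 \<longrightarrow> vec_pval (fst q) t \<bullet> vec_pval x t < pval (snd q) t"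
  proof (intro eventually_ball_finite Q ballI)
    fix q assume q: "q \<in> Q"
    show "\<forall>\<^sub>F t in at_top. fst q \<noteq> 0 \<longrightarrow> vec_pval (fst q) t \<bullet> vec_pval x t < pval (snd q) t"
    proof (cases "fst q = 0")
      case False
      then have "pdot (fst q) x < snd q" using x(2) q by (cases q) auto
      then have "\<forall>\<^sub>F t in at_top. pval (pdot (fst q) x) t < pval (snd q) t" by (simp add: less_puiseux_iff)
      with eventually_pval_pdot[of "fst q" x] show ?thesis by eventually_elim simp
    qed simp
  qed
  with solutions_eventually[OF Q x(1)] show ?thesis
  proof eventually_elim
    case (elim t)
    then show ?case by (intro bexI[of _ "vec_pval x t"]) auto
  qed
qed

lemma interior_solutions_at:
  assumes Q: "finite Q" and z: "z \<in> solutions_at Q t" "\<forall>(a, b)\<in>Q. a \<noteq> 0 \<longrightarrow> vec_pval a t \<bullet> z < pval b t"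
  shows "z \<in> interior (solutions_at Q t)"
proof (rule interiorI)
  let ?U = "\<Inter>(a, b)\<in>{q\<in>Q. fst q \<noteq> 0}. {x. vec_pval a t \<bullet> x < pval b t}"
  show "open ?U" using Q by (intro open_INT) (auto simp: open_halfspace_lt)
  show "z \<in> ?U" using z(2) by auto
  show "?U \<subseteq> solutions_at Q t"
  proof
    fix x assume x: "x \<in> ?U"
    have "vec_pval a t \<bullet> x \<le> pval b t" if ab: "(a, b) \<in> Q" for a b
    proof (cases "a = 0")
      case True
      then show ?thesis using z(1) ab by (auto simp: solutions_at_def)
    next
      case False
      then show ?thesis using x ab by force
    qed
    then show "x \<in> solutions_at Q t" by (auto simp: solutions_at_def)
  qed
qed

section \<open>Comparison of the two tropical central paths\<close>

lemma tendsto_fun: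
  fixes f :: "'a \<Rightarrow> 'b \<Rightarrow> 'c::topological_space"
  assumes "\<And>i. ((\<lambda>t. f t i) \<longlongrightarrow> l i) F"
  shows "(f \<longlongrightarrow> l) F"
proof -
  have "limitin (product_topology (\<lambda>_. euclidean) UNIV) f l F"
    unfolding limitin_componentwise using assms by auto
  then show ?thesis by (simp add: euclidean_product_topology)
qed

lemma puiseux_polyhedron_eq: "puiseux_polyhedron m A b = solutions ((\<lambda>i. (A i, b i)) ` {..<m})"
  by (auto simp: puiseux_polyhedron_def solutions_def pdot_def)

lemma polyhedron_at_eq: "polyhedron_at m A b t = solutions_at ((\<lambda>i. (A i, b i)) ` {..<m}) t"
  by (auto simp: polyhedron_at_def solutions_at_def)

lemma eventually_positive_vec:
  assumes "\<And>j. 0 < c $ j"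
  shows "\<forall>\<^sub>F t in at_top. \<forall>j. 0 < vec_pval c t $ j"
proof -
  have "\<forall>\<^sub>F t in at_top. \<forall>j\<in>UNIV. 0 < pval (c $ j) t"
    using assms by (intro eventually_ball_finite) (auto simp: less_puiseux_iff)
  then show ?thesis by eventually_elim (simp add: vec_pval_def)
qed

text \<open>
  The common description of both tropical paths: coordinate \<open>j\<close> of \<open>F \<mu>\<close> is the valuation of the maximum of \<open>x\<^sub>j\<close> over
  the points of cost at most \<open>\<epsilon>\<close>, for any \<open>\<epsilon>\<close> of valuation \<open>\<mu>\<close>.
\<close>

definition tropical_coordinates :: "(puiseux ^ 'n) set \<Rightarrow> puiseux ^ 'n \<Rightarrow> (real \<Rightarrow> real ^ 'n) \<Rightarrow> bool" where
  "tropical_coordinates P c F \<longleftrightarrow> (\<forall>\<epsilon> j. 0 < \<epsilon> \<longrightarrow> (\<exists>x. optimal_point P c (axis j 1) \<epsilon> x \<and>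
     0 < x $ j \<and> lead_exp (x $ j) = F (lead_exp \<epsilon>) $ j))"

lemma tropical_coordinates_exist:
  assumes Q: "finite Q" and nonneg: "\<And>x j. x \<in> solutions Q \<Longrightarrow> 0 \<le> x $ j" and zero: "0 \<in> solutions Q"
    and c: "\<And>j. 0 < c $ j" and reg: "tropical_regular (vec_val ` solutions Q)"
  shows "\<exists>F. tropical_coordinates (solutions Q) c F \<and> piecewise_linear F"
proof -
  have "\<exists>\<phi>. piecewise_linear \<phi> \<and> (\<forall>\<epsilon>. 0 < \<epsilon> \<longrightarrow>
      (\<exists>x. optimal_point (solutions Q) c (axis j 1) \<epsilon> x \<and> 0 < 0 + pdot (axis j 1) x \<and>
        lead_exp (0 + pdot (axis j 1) x) = \<phi> (lead_exp \<epsilon>)))" for j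
  proof -
    have "axis j (1::puiseux) \<noteq> 0" by (simp add: axis_eq_0_iff)
    then obtain y where y: "y \<in> solutions Q" "y $ j \<noteq> 0"
      using regular_imp_nonvanishing[OF reg] zero by blast
    then have "0 < 0 + pdot (axis j 1) y" using nonneg[OF y(1), of j] by (simp add: pdot_axis)
    from value_function[OF Q nonneg zero c order_refl y(1) this] show ?thesis .
  qed
  then have "\<forall>j. \<exists>\<phi>. piecewise_linear \<phi> \<and> (\<forall>\<epsilon>. 0 < \<epsilon> \<longrightarrow>
      (\<exists>x. optimal_point (solutions Q) c (axis j 1) \<epsilon> x \<and> 0 < x $ j \<and> lead_exp (x $ j) = \<phi> (lead_exp \<epsilon>)))"
    unfolding pdot_axis add_0 by blast
  then obtain \<phi> where \<phi>: "\<And>j. piecewise_linear (\<phi> j)"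
    "\<And>j \<epsilon>. 0 < \<epsilon> \<Longrightarrow> \<exists>x. optimal_point (solutions Q) c (axis j 1) \<epsilon> x \<and> 0 < x $ j \<and>
      lead_exp (x $ j) = \<phi> j (lead_exp \<epsilon>)"
    by metis
  have "tropical_coordinates (solutions Q) c (\<lambda>\<mu>. \<chi> j. \<phi> j \<mu>)"
    using \<phi>(2) by (simp add: tropical_coordinates_def)
  moreover have "piecewise_linear (\<lambda>\<mu>. \<chi> j. \<phi> j \<mu>)" using \<phi>(1) by (intro piecewise_linear_vec) simp
  ultimately show ?thesis by blast
qed

lemma tendsto_log_coordinate:
  fixes z :: "real \<Rightarrow> real ^ 'n"
  assumes Q: "finite Q" and zero: "0 \<in> solutions Q" and F: "tropical_coordinates (solutions Q) c F"
    and \<epsilon>: "0 < \<epsilon>" "lead_exp \<epsilon> = \<mu>" and C: "1 \<le> C"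
    and z: "\<forall>\<^sub>F t in at_top. z t \<in> solutions_at Q t \<and> vec_pval c t \<bullet> z t \<le> C * pval \<epsilon> t \<and>
      (\<forall>p\<in>solutions_at Q t. vec_pval c t \<bullet> p \<le> pval \<epsilon> t \<longrightarrow> (\<forall>j. p $ j \<le> C * z t $ j))"
  shows "((\<lambda>t. log t (z t $ j)) \<longlongrightarrow> F \<mu> $ j) at_top"
proof -
  obtain x where x: "optimal_point (solutions Q) c (axis j 1) \<epsilon> x" "0 < x $ j" "lead_exp (x $ j) = F \<mu> $ j"
    using F \<epsilon> unfolding tropical_coordinates_def by blast
  have ax: "vec_pval (axis j 1) t \<bullet> v = v $ j" if "0 < t" for t and v :: "real ^ 'n"
    using that by (simp add: vec_pval_axis inner_axis')
  have "((\<lambda>t. log t (pval 0 t + vec_pval (axis j 1) t \<bullet> z t)) \<longlongrightarrow> lead_exp (0 + pdot (axis j 1) x)) at_top"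
  proof (rule tendsto_log_near_optimal[OF Q zero order_refl x(1) _ C])
    show "\<forall>\<^sub>F t in at_top. z t \<in> solutions_at Q t \<and> vec_pval c t \<bullet> z t \<le> C * pval \<epsilon> t \<and>
      (\<forall>p\<in>solutions_at Q t. vec_pval c t \<bullet> p \<le> pval \<epsilon> t \<longrightarrow>
        pval 0 t + vec_pval (axis j 1) t \<bullet> p \<le> C * (pval 0 t + vec_pval (axis j 1) t \<bullet> z t))"
      using z eventually_gt_at_top[of 0] by eventually_elim (simp add: ax)
  qed (use x in \<open>simp add: pdot_axis\<close>)
  moreover have "\<forall>\<^sub>F t in at_top. log t (pval 0 t + vec_pval (axis j 1) t \<bullet> z t) = log t (z t $ j)"
    using eventually_gt_at_top[of 0] by eventually_elim (simp add: ax)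
  ultimately show ?thesis using x(3) by (simp add: pdot_axis tendsto_cong)
qed

lemma val_eq_ereal: "0 < \<epsilon> \<Longrightarrow> val \<epsilon> = ereal \<mu> \<longleftrightarrow> lead_exp \<epsilon> = \<mu>"
  by (auto simp: val_def)

lemma tropical_entropic_path:
  fixes M :: "nat \<Rightarrow> puiseux ^ 'n"
  assumes P: "P = puiseux_polyhedron p M d" and nonneg: "\<And>x j. x \<in> P \<Longrightarrow> 0 \<le> x $ j" and zero: "0 \<in> P"
    and c: "\<And>j. 0 < c $ j" and reg: "tropical_regular (vec_val ` P)"
    and F: "tropical_coordinates P c F"
  shows "is_tropical_entropic_path p M d c F"
  unfolding is_tropical_entropic_path_def
proof (intro allI impI)
  fix \<mu> \<epsilon> assume "0 < \<epsilon> \<and> val \<epsilon> = ereal \<mu>"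
  then have \<epsilon>: "0 < \<epsilon>" "lead_exp \<epsilon> = \<mu>" by (auto simp: val_eq_ereal)
  define Q where "Q = (\<lambda>i. (M i, d i)) ` {..<p}"
  have Q: "finite Q" "solutions Q = P" by (simp_all add: Q_def P puiseux_polyhedron_eq)
  note PQ = polyhedron_at_eq[of p M d, folded Q_def]
  have \<epsilon>_t: "\<forall>\<^sub>F t in at_top. 0 < pval \<epsilon> t" using \<epsilon>(1) by (simp add: less_puiseux_iff)
  have zero_t: "\<forall>\<^sub>F t in at_top. 0 \<in> solutions_at Q t"
    using solutions_eventually[OF Q(1), of 0] zero Q(2) by simp
  have "\<forall>\<^sub>F t in at_top. \<forall>j\<in>UNIV. \<forall>x\<in>solutions_at Q t. vec_pval (- axis j 1) t \<bullet> x \<le> pval 0 t"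
  proof (intro eventually_ball_finite ballI)
    fix j :: 'n
    show "\<forall>\<^sub>F t in at_top. \<forall>x\<in>solutions_at Q t. vec_pval (- axis j 1) t \<bullet> x \<le> pval 0 t"
      by (rule valid_inequality_eventually[OF Q(1), of 0])
         (use Q(2) zero nonneg in \<open>simp_all add: pdot_uminus_left pdot_axis\<close>)
  qed simp
  then have nonneg_t: "\<forall>\<^sub>F t in at_top. \<forall>x\<in>solutions_at Q t. \<forall>j. 0 \<le> x $ j"
    using eventually_gt_at_top[of 0] by eventually_elim (simp add: vec_pval_axis inner_axis')
  have prob: "\<forall>\<^sub>F t in at_top. entropic_problem (solutions_at Q t) (vec_pval c t) (pval \<epsilon> t)"
    using strict_point_eventually[OF Q(1)[unfolded Q_def], folded Q_def, unfolded Q(2), OF reg zero]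
      \<epsilon>_t zero_t nonneg_t eventually_positive_vec[of c, OF c]
  proof eventually_elim
    case (elim t)
    then have "interior (solutions_at Q t) \<noteq> {}" using interior_solutions_at[OF Q(1)] by blast
    then show ?case using elim
      by unfold_locales (auto simp: solutions_at_closed solutions_at_convex)
  qed
  define z where "z t = entropic_central_path (solutions_at Q t) (vec_pval c t) (pval \<epsilon> t)" for t
  define C :: real where "C = 2 ^ (CARD('n) + 2)"
  have near: "\<forall>\<^sub>F t in at_top. z t \<in> solutions_at Q t \<and> vec_pval c t \<bullet> z t \<le> C * pval \<epsilon> t \<and>
      (\<forall>p\<in>solutions_at Q t. vec_pval c t \<bullet> p \<le> pval \<epsilon> t \<longrightarrow> (\<forall>j. p $ j \<le> C * z t $ j))"
    using prob \<epsilon>_t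
  proof eventually_elim
    case (elim t)
    interpret entropic_problem "solutions_at Q t" "vec_pval c t" "pval \<epsilon> t" by (rule elim)
    have "2 ^ (CARD('n) + 1) * pval \<epsilon> t \<le> C * pval \<epsilon> t"
      unfolding C_def using elim by (intro mult_right_mono power_increasing) auto
    with barycenter_cost have "vec_pval c t \<bullet> barycenter \<le> C * pval \<epsilon> t" by (rule order_trans)
    then show ?case
      using barycenter_interior interior_subset barycenter_dominates
      unfolding z_def entropic_central_path_eq C_def by blast
  qed
  have C: "1 \<le> C" unfolding C_def by (rule one_le_power) simp
  have lim: "((\<lambda>t. log t (z t $ j)) \<longlongrightarrow> F \<mu> $ j) at_top" for j
    by (rule tendsto_log_coordinate[OF Q(1) _ _ \<epsilon> C near]) (simp_all add: Q(2) zero F)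
  have "((\<lambda>t. vec_log t (z t)) \<longlongrightarrow> F \<mu>) at_top"
    by (rule vec_tendstoI) (simp add: vec_log_def lim)
  moreover have "\<forall>\<^sub>F t in at_top. \<exists>!x. is_entropic_optimum (solutions_at Q t) (vec_pval c t) (pval \<epsilon> t) x"
    using prob by eventually_elim (rule entropic_problem.ex1_entropic_optimum)
  ultimately show "(\<forall>\<^sub>F t in at_top. \<exists>!x. is_entropic_optimum (polyhedron_at p M d t) (vec_pval c t) (pval \<epsilon> t) x) \<and>
     ((\<lambda>t. vec_log t (entropic_central_path (polyhedron_at p M d t) (vec_pval c t) (pval \<epsilon> t))) \<longlongrightarrow> F \<mu>) at_top"
    unfolding PQ z_def by blast
qed

lemma tropical_log_path:
  fixes A :: "nat \<Rightarrow> puiseux ^ 'n"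
  assumes P: "P = {x. \<forall>j. 0 \<le> x $ j} \<inter> puiseux_polyhedron m A b" and rows: "\<And>i. i < m \<Longrightarrow> A i \<noteq> 0"
    and zero: "0 \<in> P" and c: "\<And>j. 0 < c $ j" and reg: "tropical_regular (vec_val ` P)"
    and F: "tropical_coordinates P c F"
  shows "\<exists>G. is_tropical_log_path m A b c G \<and> (\<forall>\<mu>. fst (G \<mu>) = F \<mu>)"
proof -
  \<comment> \<open>Treating \<open>x \<ge> 0\<close> as further rows makes strictly feasible points positive.\<close>
  define Q where "Q = (\<lambda>i. (A i, b i)) ` {..<m} \<union> range (\<lambda>j. (- axis j 1, 0))"
  have finQ: "finite Q" by (simp add: Q_def)
  have Q: "solutions Q = P"
    unfolding P puiseux_polyhedron_eq
    by (simp add: Q_def solutions_def ball_Un split_def pdot_uminus_left pdot_axis) blast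
  have nonneg: "0 \<le> x $ j" if "x \<in> P" for x j using that P by simp
  have b: "0 \<le> b i" if "i < m" for i
    using zero that unfolding Q[symmetric] by (auto simp: Q_def solutions_def)
  have Q_t: "x \<in> solutions_at Q t \<longleftrightarrow> (\<forall>j. 0 \<le> x $ j) \<and> (\<forall>i<m. vec_pval (A i) t \<bullet> x \<le> pval (b i) t)"
    if "0 < t" for x t
    using that by (simp add: Q_def solutions_at_def ball_Un split_def vec_pval_axis inner_axis') blast
  note zeroQ = zero[folded Q] and regQ = reg[folded Q] and FQ = F[folded Q]
  \<comment> \<open>The slacks have tropical value functions for the same reason as the coordinates.\<close>
  have "\<exists>\<psi>. \<forall>\<epsilon>. 0 < \<epsilon> \<longrightarrow> (\<exists>x. optimal_point (solutions Q) c (- A i) \<epsilon> x \<and>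
      0 < b i + pdot (- A i) x \<and> lead_exp (b i + pdot (- A i) x) = \<psi> (lead_exp \<epsilon>))" if i: "i < m" for i
  proof -
    have row: "(A i, b i) \<in> Q" using i by (auto simp: Q_def)
    obtain y where y: "y \<in> solutions Q" "pdot (A i) y < b i"
      using strict_row[OF regQ zeroQ row rows[OF i]] by blast
    then have "0 < b i + pdot (- A i) y" by (simp add: pdot_uminus_left)
    then show ?thesis
      using value_function[OF finQ _ zeroQ c b[OF i] y(1), of "- A i"] nonneg Q by blast
  qed
  then obtain \<psi> where \<psi>: "\<And>i \<epsilon>. i < m \<Longrightarrow> 0 < \<epsilon> \<Longrightarrow> \<exists>x. optimal_point (solutions Q) c (- A i) \<epsilon> x \<and>
      0 < b i + pdot (- A i) x \<and> lead_exp (b i + pdot (- A i) x) = \<psi> i (lead_exp \<epsilon>)"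
    by metis
  define G where "G \<mu> = (F \<mu>, (\<lambda>i. if i < m then \<psi> i \<mu> else 0), (\<chi> j. \<mu> - F \<mu> $ j),
    (\<lambda>i. if i < m then \<mu> - \<psi> i \<mu> else 0))" for \<mu>
  have "is_tropical_log_path m A b c G"
    unfolding is_tropical_log_path_def
  proof (intro allI impI)
    fix \<mu> \<epsilon> assume "0 < \<epsilon> \<and> val \<epsilon> = ereal \<mu>"
    then have \<epsilon>: "0 < \<epsilon>" "lead_exp \<epsilon> = \<mu>" by (auto simp: val_eq_ereal)
    have \<epsilon>_t: "\<forall>\<^sub>F t in at_top. 0 < pval \<epsilon> t" using \<epsilon>(1) by (simp add: less_puiseux_iff)
    let ?is = "\<lambda>t. is_log_central_point m (\<lambda>i. vec_pval (A i) t) (\<lambda>i. pval (b i) t) (vec_pval c t) (pval \<epsilon> t)"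
    define p where "p t = log_central_path m (\<lambda>i. vec_pval (A i) t) (\<lambda>i. pval (b i) t) (vec_pval c t) (pval \<epsilon> t)" for t
    have ex1: "\<forall>\<^sub>F t in at_top. \<exists>!q. ?is t q"
      using strict_point_eventually[OF finQ regQ zeroQ] \<epsilon>_t eventually_positive_vec[of c, OF c]
        eventually_gt_at_top[of 0]
    proof eventually_elim
      case (elim t)
      then obtain z where z: "\<forall>(a, b)\<in>Q. a \<noteq> 0 \<longrightarrow> vec_pval a t \<bullet> z < pval b t" by blast
      have "0 < z $ j" for j
      proof -
        have "(- axis j 1, 0) \<in> Q" "- axis j (1::puiseux) \<noteq> 0" by (auto simp: Q_def axis_eq_0_iff)
        then have "vec_pval (- axis j 1) t \<bullet> z < pval 0 t" using z by blast
        then show ?thesis using elim by (simp add: vec_pval_axis inner_axis')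
      qed
      moreover have "vec_pval (A i) t \<bullet> z < pval (b i) t" if "i < m" for i
        using z rows[OF that] that by (force simp: Q_def)
      ultimately have "\<exists>q. ?is t q" using elim by (intro log_central_point_exists) auto
      then show ?case using log_central_point_unique elim(2) by blast
    qed
    then have isp: "\<forall>\<^sub>F t in at_top. ?is t (p t)"
      by eventually_elim (unfold p_def log_central_path_def, rule theI')
    define x w s y where "x t = fst (p t)" and "w t = fst (snd (p t))"
      and "s t = fst (snd (snd (p t)))" and "y t = snd (snd (snd (p t)))" for t
    have p_eq: "p t = (x t, w t, s t, y t)" for t by (simp add: x_def w_def s_def y_def)
    note isp = isp[unfolded p_eq]
    have b_t: "\<forall>\<^sub>F t in at_top. \<forall>i\<in>{..<m}. 0 \<le> pval (b i) t"
      using b by (intro eventually_ball_finite) (auto simp: le_puiseux_iff)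
    define C where "C = real (CARD('n) + m + 1)"
    have C: "1 \<le> C" by (simp add: C_def)
    have near: "\<forall>\<^sub>F t in at_top. x t \<in> solutions_at Q t \<and> vec_pval c t \<bullet> x t \<le> C * pval \<epsilon> t \<and>
      (\<forall>p\<in>solutions_at Q t. vec_pval c t \<bullet> p \<le> pval \<epsilon> t \<longrightarrow> (\<forall>j. p $ j \<le> C * x t $ j) \<and>
        (\<forall>i<m. pval (b i) t - vec_pval (A i) t \<bullet> p \<le> C * (pval (b i) t - vec_pval (A i) t \<bullet> x t)))"
      using isp b_t eventually_positive_vec[of c, OF c] eventually_gt_at_top[of 0] \<epsilon>_t
    proof eventually_elim
      case (elim t)
      note D = log_central_pointD[OF elim(1)]
      have x_in: "x t \<in> solutions_at Q t"
        unfolding Q_t[OF elim(4)] using D(1,3,7) by (fastforce simp: less_imp_le)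
      have "vec_pval c t \<bullet> x t \<le> real (CARD('n) + m) * pval \<epsilon> t"
        by (rule log_central_point_bounds(1)[OF elim(1)]) (use elim in auto)
      also have "\<dots> \<le> C * pval \<epsilon> t" using elim by (intro mult_right_mono) (auto simp: C_def)
      finally have cost: "vec_pval c t \<bullet> x t \<le> C * pval \<epsilon> t" .
      have "(\<forall>j. p $ j \<le> C * x t $ j) \<and>
        (\<forall>i<m. pval (b i) t - vec_pval (A i) t \<bullet> p \<le> C * (pval (b i) t - vec_pval (A i) t \<bullet> x t))"
        if p: "p \<in> solutions_at Q t" "vec_pval c t \<bullet> p \<le> pval \<epsilon> t" for p
      proof (intro conjI allI impI)
        note p' = p[unfolded Q_t[OF elim(4)]]
        show "p $ j \<le> C * x t $ j" for j unfolding C_def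
          by (rule log_central_point_bounds(2)[OF elim(1)]) (use elim p' in auto)
        show "pval (b i) t - vec_pval (A i) t \<bullet> p \<le> C * (pval (b i) t - vec_pval (A i) t \<bullet> x t)" if i: "i < m" for i
          unfolding C_def D(7)[OF i, symmetric]
          by (rule log_central_point_bounds(3)[OF elim(1)]) (use elim p' i in auto)
      qed
      with x_in cost show ?case by blast
    qed
    have log_\<epsilon>: "((\<lambda>t. log t (pval \<epsilon> t)) \<longlongrightarrow> \<mu>) at_top" using tendsto_log_pval[OF \<epsilon>(1)] \<epsilon>(2) by simp
    have x_lim: "((\<lambda>t. log t (x t $ j)) \<longlongrightarrow> F \<mu> $ j) at_top" for j
    proof (rule tendsto_log_coordinate[OF finQ zeroQ FQ \<epsilon> C])
      show "\<forall>\<^sub>F t in at_top. x t \<in> solutions_at Q t \<and> vec_pval c t \<bullet> x t \<le> C * pval \<epsilon> t \<and>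
        (\<forall>p\<in>solutions_at Q t. vec_pval c t \<bullet> p \<le> pval \<epsilon> t \<longrightarrow> (\<forall>j. p $ j \<le> C * x t $ j))"
        using near by eventually_elim blast
    qed
    have w_lim: "((\<lambda>t. log t (w t i)) \<longlongrightarrow> \<psi> i \<mu>) at_top" if i: "i < m" for i
    proof -
      obtain v where v: "optimal_point (solutions Q) c (- A i) \<epsilon> v" "0 < b i + pdot (- A i) v"
        "lead_exp (b i + pdot (- A i) v) = \<psi> i \<mu>"
        using \<psi>[OF i \<epsilon>(1)] \<epsilon>(2) by blast
      have "((\<lambda>t. log t (pval (b i) t + vec_pval (- A i) t \<bullet> x t)) \<longlongrightarrow> lead_exp (b i + pdot (- A i) v)) at_top"
      proof (rule tendsto_log_near_optimal[OF finQ zeroQ b[OF i] v(1,2) C])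
        show "\<forall>\<^sub>F t in at_top. x t \<in> solutions_at Q t \<and> vec_pval c t \<bullet> x t \<le> C * pval \<epsilon> t \<and>
          (\<forall>p\<in>solutions_at Q t. vec_pval c t \<bullet> p \<le> pval \<epsilon> t \<longrightarrow>
            pval (b i) t + vec_pval (- A i) t \<bullet> p \<le> C * (pval (b i) t + vec_pval (- A i) t \<bullet> x t))"
          using near by eventually_elim (use i in simp)
      qed
      moreover have "\<forall>\<^sub>F t in at_top. log t (pval (b i) t + vec_pval (- A i) t \<bullet> x t) = log t (w t i)"
        using isp by eventually_elim (simp add: log_central_pointD(7)[OF _ i])
      ultimately show ?thesis using v(3) by (simp add: tendsto_cong)
    qed
    have s_lim: "((\<lambda>t. log t (s t $ j)) \<longlongrightarrow> \<mu> - F \<mu> $ j) at_top" for j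
    proof (rule Lim_transform_eventually[OF tendsto_diff[OF log_\<epsilon> x_lim]])
      show "\<forall>\<^sub>F t in at_top. log t (pval \<epsilon> t) - log t (x t $ j) = log t (s t $ j)"
        using isp
      proof eventually_elim
        case (elim t)
        note D = log_central_pointD[OF elim]
        show ?case unfolding D(9)[of j, symmetric] using D(1,2)[of j] by (simp add: log_mult_pos)
      qed
    qed
    have y_lim: "((\<lambda>t. log t (y t i)) \<longlongrightarrow> \<mu> - \<psi> i \<mu>) at_top" if i: "i < m" for i
    proof (rule Lim_transform_eventually[OF tendsto_diff[OF log_\<epsilon> w_lim[OF i]]])
      show "\<forall>\<^sub>F t in at_top. log t (pval \<epsilon> t) - log t (w t i) = log t (y t i)"
        using isp
      proof eventually_elim
        case (elim t)
        note D = log_central_pointD[OF elim]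
        show ?case unfolding D(10)[OF i, symmetric] using D(3,4)[OF i] by (simp add: log_mult_pos)
      qed
    qed
    have pad: "\<forall>\<^sub>F t in at_top. 0 = log t (w t i)" "\<forall>\<^sub>F t in at_top. 0 = log t (y t i)" if "m \<le> i" for i
      using isp by (eventually_elim, simp add: log_central_pointD(5,6)[OF _ that] log_def)+
    have "((\<lambda>t. log_primal_dual t (x t, w t, s t, y t)) \<longlongrightarrow> G \<mu>) at_top"
      unfolding log_primal_dual_def G_def prod.case
    proof (intro tendsto_Pair tendsto_fun)
      show "((\<lambda>t. vec_log t (x t)) \<longlongrightarrow> F \<mu>) at_top"
        by (rule vec_tendstoI) (simp add: vec_log_def x_lim)
      show "((\<lambda>t. vec_log t (s t)) \<longlongrightarrow> (\<chi> j. \<mu> - F \<mu> $ j)) at_top"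
        by (rule vec_tendstoI) (simp add: vec_log_def s_lim)
      show "((\<lambda>t. log t (w t i)) \<longlongrightarrow> (if i < m then \<psi> i \<mu> else 0)) at_top" for i
        using w_lim[of i] Lim_transform_eventually[OF tendsto_const pad(1)[of i]] by simp
      show "((\<lambda>t. log t (y t i)) \<longlongrightarrow> (if i < m then \<mu> - \<psi> i \<mu> else 0)) at_top" for i
        using y_lim[of i] Lim_transform_eventually[OF tendsto_const pad(2)[of i]] by simp
    qed
    with ex1 show "(\<forall>\<^sub>F t in at_top. \<exists>!q. ?is t q) \<and> ((\<lambda>t. log_primal_dual t (log_central_path m
        (\<lambda>i. vec_pval (A i) t) (\<lambda>i. pval (b i) t) (vec_pval c t) (pval \<epsilon> t))) \<longlongrightarrow> G \<mu>) at_top"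
      unfolding p_def[symmetric] p_eq by blast
  qed
  moreover have "fst (G \<mu>) = F \<mu>" for \<mu> by (simp add: G_def)
  ultimately show ?thesis by blast
qed

theorem corollary7:
  fixes p :: nat and M :: "nat \<Rightarrow> puiseux ^ 'n" and d :: "nat \<Rightarrow> puiseux"
    and P :: "(puiseux ^ 'n) set" and c :: "puiseux ^ 'n"
  assumes "P = puiseux_polyhedron p M d"
    and "P \<subseteq> {x. \<forall>j. 0 \<le> x $ j}" and "0 \<in> P"
    and "tropical_regular (vec_val ` P)"
    and "\<forall>j. 0 < c $ j"
  shows "\<exists>F. is_tropical_entropic_path p M d c F \<and> piecewise_linear F \<and>
    (\<forall>m A b. P = {x. \<forall>j. 0 \<le> x $ j} \<inter> puiseux_polyhedron m A b \<and> (\<forall>i<m. A i \<noteq> 0) \<longrightarrow>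
       (\<exists>G. is_tropical_log_path m A b c G \<and> (\<forall>\<mu>. fst (G \<mu>) = F \<mu>)))"
proof -
  have nonneg: "0 \<le> x $ j" if "x \<in> P" for x j using assms(2) that by blast
  have c: "0 < c $ j" for j using assms(5) by blast
  have "\<exists>F. tropical_coordinates P c F \<and> piecewise_linear F"
    using tropical_coordinates_exist[of "(\<lambda>i. (M i, d i)) ` {..<p}" c] nonneg c assms(3,4)
    unfolding assms(1) puiseux_polyhedron_eq by simp
  then obtain F where F: "tropical_coordinates P c F" "piecewise_linear F" by blast
  have "is_tropical_entropic_path p M d c F"
    by (rule tropical_entropic_path[OF assms(1) nonneg assms(3) c assms(4) F(1)])
  moreover have "\<exists>G. is_tropical_log_path m A b c G \<and> (\<forall>\<mu>. fst (G \<mu>) = F \<mu>)"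
    if "P = {x. \<forall>j. 0 \<le> x $ j} \<inter> puiseux_polyhedron m A b" "\<forall>i<m. A i \<noteq> 0" for m A b
    by (rule tropical_log_path[OF that(1) _ assms(3) c assms(4) F(1)]) (use that(2) in blast)
  ultimately show ?thesis using F(2) by blast
qed

end
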